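(* Every diagram of type (III, III) is $C^{\infty}$-equivalent to a diagram in the following normal form: $$f_{1}(x_1, y_1)=x_{1}+y_{1},\quad \gamma_{1}(x_1,y_1)=(x_{1}, y_{1}^{2}),$$ $$f_{2}(x_2, y_2)=x_{2}+y_{2}+\theta (x_{2}, y_{2}),\quad \gamma_{2}(x_2,y_2)=(x_{2}^{2}, y_{2}),$$ where $\theta$ is an arbitrary function germ in the maximal ideal $\mathcal{M}_{x_{2}, y_{2}}$ (of the ring of smooth function germs on $(\mathbb{R}^2,0)$ in the variables $(x_2,y_2)$) satisfying $\theta (x_{2}, 0)=\theta (0, y_{2})=0$.
   Context: One considers diagrams of $C^{\infty}$ map germs $(\mathbb{R},0) \xleftarrow{f_1} (\mathbb{R}^{2},0) \xrightarrow{\gamma_1} (\mathbb{R}^2,0) \xleftarrow{\gamma_2} (\mathbb{R}^{2},0) \xrightarrow{f_2} (\mathbb{R},0)$. Two such diagrams $(f_1^{j}, \gamma_1^{j}; f_2^{j}, \gamma_2^{j})$, $j=1,2$, are $C^{\infty}$-equivalent if there exist $C^{\infty}$-diffeomorphism germs $h_i:(\mathbb{R},0)\to(\mathbb{R},0)$, $H_i:(\mathbb{R}^2,0)\to(\mathbb{R}^2,0)$ ($i=1,2$) and $K:(\mathbb{R}^2,0)\to(\mathbb{R}^2,0)$ with $h_i\circ f_i^1 = f_i^2\circ H_i$ and $K\circ\gamma_i^1 = \gamma_i^2\circ H_i$ for $i=1,2$. A pair $(f,\gamma)$, $(\mathbb{R},0)\xleftarrow{f}(\mathbb{R}^2,0)\xrightarrow{\gamma}(\mathbb{R}^2,0)$,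 is of type (III) if $f$ is a submersion, $\gamma$ is a fold, $f$ restricted to the singular set $S_\gamma$ of $\gamma$ is regular, and $(f,\gamma):(\mathbb{R}^2,0)\to(\mathbb{R}^3,0)$ is regular. A diagram is of type (III, III) if $(f_1,\gamma_1)$ and $(f_2,\gamma_2)$ are both of type (III) and the discriminant curves $\gamma_1(S_{\gamma_1})$ and $\gamma_2(S_{\gamma_2})$ are transversal at $0$. *)

theory Defs
  imports "HOL-Analysis.Analysis"
begin

fun iter_dd :: "'a::real_normed_vector list \<Rightarrow> ('a \<Rightarrow> 'b::real_normed_vector) \<Rightarrow> 'a \<Rightarrow> 'b" where
  "iter_dd [] f = f"
| "iter_dd (v # vs) f = (\<lambda>x. frechet_derivative (iter_dd vs f) (at x) v)"

definition smooth_on :: "'a::real_normed_vector set \<Rightarrow> ('a \<Rightarrow> 'b::real_normed_vector) \<Rightarrow> bool" where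
  "smooth_on U f \<longleftrightarrow> open U \<and> (\<forall>vs. \<forall>x\<in>U. iter_dd vs f differentiable (at x))"

definition smooth_germ :: "('a::real_normed_vector \<Rightarrow> 'b::real_normed_vector) \<Rightarrow> bool" where
  "smooth_germ f \<longleftrightarrow> (\<exists>U. 0 \<in> U \<and> smooth_on U f)"

definition diffeo_germ :: "('a::real_normed_vector \<Rightarrow> 'a) \<Rightarrow> bool" where
  "diffeo_germ h \<longleftrightarrow> h 0 = 0 \<and> smooth_germ h \<and>
     (\<exists>g. g 0 = 0 \<and> smooth_germ g \<and> (\<forall>\<^sub>F x in nhds 0. g (h x) = x) \<and> (\<forall>\<^sub>F y in nhds 0. h (g y) = y))"

definition fold_germ :: "(real \<times> real \<Rightarrow> real \<times> real) \<Rightarrow> bool" where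
  "fold_germ \<gamma> \<longleftrightarrow> \<gamma> 0 = 0 \<and> smooth_germ \<gamma> \<and>
     (\<exists>\<phi> \<psi>. diffeo_germ \<phi> \<and> diffeo_germ \<psi> \<and>
        (\<forall>\<^sub>F p in nhds 0. \<psi> (\<gamma> p) = (\<lambda>(x, y). (x, y ^ 2)) (\<phi> p)))"

definition sing_set :: "(real \<times> real \<Rightarrow> real \<times> real) \<Rightarrow> (real \<times> real) set" where
  "sing_set \<gamma> = {p. \<not> surj (frechet_derivative \<gamma> (at p))}"

definition param_curve :: "(real \<times> real) set \<Rightarrow> (real \<Rightarrow> real \<times> real) \<Rightarrow> bool" where
  "param_curve S c \<longleftrightarrow> c 0 = 0 \<and> smooth_germ c \<and> frechet_derivative c (at 0) 1 \<noteq> 0 \<and>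
     (\<exists>U \<epsilon>. open U \<and> 0 \<in> U \<and> \<epsilon> > 0 \<and> c ` {-\<epsilon><..<\<epsilon>} \<subseteq> U \<and> S \<inter> U = c ` {-\<epsilon><..<\<epsilon>})"

definition typeIII :: "(real \<times> real \<Rightarrow> real) \<Rightarrow> (real \<times> real \<Rightarrow> real \<times> real) \<Rightarrow> bool" where
  "typeIII f \<gamma> \<longleftrightarrow>
     f 0 = 0 \<and> smooth_germ f \<and> surj (frechet_derivative f (at 0)) \<comment> \<open>f submersion\<close>
     \<and> fold_germ \<gamma>
     \<and> (\<exists>c. param_curve (sing_set \<gamma>) c \<and> frechet_derivative (f \<circ> c) (at 0) 1 \<noteq> 0) \<comment> \<open>f|S regular\<close>
     \<and> inj (frechet_derivative (\<lambda>p. (f p, \<gamma> p)) (at 0))"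

definition discr_transversal :: "(real \<times> real \<Rightarrow> real \<times> real) \<Rightarrow> (real \<times> real \<Rightarrow> real \<times> real) \<Rightarrow> bool" where
  "discr_transversal \<gamma>1 \<gamma>2 \<longleftrightarrow>
     (\<exists>c1 c2. param_curve (sing_set \<gamma>1) c1 \<and> param_curve (sing_set \<gamma>2) c2 \<and>
        (let u = frechet_derivative (\<gamma>1 \<circ> c1) (at 0) 1; v = frechet_derivative (\<gamma>2 \<circ> c2) (at 0) 1
         in fst u * snd v - snd u * fst v \<noteq> 0))"

definition typeIII_III ::
  "(real \<times> real \<Rightarrow> real) \<Rightarrow> (real \<times> real \<Rightarrow> real \<times> real) \<Rightarrow>
   (real \<times> real \<Rightarrow> real) \<Rightarrow> (real \<times> real \<Rightarrow> real \<times> real) \<Rightarrow> bool" where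
  "typeIII_III f1 \<gamma>1 f2 \<gamma>2 \<longleftrightarrow> typeIII f1 \<gamma>1 \<and> typeIII f2 \<gamma>2 \<and> discr_transversal \<gamma>1 \<gamma>2"

definition diagram_equiv ::
  "(real \<times> real \<Rightarrow> real) \<Rightarrow> (real \<times> real \<Rightarrow> real \<times> real) \<Rightarrow>
   (real \<times> real \<Rightarrow> real) \<Rightarrow> (real \<times> real \<Rightarrow> real \<times> real) \<Rightarrow>
   (real \<times> real \<Rightarrow> real) \<Rightarrow> (real \<times> real \<Rightarrow> real \<times> real) \<Rightarrow>
   (real \<times> real \<Rightarrow> real) \<Rightarrow> (real \<times> real \<Rightarrow> real \<times> real) \<Rightarrow> bool" where
  "diagram_equiv f1 \<gamma>1 f2 \<gamma>2 g1 \<delta>1 g2 \<delta>2 \<longleftrightarrow>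
     (\<exists>(h1 :: real \<Rightarrow> real) (h2 :: real \<Rightarrow> real) H1 H2 K.
        diffeo_germ h1 \<and> diffeo_germ h2 \<and> diffeo_germ H1 \<and> diffeo_germ H2 \<and> diffeo_germ K \<and>
        (\<forall>\<^sub>F p in nhds 0. h1 (f1 p) = g1 (H1 p)) \<and>
        (\<forall>\<^sub>F p in nhds 0. h2 (f2 p) = g2 (H2 p)) \<and>
        (\<forall>\<^sub>F p in nhds 0. K (\<gamma>1 p) = \<delta>1 (H1 p)) \<and>
        (\<forall>\<^sub>F p in nhds 0. K (\<gamma>2 p) = \<delta>2 (H2 p)))"

end

theory Submission
  imports Defs
begin

text \<open>
  Target coordinates bring the discriminants of \<open>\<gamma>1\<close> and \<open>\<gamma>2\<close> to the two axes: after \<open>\<gamma>1\<close> is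
  normalised, transversality makes the discriminant of \<open>\<gamma>2\<close> a graph \<open>X = d(Y)\<close>, which is sheared to
  \<open>X = 0\<close>.  A diffeomorphism preserving a discriminant lifts through the fold, so \<open>\<gamma>1\<close> and \<open>\<gamma>2\<close>
  become \<open>(x, y\<^sup>2)\<close> and \<open>(x\<^sup>2, y)\<close> at once.

  By Whitney's theorem on even functions \<open>h1 (f1 (x, y)) = a (x, y\<^sup>2) + y b (x, y\<^sup>2)\<close> with smooth
  \<open>a\<close>, \<open>b\<close>, so the target map \<open>K = (a, Y b\<^sup>2)\<close> and its lift \<open>(a, y b)\<close> turn \<open>f1\<close> into \<open>x + y\<close>.
  This \<open>K\<close> preserves the line \<open>X = 0\<close> as soon as \<open>h1 (f1 (0, y)) = y k (y\<^sup>2)\<close> is odd; the remaining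
  freedom is therefore one positive function \<open>k\<close>.  The lift of \<open>K\<close> through \<open>\<gamma>2\<close> acts on the two axes
  by explicit formulas in \<open>k\<close>, and the requirement that some \<open>h2\<close> make \<open>f2\<close> equal to the coordinate
  on both axes becomes, for \<open>\<kappa> = ln k\<close>, a linear functional equation
  \<open>\<kappa> (y) = \<rho> (y) + \<kappa> (p (y)) / 4\<close> with \<open>p (0) = p' (0) = 0\<close>.  The obvious series solves it, and the
  solution is smooth because its derivative solves an equation of the same type.

  In Whitney's theorem the values of \<open>a\<close> are only prescribed for \<open>Y \<ge> 0\<close>; a Borel series with the
  Taylor coefficients of \<open>f\<close> along \<open>y = 0\<close> extends them to \<open>Y < 0\<close>.
\<close>

subsection \<open>Smooth maps\<close>

primrec Ck_on :: "nat \<Rightarrow> 'a::real_normed_vector set \<Rightarrow> ('a \<Rightarrow> 'b::real_normed_vector) \<Rightarrow> bool" where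
  "Ck_on 0 U f \<longleftrightarrow> continuous_on U f"
| "Ck_on (Suc n) U f \<longleftrightarrow> (\<forall>x\<in>U. f differentiable (at x)) \<and>
     (\<forall>v. Ck_on n U (\<lambda>x. frechet_derivative f (at x) v))"

lemma differentiable_imp_continuous_on:
  "(\<And>x. x \<in> U \<Longrightarrow> f differentiable (at x)) \<Longrightarrow> continuous_on U f"
  by (simp add: continuous_at_imp_continuous_on differentiable_imp_continuous_within)

lemma Ck_on_cong:
  assumes "open U" "\<And>x. x \<in> U \<Longrightarrow> f x = g x" "Ck_on n U f"
  shows "Ck_on n U g"
  using assms(2,3)
proof (induction n arbitrary: f g)
  case 0
  then show ?case by (metis Ck_on.simps(1) continuous_on_cong)
next
  case (Suc n)
  have g: "(g has_derivative frechet_derivative f (at x)) (at x)" if "x \<in> U" for x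
  proof (rule has_derivative_transform_within_open[OF _ assms(1) that])
    show "(f has_derivative frechet_derivative f (at x)) (at x)"
      using Suc.prems that by (simp add: frechet_derivative_works[symmetric])
  qed (use Suc.prems in auto)
  then have eq: "frechet_derivative f (at x) = frechet_derivative g (at x)" if "x \<in> U" for x
    using frechet_derivative_at that by blast
  have "Ck_on n U (\<lambda>x. frechet_derivative g (at x) v)" for v
    by (rule Suc.IH[of "\<lambda>x. frechet_derivative f (at x) v"]) (use Suc.prems eq in auto)
  then show ?case using g by (auto simp: differentiable_def)
qed

lemma Ck_on_SucI:
  assumes "open U" "\<And>x. x \<in> U \<Longrightarrow> (f has_derivative f' x) (at x)"
    and "\<And>v. Ck_on n U (\<lambda>x. f' x v)"
  shows "Ck_on (Suc n) U f"
proof -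
  have "Ck_on n U (\<lambda>x. frechet_derivative f (at x) v)" for v
    by (rule Ck_on_cong[OF assms(1) _ assms(3)[of v]])
       (use assms(2) frechet_derivative_at in metis)
  then show ?thesis using assms(2) by (auto simp: differentiable_def)
qed

lemma Ck_on_Suc_has_derivative:
  assumes "Ck_on (Suc n) U f" "x \<in> U"
  shows "(f has_derivative frechet_derivative f (at x)) (at x)"
  using assms frechet_derivative_works by auto

lemma Ck_on_SucD: "Ck_on (Suc n) U f \<Longrightarrow> Ck_on n U f"
  by (induction n arbitrary: f) (auto intro: differentiable_imp_continuous_on)

lemma Ck_on_mono: "Ck_on n U f \<Longrightarrow> m \<le> n \<Longrightarrow> Ck_on m U f"
  by (induction n) (auto simp: le_Suc_eq simp del: Ck_on.simps dest: Ck_on_SucD)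

lemma Ck_on_imp_continuous_on: "Ck_on n U f \<Longrightarrow> continuous_on U f"
  using Ck_on_mono[of n U f 0] by simp

lemma Ck_on_subset: "Ck_on n U f \<Longrightarrow> V \<subseteq> U \<Longrightarrow> Ck_on n V f"
  by (induction n arbitrary: f) (auto intro: continuous_on_subset)

lemma Ck_on_const: "Ck_on n U (\<lambda>x. c)"
  by (induction n arbitrary: c) auto

lemma Ck_on_linear_compose:
  assumes "open U" "bounded_linear L" "Ck_on n U f"
  shows "Ck_on n U (\<lambda>x. L (f x))"
  using assms(3)
proof (induction n arbitrary: f)
  case 0
  then show ?case by (simp add: bounded_linear.continuous_on[OF assms(2)])
next
  case (Suc n)
  show ?case
  proof (rule Ck_on_SucI[OF assms(1)])
    show "((\<lambda>x. L (f x)) has_derivative (\<lambda>v. L (frechet_derivative f (at x) v))) (at x)"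
      if "x \<in> U" for x
      by (rule bounded_linear.has_derivative[OF assms(2) Ck_on_Suc_has_derivative[OF Suc.prems that]])
  qed (use Suc in auto)
qed

lemma Ck_on_ident: "open U \<Longrightarrow> Ck_on n U (\<lambda>x. x)"
  by (cases n) (auto intro!: Ck_on_SucI[where f'="\<lambda>x v. v"] simp del: Ck_on.simps(2) simp: Ck_on_const)

lemma Ck_on_add:
  assumes "open U" "Ck_on n U f" "Ck_on n U g"
  shows "Ck_on n U (\<lambda>x. f x + g x)"
  using assms(2,3)
proof (induction n arbitrary: f g)
  case 0
  then show ?case by (auto intro: continuous_intros)
next
  case (Suc n)
  show ?case
  proof (rule Ck_on_SucI[OF assms(1)])
    show "((\<lambda>x. f x + g x) has_derivative
        (\<lambda>v. frechet_derivative f (at x) v + frechet_derivative g (at x) v)) (at x)" if "x \<in> U" for x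
      using Suc.prems[THEN Ck_on_Suc_has_derivative, OF that] by (rule has_derivative_add)
  qed (use Suc in auto)
qed

lemma Ck_on_bilinear:
  assumes "bounded_bilinear B" "open U" "Ck_on n U f" "Ck_on n U g"
  shows "Ck_on n U (\<lambda>x. B (f x) (g x))"
  using assms(3,4)
proof (induction n arbitrary: f g)
  case 0
  then show ?case
    by (auto intro: bounded_bilinear.continuous_on[OF assms(1)])
next
  case (Suc n)
  show ?case
  proof (rule Ck_on_SucI[OF assms(2)])
    show "((\<lambda>x. B (f x) (g x)) has_derivative
        (\<lambda>v. B (f x) (frechet_derivative g (at x) v) + B (frechet_derivative f (at x) v) (g x))) (at x)"
      if "x \<in> U" for x
      using Suc.prems[THEN Ck_on_Suc_has_derivative, OF that]
      by (rule bounded_bilinear.FDERIV[OF assms(1)])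
    show "Ck_on n U (\<lambda>x. B (f x) (frechet_derivative g (at x) v)
        + B (frechet_derivative f (at x) v) (g x))" for v
      by (intro Ck_on_add[OF assms(2)] Suc.IH) (use Suc.prems Ck_on_SucD in auto)
  qed
qed

lemmas Ck_on_scaleR = Ck_on_bilinear[OF bounded_bilinear_scaleR]
lemmas Ck_on_mult = Ck_on_bilinear[OF bounded_bilinear_mult]

lemma Ck_on_sum:
  assumes "open U" "\<And>i. i \<in> I \<Longrightarrow> Ck_on n U (f i)"
  shows "Ck_on n U (\<lambda>x. \<Sum>i\<in>I. f i x)"
  using assms(2)
  by (induction I rule: infinite_finite_induct) (simp_all add: Ck_on_const Ck_on_add[OF assms(1)])

lemma Ck_on_Pair:
  assumes "open U" "Ck_on n U f" "Ck_on n U g"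
  shows "Ck_on n U (\<lambda>x. (f x, g x))"
  using assms(2,3)
proof (induction n arbitrary: f g)
  case 0
  then show ?case by (auto intro: continuous_intros)
next
  case (Suc n)
  show ?case
  proof (rule Ck_on_SucI[OF assms(1)])
    show "((\<lambda>x. (f x, g x)) has_derivative
        (\<lambda>v. (frechet_derivative f (at x) v, frechet_derivative g (at x) v))) (at x)" if "x \<in> U" for x
      using Suc.prems[THEN Ck_on_Suc_has_derivative, OF that] by (rule has_derivative_Pair)
  qed (use Suc in auto)
qed

lemma linear_euclidean_expansion:
  fixes L :: "'a::euclidean_space \<Rightarrow> 'b::real_vector"
  assumes "linear L"
  shows "L v = (\<Sum>b\<in>Basis. (v \<bullet> b) *\<^sub>R L b)"
proof -
  have "L v = L (\<Sum>b\<in>Basis. (v \<bullet> b) *\<^sub>R b)" by (simp only: euclidean_representation)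
  also have "\<dots> = (\<Sum>b\<in>Basis. (v \<bullet> b) *\<^sub>R L b)"
    by (simp only: linear_sum[OF assms] linear_cmul[OF assms])
  finally show ?thesis .
qed

lemma Ck_on_compose:
  fixes f :: "'a::real_normed_vector \<Rightarrow> 'b::euclidean_space"
    and g :: "'b \<Rightarrow> 'c::real_normed_vector"
  assumes U: "open U" and V: "open V" and "Ck_on n V g" "Ck_on n U f" and sub: "f ` U \<subseteq> V"
  shows "Ck_on n U (\<lambda>x. g (f x))"
  using assms(3,4)
proof (induction n arbitrary: g)
  case 0
  then show ?case using sub continuous_on_compose2 by auto
next
  case (Suc n)
  let ?Df = "\<lambda>x. frechet_derivative f (at x)" and ?Dg = "\<lambda>x. frechet_derivative g (at (f x))"
  show ?case
  proof (rule Ck_on_SucI[OF U])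
    show "((\<lambda>x. g (f x)) has_derivative (\<lambda>v. \<Sum>b\<in>Basis. (?Df x v \<bullet> b) *\<^sub>R ?Dg x b)) (at x)"
      if "x \<in> U" for x
    proof -
      have Dg: "(g has_derivative ?Dg x) (at (f x))"
        using Ck_on_Suc_has_derivative[OF Suc.prems(1)] that sub by auto
      have "((\<lambda>x. g (f x)) has_derivative (\<lambda>v. ?Dg x (?Df x v))) (at x)"
        by (rule has_derivative_compose[OF Ck_on_Suc_has_derivative[OF Suc.prems(2) that] Dg])
      then show ?thesis
        by (simp only: linear_euclidean_expansion[OF has_derivative_linear[OF Dg], symmetric])
    qed
    have "Ck_on n U (\<lambda>x. ?Dg x b)" for b
      by (rule Suc.IH) (use Suc.prems Ck_on_SucD in auto)
    then show "Ck_on n U (\<lambda>x. \<Sum>b\<in>Basis. (?Df x v \<bullet> b) *\<^sub>R ?Dg x b)" for v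
      using Suc.prems(2)
      by (intro Ck_on_sum Ck_on_scaleR Ck_on_linear_compose[OF _ bounded_linear_inner_left] U) auto
  qed
qed

lemma frechet_derivative_real_eq:
  "(f has_real_derivative f') (at x) \<Longrightarrow> frechet_derivative f (at x) 1 = f'"
  using frechet_derivative_at[of f "(*) f'" x] by (metis has_field_derivative_def mult.right_neutral)

lemma Ck_on_Suc_realI:
  fixes f :: "real \<Rightarrow> real"
  assumes "open U" "\<And>x. x \<in> U \<Longrightarrow> (f has_real_derivative f' x) (at x)" "Ck_on n U f'"
  shows "Ck_on (Suc n) U f"
  by (rule Ck_on_SucI[OF assms(1) assms(2)[unfolded has_field_derivative_def]])
     (auto intro!: Ck_on_mult Ck_on_const assms)

lemma Ck_on_Suc_real_iff:
  fixes f :: "real \<Rightarrow> real"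
  assumes "open U"
  shows "Ck_on (Suc n) U f \<longleftrightarrow> (\<forall>x\<in>U. (f has_real_derivative deriv f x) (at x)) \<and> Ck_on n U (deriv f)"
    (is "_ \<longleftrightarrow> ?deriv \<and> _")
proof
  assume f: "Ck_on (Suc n) U f"
  have "f differentiable (at x)" if "x \<in> U" for x using f that by simp
  then have d: ?deriv by (auto simp: real_differentiable_def dest: DERIV_imp_deriv)
  then have "frechet_derivative f (at x) 1 = deriv f x" if "x \<in> U" for x
    using that frechet_derivative_real_eq by blast
  moreover have "Ck_on n U (\<lambda>x. frechet_derivative f (at x) 1)" using f by simp
  ultimately have "Ck_on n U (deriv f)" by (rule Ck_on_cong[OF assms])
  with d show "?deriv \<and> Ck_on n U (deriv f)" by blast
next
  assume "?deriv \<and> Ck_on n U (deriv f)"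
  then show "Ck_on (Suc n) U f" by (intro Ck_on_Suc_realI[OF assms]) auto
qed

lemma iter_dd_append: "iter_dd (vs @ ws) f = iter_dd vs (iter_dd ws f)"
  by (induction vs) auto

lemma Ck_on_all_iter_dd: "\<forall>n. Ck_on n U f \<Longrightarrow> \<forall>n. Ck_on n U (iter_dd vs f)"
proof (induction vs)
  case (Cons v vs)
  then have "Ck_on (Suc n) U (iter_dd vs f)" for n by blast
  then show ?case by simp
qed simp

lemma differentiable_iter_dd_imp_Ck_on:
  assumes "\<forall>vs. \<forall>x\<in>U. iter_dd vs f differentiable (at x)"
  shows "Ck_on n U f"
  using assms
proof (induction n arbitrary: f)
  case 0
  then have "\<forall>x\<in>U. f differentiable (at x)" by (metis iter_dd.simps(1))
  then show ?case by (auto intro: differentiable_imp_continuous_on)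
next
  case (Suc n)
  have "f differentiable (at x)" if "x \<in> U" for x
    using Suc.prems that by (metis iter_dd.simps(1))
  moreover have "Ck_on n U (\<lambda>x. frechet_derivative f (at x) v)" for v
  proof (rule Suc.IH, intro allI)
    show "\<forall>x\<in>U. iter_dd vs (\<lambda>x. frechet_derivative f (at x) v) differentiable (at x)" for vs
      using Suc.prems[rule_format, of _ "vs @ [v]"] by (simp add: iter_dd_append)
  qed
  ultimately show ?case by simp
qed

lemma smooth_on_iff_Ck_on: "smooth_on U f \<longleftrightarrow> open U \<and> (\<forall>n. Ck_on n U f)"
proof -
  have "iter_dd vs f differentiable (at x)" if "\<forall>n. Ck_on n U f" "x \<in> U" for vs x
    using Ck_on_all_iter_dd[OF that(1), of vs] that(2) by (metis Ck_on.simps(2))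
  then show ?thesis
    unfolding smooth_on_def using differentiable_iter_dd_imp_Ck_on by blast
qed

lemma smooth_on_bootstrap:
  assumes "open U" "\<And>x. x \<in> U \<Longrightarrow> (f has_derivative f' x) (at x)"
    and "\<And>n v. Ck_on n U f \<Longrightarrow> Ck_on n U (\<lambda>x. f' x v)"
  shows "smooth_on U f"
proof -
  have "Ck_on n U f" for n
  proof (induction n)
    case 0
    show ?case
      using assms(2) by (auto intro!: differentiable_imp_continuous_on intro: differentiableI)
  next
    case (Suc n)
    then show ?case using Ck_on_SucI assms by blast
  qed
  then show ?thesis using smooth_on_iff_Ck_on assms(1) by blast
qed

lemma smooth_on_imp_open: "smooth_on U f \<Longrightarrow> open U"
  by (simp add: smooth_on_def)

lemma smooth_on_subset: "smooth_on U f \<Longrightarrow> open V \<Longrightarrow> V \<subseteq> U \<Longrightarrow> smooth_on V f"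
  unfolding smooth_on_def by blast

lemma smooth_on_Un: "smooth_on U f \<Longrightarrow> smooth_on V f \<Longrightarrow> smooth_on (U \<union> V) f"
  by (auto simp: smooth_on_def)

lemma smooth_on_cong: "smooth_on U f \<Longrightarrow> (\<And>x. x \<in> U \<Longrightarrow> f x = g x) \<Longrightarrow> smooth_on U g"
  using Ck_on_cong smooth_on_iff_Ck_on by metis

lemma smooth_on_const: "open U \<Longrightarrow> smooth_on U (\<lambda>x. c)"
  by (simp add: smooth_on_iff_Ck_on Ck_on_const)

lemma smooth_on_ident: "open U \<Longrightarrow> smooth_on U (\<lambda>x. x)"
  by (simp add: smooth_on_iff_Ck_on Ck_on_ident)

lemma smooth_on_linear_compose: "bounded_linear L \<Longrightarrow> smooth_on U f \<Longrightarrow> smooth_on U (\<lambda>x. L (f x))"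
  by (simp add: smooth_on_iff_Ck_on Ck_on_linear_compose)

lemmas smooth_on_fst = smooth_on_linear_compose[OF bounded_linear_fst]
lemmas smooth_on_snd = smooth_on_linear_compose[OF bounded_linear_snd]
lemmas smooth_on_minus = smooth_on_linear_compose[OF bounded_linear_minus[OF bounded_linear_ident]]

lemma smooth_on_add: "smooth_on U f \<Longrightarrow> smooth_on U g \<Longrightarrow> smooth_on U (\<lambda>x. f x + g x)"
  by (simp add: smooth_on_iff_Ck_on Ck_on_add)

lemma smooth_on_diff: "smooth_on U f \<Longrightarrow> smooth_on U g \<Longrightarrow> smooth_on U (\<lambda>x. f x - g x)"
  using smooth_on_add[OF _ smooth_on_minus, of U f g] by simp

lemma smooth_on_bilinear:
  "bounded_bilinear B \<Longrightarrow> smooth_on U f \<Longrightarrow> smooth_on U g \<Longrightarrow> smooth_on U (\<lambda>x. B (f x) (g x))"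
  by (simp add: smooth_on_iff_Ck_on Ck_on_bilinear)

lemmas smooth_on_scaleR = smooth_on_bilinear[OF bounded_bilinear_scaleR]
lemmas smooth_on_mult = smooth_on_bilinear[OF bounded_bilinear_mult]

lemma smooth_on_power: "smooth_on U f \<Longrightarrow> smooth_on U (\<lambda>x. f x ^ n)"
  for f :: "'a::real_normed_vector \<Rightarrow> 'b::real_normed_algebra_1"
  by (induction n) (auto intro: smooth_on_mult smooth_on_const smooth_on_imp_open)

lemma smooth_on_sum:
  "open U \<Longrightarrow> (\<And>i. i \<in> I \<Longrightarrow> smooth_on U (f i)) \<Longrightarrow> smooth_on U (\<lambda>x. \<Sum>i\<in>I. f i x)"
  by (simp add: smooth_on_iff_Ck_on Ck_on_sum)

lemma smooth_on_Pair: "smooth_on U f \<Longrightarrow> smooth_on U g \<Longrightarrow> smooth_on U (\<lambda>x. (f x, g x))"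
  by (simp add: smooth_on_iff_Ck_on Ck_on_Pair)

lemmas smooth_on_intros = smooth_on_const smooth_on_ident smooth_on_fst smooth_on_snd smooth_on_minus
  smooth_on_add smooth_on_diff smooth_on_scaleR smooth_on_mult smooth_on_power smooth_on_sum
  smooth_on_Pair

lemma smooth_on_compose:
  fixes f :: "'a::real_normed_vector \<Rightarrow> 'b::euclidean_space"
  shows "smooth_on V g \<Longrightarrow> smooth_on U f \<Longrightarrow> f ` U \<subseteq> V \<Longrightarrow> smooth_on U (\<lambda>x. g (f x))"
  unfolding smooth_on_iff_Ck_on using Ck_on_compose by blast

lemma smooth_on_has_derivative:
  "smooth_on U f \<Longrightarrow> x \<in> U \<Longrightarrow> (f has_derivative frechet_derivative f (at x)) (at x)"
  by (meson Ck_on_Suc_has_derivative smooth_on_iff_Ck_on)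

lemma smooth_on_frechet_derivative:
  "smooth_on U f \<Longrightarrow> smooth_on U (\<lambda>x. frechet_derivative f (at x) v)"
  unfolding smooth_on_iff_Ck_on by (metis Ck_on.simps(2))

lemma smooth_on_iter_dd: "smooth_on U f \<Longrightarrow> smooth_on U (iter_dd vs f)"
  unfolding smooth_on_iff_Ck_on using Ck_on_all_iter_dd by blast

lemma smooth_on_imp_continuous_on: "smooth_on U f \<Longrightarrow> continuous_on U f"
  by (meson Ck_on_imp_continuous_on smooth_on_iff_Ck_on)

lemma smooth_on_has_real_derivative:
  fixes f :: "real \<Rightarrow> real"
  assumes "smooth_on U f" "x \<in> U"
  shows "(f has_real_derivative deriv f x) (at x)"
  using assms unfolding smooth_on_iff_Ck_on by (metis Ck_on_Suc_real_iff)

lemma smooth_on_deriv: "smooth_on U f \<Longrightarrow> smooth_on U (deriv f)" for f :: "real \<Rightarrow> real"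
  unfolding smooth_on_iff_Ck_on by (metis Ck_on_Suc_real_iff)

lemma smooth_on_funpow_deriv: "smooth_on U f \<Longrightarrow> smooth_on U ((deriv ^^ n) f)" for f :: "real \<Rightarrow> real"
  by (induction n) (auto intro: smooth_on_deriv)

lemma smooth_on_exp: "smooth_on UNIV (exp :: real \<Rightarrow> real)"
  by (rule smooth_on_bootstrap[where f'="\<lambda>x v. exp x * v"])
     (auto simp: has_field_derivative_def[symmetric] intro!: Ck_on_mult Ck_on_const derivative_eq_intros)

lemma smooth_on_inverse: "smooth_on (- {0}) (inverse :: real \<Rightarrow> real)"
proof (rule smooth_on_bootstrap[where f'="\<lambda>x v. - v * inverse x * inverse x"])
  show "Ck_on n (- {0}) (\<lambda>x. - v * inverse x * inverse x)"
    if "Ck_on n (- {0}) (inverse :: real \<Rightarrow> real)" for n and v :: real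
    by (intro Ck_on_mult Ck_on_const open_Compl closed_singleton that)
qed (auto intro!: derivative_eq_intros)

lemma smooth_on_ln: "smooth_on {0<..} (ln :: real \<Rightarrow> real)"
proof (rule smooth_on_bootstrap[where f'="\<lambda>x v. inverse x * v"])
  have "Ck_on n {0<..} (inverse :: real \<Rightarrow> real)" for n
    by (rule Ck_on_subset[of n "-{0}"]) (use smooth_on_inverse in \<open>auto simp: smooth_on_iff_Ck_on\<close>)
  then show "Ck_on n {0<..} (\<lambda>x. inverse x * v)" for n and v :: real
    by (intro Ck_on_mult Ck_on_const) auto
qed (auto simp: has_field_derivative_def[symmetric] divide_inverse intro!: derivative_eq_intros)

lemma smooth_on_sqrt: "smooth_on {0<..} sqrt"
proof (rule smooth_on_cong)
  show "smooth_on {0<..} (\<lambda>x::real. exp ((1/2) * ln x))"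
    by (rule smooth_on_compose[OF smooth_on_exp])
       (auto simp del: times_divide_eq_left intro!: smooth_on_mult smooth_on_ln smooth_on_const)
  show "exp ((1/2) * ln x) = sqrt x" if "x \<in> {0<..}" for x
    using that powr_half_sqrt[of x] by (simp add: powr_def)
qed

subsection \<open>Germs\<close>

lemma smooth_germI: "smooth_on U f \<Longrightarrow> 0 \<in> U \<Longrightarrow> smooth_germ f"
  unfolding smooth_germ_def by blast

lemma smooth_germ_common_domain:
  assumes "smooth_germ f" "smooth_germ g"
  obtains U where "0 \<in> U" "smooth_on U f" "smooth_on U g"
proof -
  obtain U V where U: "0 \<in> U" "smooth_on U f" and V: "0 \<in> V" "smooth_on V g"
    using assms unfolding smooth_germ_def by blast
  have "open (U \<inter> V)" using U V by (simp add: open_Int smooth_on_imp_open)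
  then show ?thesis
    using that[of "U \<inter> V"] smooth_on_subset[OF U(2)] smooth_on_subset[OF V(2)] U V by auto
qed

lemma smooth_germ_compose_on:
  fixes f :: "'a::real_normed_vector \<Rightarrow> 'b::euclidean_space"
  assumes "smooth_on V g" "smooth_germ f" "f 0 \<in> V"
  shows "smooth_germ (\<lambda>x. g (f x))"
proof -
  obtain U where U: "0 \<in> U" "smooth_on U f" using assms(2) unfolding smooth_germ_def by blast
  have "open (U \<inter> f -` V)"
    using smooth_on_imp_open[OF U(2)] smooth_on_imp_open[OF assms(1)]
      smooth_on_imp_continuous_on[OF U(2)]
    by (simp add: continuous_open_preimage)
  then have "smooth_on (U \<inter> f -` V) (\<lambda>x. g (f x))"
    by (intro smooth_on_compose[OF assms(1) smooth_on_subset[OF U(2)]]) auto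
  then show ?thesis using U assms(3) by (auto intro: smooth_germI)
qed

lemma smooth_germ_compose:
  fixes f :: "'a::real_normed_vector \<Rightarrow> 'b::euclidean_space"
  assumes "smooth_germ g" "smooth_germ f" "f 0 = 0"
  shows "smooth_germ (\<lambda>x. g (f x))"
  using assms smooth_germ_compose_on[of _ g f] by (auto simp: smooth_germ_def[of g])

lemma smooth_germ_const: "smooth_germ (\<lambda>x. c)"
  by (rule smooth_germI[of UNIV]) (auto intro: smooth_on_const)

lemma smooth_germ_ident: "smooth_germ (\<lambda>x. x)"
  by (rule smooth_germI[of UNIV]) (auto intro: smooth_on_ident)

lemma smooth_germ_linear_compose: "bounded_linear L \<Longrightarrow> smooth_germ f \<Longrightarrow> smooth_germ (\<lambda>x. L (f x))"
  unfolding smooth_germ_def using smooth_on_linear_compose by blast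

lemmas smooth_germ_linear = smooth_germ_linear_compose[OF _ smooth_germ_ident]
lemmas smooth_germ_fst = smooth_germ_linear_compose[OF bounded_linear_fst]
lemmas smooth_germ_snd = smooth_germ_linear_compose[OF bounded_linear_snd]
lemmas smooth_germ_minus = smooth_germ_linear_compose[OF bounded_linear_minus[OF bounded_linear_ident]]

lemma smooth_germ_add: "smooth_germ f \<Longrightarrow> smooth_germ g \<Longrightarrow> smooth_germ (\<lambda>x. f x + g x)"
  by (erule (1) smooth_germ_common_domain) (rule smooth_germI[OF smooth_on_add])

lemma smooth_germ_diff: "smooth_germ f \<Longrightarrow> smooth_germ g \<Longrightarrow> smooth_germ (\<lambda>x. f x - g x)"
  by (erule (1) smooth_germ_common_domain) (rule smooth_germI[OF smooth_on_diff])

lemma smooth_germ_mult: "smooth_germ f \<Longrightarrow> smooth_germ g \<Longrightarrow> smooth_germ (\<lambda>x. f x * g x)"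
  for f :: "'a::real_normed_vector \<Rightarrow> 'b::real_normed_algebra"
  by (erule (1) smooth_germ_common_domain) (rule smooth_germI[OF smooth_on_mult])

lemma smooth_germ_power: "smooth_germ f \<Longrightarrow> smooth_germ (\<lambda>x. f x ^ n)"
  for f :: "'a::real_normed_vector \<Rightarrow> 'b::real_normed_algebra_1"
  unfolding smooth_germ_def using smooth_on_power by blast

lemma smooth_germ_Pair: "smooth_germ f \<Longrightarrow> smooth_germ g \<Longrightarrow> smooth_germ (\<lambda>x. (f x, g x))"
  by (erule (1) smooth_germ_common_domain) (rule smooth_germI[OF smooth_on_Pair])

lemma smooth_germ_sqrt: "smooth_germ f \<Longrightarrow> f 0 > 0 \<Longrightarrow> smooth_germ (\<lambda>x. sqrt (f x))"
  by (rule smooth_germ_compose_on[OF smooth_on_sqrt]) auto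

lemma smooth_germ_ln: "smooth_germ f \<Longrightarrow> f 0 > 0 \<Longrightarrow> smooth_germ (\<lambda>x. ln (f x :: real))"
  by (rule smooth_germ_compose_on[OF smooth_on_ln]) auto

lemma smooth_germ_exp: "smooth_germ f \<Longrightarrow> smooth_germ (\<lambda>x. exp (f x :: real))"
  by (rule smooth_germ_compose_on[OF smooth_on_exp]) auto

lemmas smooth_germ_intros = smooth_germ_const smooth_germ_ident smooth_germ_fst smooth_germ_snd
  smooth_germ_minus smooth_germ_add smooth_germ_diff smooth_germ_mult smooth_germ_power smooth_germ_Pair

lemma smooth_germ_eventually_has_derivative:
  assumes "smooth_germ f"
  shows "\<forall>\<^sub>F x in nhds 0. (f has_derivative frechet_derivative f (at x)) (at x)"
proof -
  obtain U where U: "0 \<in> U" "smooth_on U f" using assms unfolding smooth_germ_def by blast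
  then have "\<forall>\<^sub>F x in nhds 0. x \<in> U" by (intro eventually_nhds_in_open smooth_on_imp_open)
  then show ?thesis by eventually_elim (rule smooth_on_has_derivative[OF U(2)])
qed

lemma smooth_germ_tendsto: "smooth_germ f \<Longrightarrow> (f \<longlongrightarrow> f 0) (nhds 0)"
  using has_derivative_continuous[OF smooth_germ_eventually_has_derivative[THEN eventually_nhds_x_imp_x]]
  by (simp add: continuous_at tendsto_at_iff_tendsto_nhds)

lemma smooth_germ_eventually_pos:
  "smooth_germ f \<Longrightarrow> f 0 > 0 \<Longrightarrow> \<forall>\<^sub>F x in nhds 0. f x > (0::real)"
  by (rule order_tendstoD(1)[OF smooth_germ_tendsto])

lemma smooth_germ_eventually_compose:
  assumes "smooth_germ f" "f 0 = 0" "\<forall>\<^sub>F y in nhds 0. P y"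
  shows "\<forall>\<^sub>F x in nhds 0. P (f x)"
  using smooth_germ_tendsto[OF assms(1)] assms(2,3) eventually_compose_filterlim by fastforce

lemma has_derivative_transform_nhds:
  assumes "(f has_derivative f') (at p)" "\<forall>\<^sub>F x in nhds p. f x = g x"
  shows "(g has_derivative f') (at p)"
  using has_derivative_transform_eventually[OF assms(1), of g] assms(2)
  by (simp add: eventually_nhds_conv_at)

lemma frechet_derivative_cong_eventually:
  assumes "\<forall>\<^sub>F x in nhds p. f x = g x"
  shows "frechet_derivative f (at p) = frechet_derivative g (at p)"
proof -
  have "\<forall>\<^sub>F x in nhds p. g x = f x" using assms by eventually_elim simp
  with assms have "(f has_derivative f') (at p) \<longleftrightarrow> (g has_derivative f') (at p)" for f'
    using has_derivative_transform_nhds by blast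
  then show ?thesis unfolding frechet_derivative_def by simp
qed

abbreviation D\<^sub>0 :: "('a::real_normed_vector \<Rightarrow> 'b::real_normed_vector) \<Rightarrow> 'a \<Rightarrow> 'b" where
  "D\<^sub>0 f \<equiv> frechet_derivative f (at 0)"

lemma smooth_germ_has_derivative: "smooth_germ f \<Longrightarrow> (f has_derivative D\<^sub>0 f) (at 0)"
  by (rule smooth_germ_eventually_has_derivative[THEN eventually_nhds_x_imp_x])

lemma linear_D0: "smooth_germ f \<Longrightarrow> linear (D\<^sub>0 f)"
  using smooth_germ_has_derivative has_derivative_linear by blast

lemma D0_eqI: "(f has_derivative f') (at 0) \<Longrightarrow> D\<^sub>0 f = f'"
  by (rule frechet_derivative_at[symmetric])

lemma D0_linear: "bounded_linear L \<Longrightarrow> D\<^sub>0 L = L"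
  by (intro D0_eqI bounded_linear_imp_has_derivative)

lemma D0_compose:
  assumes "smooth_germ g" "smooth_germ f" "f 0 = 0"
  shows "D\<^sub>0 (\<lambda>x. g (f x)) v = D\<^sub>0 g (D\<^sub>0 f v)"
  using has_derivative_compose[of f _ 0 UNIV g] smooth_germ_has_derivative assms by (metis D0_eqI)

lemma D0_linear_compose:
  assumes "bounded_linear L" "smooth_germ f"
  shows "D\<^sub>0 (\<lambda>x. L (f x)) v = L (D\<^sub>0 f v)"
  using D0_eqI[OF bounded_linear.has_derivative[OF assms(1) smooth_germ_has_derivative[OF assms(2)]]]
  by simp

lemma D0_Pair:
  assumes "smooth_germ f" "smooth_germ g"
  shows "D\<^sub>0 (\<lambda>x. (f x, g x)) v = (D\<^sub>0 f v, D\<^sub>0 g v)"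
  using D0_eqI[OF has_derivative_Pair[OF assms[THEN smooth_germ_has_derivative]]] by simp

lemmas D0_fst = D0_linear_compose[OF bounded_linear_fst]
lemmas D0_snd = D0_linear_compose[OF bounded_linear_snd]

lemma diffeo_germ_smooth: "diffeo_germ h \<Longrightarrow> smooth_germ h"
  and diffeo_germ_zero: "diffeo_germ h \<Longrightarrow> h 0 = 0"
  by (auto simp: diffeo_germ_def)

lemma diffeo_germ_eventually_compose:
  "diffeo_germ h \<Longrightarrow> \<forall>\<^sub>F y in nhds 0. P y \<Longrightarrow> \<forall>\<^sub>F x in nhds 0. P (h x)"
  by (rule smooth_germ_eventually_compose[OF diffeo_germ_smooth diffeo_germ_zero])

lemma diffeo_germ_inverse:
  assumes "diffeo_germ h"
  obtains g where "diffeo_germ g" "\<forall>\<^sub>F x in nhds 0. g (h x) = x" "\<forall>\<^sub>F y in nhds 0. h (g y) = y"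
  using assms unfolding diffeo_germ_def by blast

lemma diffeo_germ_compose:
  fixes g h :: "'a::euclidean_space \<Rightarrow> 'a"
  assumes "diffeo_germ g" "diffeo_germ h"
  shows "diffeo_germ (\<lambda>x. g (h x))"
proof -
  obtain g' where g': "diffeo_germ g'" "\<forall>\<^sub>F x in nhds 0. g' (g x) = x" "\<forall>\<^sub>F y in nhds 0. g (g' y) = y"
    by (rule diffeo_germ_inverse[OF assms(1)])
  obtain h' where h': "diffeo_germ h'" "\<forall>\<^sub>F x in nhds 0. h' (h x) = x" "\<forall>\<^sub>F y in nhds 0. h (h' y) = y"
    by (rule diffeo_germ_inverse[OF assms(2)])
  have "\<forall>\<^sub>F x in nhds 0. h' (g' (g (h x))) = x"
    using diffeo_germ_eventually_compose[OF assms(2) g'(2)] h'(2) by eventually_elim simp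
  moreover have "\<forall>\<^sub>F y in nhds 0. g (h (h' (g' y))) = y"
    using diffeo_germ_eventually_compose[OF g'(1) h'(3)] g'(3) by eventually_elim simp
  moreover have "smooth_germ (\<lambda>x. g (h x))" "smooth_germ (\<lambda>y. h' (g' y))"
    using assms g'(1) h'(1) by (auto intro: smooth_germ_compose diffeo_germ_smooth diffeo_germ_zero)
  ultimately show ?thesis unfolding diffeo_germ_def
    using assms[THEN diffeo_germ_zero] g'(1) h'(1)
    by (intro conjI exI[of _ "\<lambda>y. h' (g' y)"]) (auto simp: diffeo_germ_zero)
qed

lemma diffeo_germ_eventually_bij:
  fixes h :: "'a::euclidean_space \<Rightarrow> 'a"
  assumes "diffeo_germ h"
  shows "\<forall>\<^sub>F x in nhds 0. bij (frechet_derivative h (at x))"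
proof -
  obtain g where g: "diffeo_germ g" "\<forall>\<^sub>F x in nhds 0. g (h x) = x"
    by (rule diffeo_germ_inverse[OF assms])
  have "\<forall>\<^sub>F x in nhds 0. (g has_derivative frechet_derivative g (at (h x))) (at (h x))"
    by (intro diffeo_germ_eventually_compose[OF assms] smooth_germ_eventually_has_derivative
        diffeo_germ_smooth g(1))
  moreover have "\<forall>\<^sub>F x in nhds 0. \<forall>\<^sub>F y in nhds x. g (h y) = y"
    using g(2) by (simp add: eventually_eventually)
  ultimately show ?thesis
    using smooth_germ_eventually_has_derivative[OF diffeo_germ_smooth[OF assms]]
  proof eventually_elim
    case (elim x)
    let ?Dh = "frechet_derivative h (at x)" and ?Dg = "frechet_derivative g (at (h x))"
    have "(\<lambda>v. ?Dg (?Dh v)) = frechet_derivative (\<lambda>y. g (h y)) (at x)"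
      by (rule frechet_derivative_at[OF has_derivative_compose[OF elim(3,1)]])
    also have "\<dots> = (\<lambda>v. v)"
      using frechet_derivative_cong_eventually[OF elim(2)] by simp
    finally have "inj ?Dh" by (metis injI)
    moreover have "linear ?Dh" using elim(3) by (rule has_derivative_linear)
    ultimately show ?case using linear_injective_imp_surjective by (auto simp: bij_def)
  qed
qed

lemma bij_D0_diffeo_germ: "diffeo_germ h \<Longrightarrow> bij (D\<^sub>0 h)" for h :: "'a::euclidean_space \<Rightarrow> 'a"
  by (rule diffeo_germ_eventually_bij[THEN eventually_nhds_x_imp_x])

subsection \<open>The inverse function theorem for smooth germs\<close>

lemma has_derivative_bilinear_vanishing:
  assumes B: "bounded_bilinear B"
    and f: "continuous (at x) f" and g: "(g has_derivative g') (at x)" "g x = 0"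
  shows "((\<lambda>y. B (f y) (g y)) has_derivative (\<lambda>h. B (f x) (g' h))) (at x)"
proof -
  interpret bounded_bilinear B by (rule B)
  have g': "bounded_linear g'" using g(1) by (rule has_derivative_bounded_linear)
  obtain K where K: "\<And>a b. norm (B a b) \<le> norm a * norm b * K" "K \<ge> 0"
    using nonneg_bounded by blast
  obtain C where C: "\<And>h. norm (g' h) \<le> norm h * C" using bounded_linear.bounded[OF g'] by blast
  define r where "r y = norm (g y - g x - g' (y - x)) / norm (y - x)" for y
  have r: "(r \<longlongrightarrow> 0) (at x)" using g(1) by (simp add: has_derivative_iff_norm r_def[abs_def])
  have g_le: "norm (g y) \<le> (r y + C) * norm (y - x)" if "y \<noteq> x" for y
  proof -
    have "norm (g y) \<le> norm (g y - g x - g' (y - x)) + norm (g' (y - x))"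
      using norm_triangle_sub[of "g y" "g' (y - x)"] g(2) by simp
    also have "\<dots> \<le> r y * norm (y - x) + norm (y - x) * C"
      using C[of "y - x"] that by (simp add: r_def)
    finally show ?thesis by (simp add: algebra_simps)
  qed
  have "((\<lambda>y. B (f y - f x) (g y)) has_derivative (\<lambda>h. 0)) (at x)"
  proof (rule has_derivativeI_sandwich[where e=1])
    fix y assume "y \<noteq> x"
    have "norm (B (f y - f x) (g y)) \<le> norm (f y - f x) * norm (g y) * K" by (rule K(1))
    also have "\<dots> \<le> norm (f y - f x) * ((r y + C) * norm (y - x)) * K"
      using g_le[OF \<open>y \<noteq> x\<close>] K(2) by (intro mult_right_mono mult_left_mono) auto
    finally show "norm (B (f y - f x) (g y) - B (f x - f x) (g x) - 0) / norm (y - x)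
        \<le> norm (f y - f x) * (r y + C) * K"
      using \<open>y \<noteq> x\<close> by (simp add: g(2) zero_right divide_le_eq mult_ac)
  next
    have "((\<lambda>y. norm (f y - f x)) \<longlongrightarrow> 0) (at x)"
      using f by (simp add: continuous_at tendsto_norm_zero_iff LIM_zero_iff)
    from tendsto_mult[OF tendsto_mult[OF this tendsto_add[OF r tendsto_const]] tendsto_const]
    show "((\<lambda>y. norm (f y - f x) * (r y + C) * K) \<longlongrightarrow> 0) (at x)" by simp
  qed auto
  moreover have "((\<lambda>y. B (f x) (g y)) has_derivative (\<lambda>h. B (f x) (g' h))) (at x)"
    by (rule bounded_linear.has_derivative[OF bounded_linear_right g(1)])
  ultimately have "((\<lambda>y. B (f y - f x) (g y) + B (f x) (g y)) has_derivative
    (\<lambda>h. 0 + B (f x) (g' h))) (at x)"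
    by (rule has_derivative_add)
  then show ?thesis by (simp add: diff_left)
qed

lemma blinfun_inverse_diff:
  fixes A B :: "'a::real_normed_vector \<Rightarrow>\<^sub>L 'b::real_normed_vector"
  assumes "A' o\<^sub>L A = id_blinfun" "B o\<^sub>L B' = id_blinfun"
  shows "A' - B' = A' o\<^sub>L (B - A) o\<^sub>L B'"
proof -
  have "A' o\<^sub>L (B - A) o\<^sub>L B' = (A' o\<^sub>L (B o\<^sub>L B')) - (A' o\<^sub>L A o\<^sub>L B')"
    by (simp add: blinfun_eqI blinfun.diff_left blinfun.diff_right)
  then show ?thesis by (simp add: assms blinfun_eqI blinfun.diff_left)
qed

lemma norm_blinfun_compose3:
  "norm (A o\<^sub>L B o\<^sub>L C) \<le> norm A * norm B * norm C"
  by (meson norm_blinfun_compose mult_right_mono norm_ge_zero order_trans)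

lemma continuous_blinfun_inverse:
  fixes A :: "'c::real_normed_vector \<Rightarrow> 'a::real_normed_vector \<Rightarrow>\<^sub>L 'b::real_normed_vector"
  assumes A: "continuous (at x) A"
    and inv: "\<forall>\<^sub>F y in nhds x. E y o\<^sub>L A y = id_blinfun \<and> A y o\<^sub>L E y = id_blinfun"
  shows "continuous (at x) E"
proof -
  define K where "K = norm (E x)"
  have lim: "((\<lambda>y. norm (A x - A y)) \<longlongrightarrow> 0) (at x)"
    using tendsto_norm[OF tendsto_diff[OF tendsto_const[of "A x"] A[unfolded continuous_at]]] by simp
  have "\<forall>\<^sub>F y in at x. norm (A x - A y) * K < 1/2"
    by (rule order_tendstoD(2)[OF tendsto_mult_left_zero[OF lim]]) simp
  moreover have "\<forall>\<^sub>F y in at x. E y o\<^sub>L A y = id_blinfun \<and> A y o\<^sub>L E y = id_blinfun"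
    using inv by (simp add: eventually_nhds_conv_at)
  ultimately have "\<forall>\<^sub>F y in at x. norm (E y - E x) \<le> 2 * K * K * norm (A x - A y)"
  proof eventually_elim
    case (elim y)
    have "E y - E x = E y o\<^sub>L (A x - A y) o\<^sub>L E x"
      using blinfun_inverse_diff elim(2) eventually_nhds_x_imp_x[OF inv] by blast
    then have diff: "norm (E y - E x) \<le> norm (E y) * (norm (A x - A y) * K)"
      using norm_blinfun_compose3 unfolding K_def by (metis mult.assoc)
    have "norm (E y) \<le> norm (E y - E x) + K"
      using norm_triangle_sub[of "E y" "E x"] by (simp add: K_def add.commute)
    also have "norm (E y - E x) \<le> norm (E y) * (1/2)"
      using diff mult_left_mono[OF less_imp_le[OF elim(1)] norm_ge_zero[of "E y"]] by linarith
    finally have "norm (E y) \<le> 2 * K" by simp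
    then have "norm (E y) * (norm (A x - A y) * K) \<le> 2 * K * (norm (A x - A y) * K)"
      by (intro mult_right_mono) (simp_all add: K_def)
    with diff show ?case by (simp add: mult_ac)
  qed
  from Lim_null_comparison[OF this tendsto_mult_right_zero[OF lim]]
  show ?thesis by (simp add: continuous_at LIM_zero_iff)
qed

lemma has_derivative_blinfun_inverse:
  fixes A :: "'c::real_normed_vector \<Rightarrow> 'a::real_normed_vector \<Rightarrow>\<^sub>L 'b::real_normed_vector"
  assumes A: "(A has_derivative A') (at x)"
    and inv: "\<forall>\<^sub>F y in nhds x. E y o\<^sub>L A y = id_blinfun \<and> A y o\<^sub>L E y = id_blinfun"
  shows "(E has_derivative (\<lambda>h. - (E x o\<^sub>L A' h o\<^sub>L E x))) (at x)"
proof -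
  have cont: "continuous (at x) E"
    by (rule continuous_blinfun_inverse[OF has_derivative_continuous[OF A] inv])
  have "((\<lambda>y. A x - A y) has_derivative (\<lambda>h. - A' h)) (at x)"
    using has_derivative_diff[OF has_derivative_const A] by simp
  then have "((\<lambda>y. E y o\<^sub>L (A x - A y)) has_derivative (\<lambda>h. E x o\<^sub>L - A' h)) (at x)"
    by (rule has_derivative_bilinear_vanishing[OF bounded_bilinear_blinfun_compose cont]) simp
  then have "((\<lambda>y. E y o\<^sub>L (A x - A y) o\<^sub>L E x) has_derivative (\<lambda>h. E x o\<^sub>L - A' h o\<^sub>L E x)) (at x)"
    by (rule bounded_linear.has_derivative[OF
          bounded_bilinear.bounded_linear_left[OF bounded_bilinear_blinfun_compose]])
  from has_derivative_add[OF has_derivative_const[of "E x"] this]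
  have "((\<lambda>y. E x + (E y o\<^sub>L (A x - A y) o\<^sub>L E x)) has_derivative
      (\<lambda>h. - (E x o\<^sub>L A' h o\<^sub>L E x))) (at x)"
    by (rule has_derivative_eq_rhs)
       (auto intro!: blinfun_eqI simp: blinfun.minus_left blinfun.minus_right)
  moreover have "\<forall>\<^sub>F y in nhds x. E x + (E y o\<^sub>L (A x - A y) o\<^sub>L E x) = E y"
    using inv
  proof eventually_elim
    case (elim y)
    then have "E y - E x = E y o\<^sub>L (A x - A y) o\<^sub>L E x"
      using blinfun_inverse_diff eventually_nhds_x_imp_x[OF inv] by blast
    then show ?case by (metis add_diff_cancel_left' add.commute diff_add_cancel)
  qed
  ultimately show ?thesis by (rule has_derivative_transform_nhds)
qed

lemma Ck_on_blinfun_inverse: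
  fixes A :: "'c::real_normed_vector \<Rightarrow> 'a::real_normed_vector \<Rightarrow>\<^sub>L 'b::real_normed_vector"
  assumes U: "open U" and inv: "\<And>x. x \<in> U \<Longrightarrow> E x o\<^sub>L A x = id_blinfun \<and> A x o\<^sub>L E x = id_blinfun"
    and "Ck_on n U A"
  shows "Ck_on n U E"
  using assms(3)
proof (induction n)
  have ev: "\<forall>\<^sub>F y in nhds x. E y o\<^sub>L A y = id_blinfun \<and> A y o\<^sub>L E y = id_blinfun" if "x \<in> U" for x
    using eventually_nhds_in_open[OF U that] by eventually_elim (rule inv)
  {
    case 0
    then show ?case
      using continuous_blinfun_inverse[OF _ ev] by (simp add: continuous_on_eq_continuous_at[OF U])
  next
    case (Suc n)
    let ?A' = "\<lambda>x. frechet_derivative A (at x)"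
    have "Ck_on n U (\<lambda>x. - (E x o\<^sub>L ?A' x v o\<^sub>L E x))" for v
      using Suc Ck_on_SucD[OF Suc.prems]
      by (intro Ck_on_linear_compose[OF U bounded_linear_minus[OF bounded_linear_ident]]
          Ck_on_bilinear[OF bounded_bilinear_blinfun_compose U]) auto
    then show ?case
      using Ck_on_Suc_has_derivative[OF Suc.prems] ev
      by (intro Ck_on_SucI[OF U has_derivative_blinfun_inverse]) auto
  }
qed

lemma Ck_on_blinfun_componentwise:
  fixes A :: "'c::real_normed_vector \<Rightarrow> 'a::euclidean_space \<Rightarrow>\<^sub>L 'b::real_normed_vector"
  assumes "open U" "\<And>b. b \<in> Basis \<Longrightarrow> Ck_on n U (\<lambda>x. A x b)"
  shows "Ck_on n U A"
proof (rule Ck_on_cong[OF assms(1)])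
  show "Ck_on n U (\<lambda>x. \<Sum>b\<in>Basis. blinfun_scaleR_left (A x b) o\<^sub>L blinfun_inner_left b)"
    using assms
    by (intro Ck_on_sum Ck_on_bilinear[OF bounded_bilinear_blinfun_compose] Ck_on_const
        Ck_on_linear_compose[OF _ bounded_linear_blinfun_scaleR_left])
  show "(\<Sum>b\<in>Basis. blinfun_scaleR_left (A x b) o\<^sub>L blinfun_inner_left b) = A x" for x
  proof (rule blinfun_eqI)
    fix v
    have "A x v = (\<Sum>b\<in>Basis. (v \<bullet> b) *\<^sub>R A x b)"
      by (rule linear_euclidean_expansion[OF bounded_linear.linear[OF blinfun.bounded_linear_right]])
    then show "(\<Sum>b\<in>Basis. blinfun_scaleR_left (A x b) o\<^sub>L blinfun_inner_left b) v = A x v"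
      by (simp only: blinfun.sum_left blinfun_apply_blinfun_compose blinfun_scaleR_left.rep_eq
          blinfun_inner_left.rep_eq)
  qed
qed

lemma smooth_on_inverse_function:
  fixes f :: "'a::euclidean_space \<Rightarrow> 'a"
  assumes f: "smooth_on U f" and V: "open V" "g ` V \<subseteq> U"
    and g: "\<And>y. y \<in> V \<Longrightarrow> (g has_derivative g' y) (at y)" and fg: "\<And>y. y \<in> V \<Longrightarrow> f (g y) = y"
  shows "smooth_on V g"
proof (rule smooth_on_bootstrap[OF V(1) g])
  fix n v assume "Ck_on n V g"
  let ?Df = "\<lambda>x. frechet_derivative f (at x)"
  define A where "A y = Blinfun (?Df (g y))" for y
  define E where "E y = Blinfun (g' y)" for y
  have Df: "(f has_derivative ?Df (g y)) (at (g y))" if "y \<in> V" for y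
    using that V(2) by (intro smooth_on_has_derivative[OF f]) auto
  have A: "A y v = ?Df (g y) v" and E: "E y v = g' y v" if "y \<in> V" for y v
    unfolding A_def E_def
    using bounded_linear_Blinfun_apply[OF has_derivative_bounded_linear] Df[OF that] g[OF that] by metis+
  have "Ck_on n V (\<lambda>y. A y b)" for b
  proof (rule Ck_on_cong[OF V(1)])
    have "Ck_on n U (\<lambda>x. ?Df x b)"
      using smooth_on_frechet_derivative[OF f] by (simp add: smooth_on_iff_Ck_on)
    then show "Ck_on n V (\<lambda>y. ?Df (g y) b)"
      by (rule Ck_on_compose[OF V(1) smooth_on_imp_open[OF f] _ \<open>Ck_on n V g\<close> V(2)])
  qed (simp add: A)
  then have Ck_A: "Ck_on n V A" by (rule Ck_on_blinfun_componentwise[OF V(1)])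
  have inv: "E y o\<^sub>L A y = id_blinfun \<and> A y o\<^sub>L E y = id_blinfun" if y: "y \<in> V" for y
  proof -
    have "((\<lambda>y. f (g y)) has_derivative (\<lambda>v. ?Df (g y) (g' y v))) (at y)"
      by (rule has_derivative_compose[OF g[OF y] Df[OF y]])
    then have "((\<lambda>y. y) has_derivative (\<lambda>v. ?Df (g y) (g' y v))) (at y)"
      by (rule has_derivative_transform_within_open[OF _ V(1) y]) (rule fg)
    from has_derivative_unique[OF this has_derivative_ident]
    have right: "?Df (g y) \<circ> g' y = id" by (simp add: fun_eq_iff)
    moreover have "g' y \<circ> ?Df (g y) = id"
      using right linear_inverse_left[OF Df[OF y, THEN has_derivative_linear]
          g[OF y, THEN has_derivative_linear]]
      by simp
    ultimately show ?thesis using A[OF y] E[OF y] by (auto intro!: blinfun_eqI simp: fun_eq_iff)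
  qed
  have "Ck_on n V (\<lambda>y. E y v)"
    using Ck_on_blinfun_inverse[OF V(1) inv Ck_A]
    by (rule Ck_on_linear_compose[OF V(1) blinfun.bounded_linear_left])
  then show "Ck_on n V (\<lambda>y. g' y v)" by (rule Ck_on_cong[OF V(1), rotated]) (rule E)
qed

lemma diffeo_germI:
  fixes f :: "'a::euclidean_space \<Rightarrow> 'a"
  assumes f: "smooth_germ f" "f 0 = 0" and inj: "inj (D\<^sub>0 f)"
  shows "diffeo_germ f"
proof -
  obtain U where U: "0 \<in> U" "smooth_on U f" using f(1) unfolding smooth_germ_def by blast
  define A where "A x = Blinfun (frechet_derivative f (at x))" for x
  have A: "blinfun_apply (A x) = frechet_derivative f (at x)" if "x \<in> U" for x
    using smooth_on_has_derivative[OF U(2) that] unfolding A_def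
    by (intro bounded_linear_Blinfun_apply has_derivative_bounded_linear)
  have "continuous_on U (\<lambda>x. A x v)" for v
    using smooth_on_imp_continuous_on[OF smooth_on_frechet_derivative[OF U(2)]]
    by (rule continuous_on_eq) (simp add: A)
  then have cont: "continuous_on U A" by (intro continuous_on_blinfun_componentwise)
  obtain L where L: "linear L" "L \<circ> D\<^sub>0 f = id"
    using linear_injective_left_inverse[OF linear_D0[OF f(1)] inj] by blast
  then have "Blinfun L o\<^sub>L A 0 = id_blinfun"
    using A[OF U(1)]
    by (intro blinfun_eqI) (simp add: bounded_linear_Blinfun_apply linear_conv_bounded_linear fun_eq_iff)
  then obtain V W g g' where V: "V \<subseteq> U" "0 \<in> V" "open V" and W: "open W" "f 0 \<in> W"
    and hom: "homeomorphism V W f g" and g: "\<And>y. y \<in> W \<Longrightarrow> (g has_derivative (g' y)) (at y)"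
    using inverse_function_theorem[of U f A 0 "Blinfun L"] smooth_on_has_derivative[OF U(2)] A cont U(1)
      smooth_on_imp_open[OF U(2)] by metis
  have fg: "g y \<in> V" "f (g y) = y" if "y \<in> W" for y
    using hom that unfolding homeomorphism_def by auto
  have gf: "f x \<in> W" "g (f x) = x" if "x \<in> V" for x
    using hom that unfolding homeomorphism_def by auto
  have "smooth_on W g"
    by (rule smooth_on_inverse_function[OF U(2) W(1) _ g fg(2)]) (use fg(1) V(1) in auto)
  then have "smooth_germ g" using W(2) f(2) by (auto intro: smooth_germI)
  moreover have "\<forall>\<^sub>F x in nhds 0. g (f x) = x" "\<forall>\<^sub>F y in nhds 0. f (g y) = y"
    using V W f(2) fg gf by (auto simp: eventually_nhds)
  moreover have "g 0 = 0" using gf(2)[OF V(2)] f(2) by simp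
  ultimately show ?thesis using f unfolding diffeo_germ_def by blast
qed

lemma diffeo_germ_linear: "linear L \<Longrightarrow> inj L \<Longrightarrow> diffeo_germ L" for L :: "'a::euclidean_space \<Rightarrow> 'a"
  by (intro diffeo_germI smooth_germ_linear) (auto simp: D0_linear linear_conv_bounded_linear linear_0)

lemma diffeo_germ_realI:
  assumes "smooth_germ h" "h 0 = 0" "D\<^sub>0 h 1 \<noteq> (0::real)"
  shows "diffeo_germ h"
proof (rule diffeo_germI[OF assms(1,2)])
  interpret linear "D\<^sub>0 h" by (rule linear_D0[OF assms(1)])
  have "D\<^sub>0 h x = x * D\<^sub>0 h 1" for x using scale[of x 1] by simp
  then show "inj (D\<^sub>0 h)" using assms(3) by (metis injI mult_cancel_right)
qed

subsection \<open>Hadamard division\<close>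

lemma has_derivative_integral_parameter:
  fixes F :: "'a::euclidean_space \<times> real \<Rightarrow> 'b::banach"
  assumes U: "open U" "U \<times> {a..b} \<subseteq> W"
    and F: "\<And>p. p \<in> W \<Longrightarrow> (F has_derivative F' p) (at p)"
    and F': "\<And>v. continuous_on W (\<lambda>p. F' p v)"
    and x: "x \<in> U"
  shows "((\<lambda>x. integral {a..b} (\<lambda>t. F (x, t))) has_derivative
    (\<lambda>v. integral {a..b} (\<lambda>t. F' (x, t) (v, 0)))) (at x)"
proof -
  define G where "G x t = Blinfun (\<lambda>v. F' (x, t) (v, 0))" for x t
  obtain d where d: "d > 0" "ball x d \<subseteq> U" using U(1) x open_contains_ball by blast
  then have sub: "ball x d \<times> {a..b} \<subseteq> W" using U(2) by blast
  have F_slice: "((\<lambda>x. F (x, t)) has_derivative (\<lambda>v. F' (y, t) (v, 0))) (at y)"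
    if "y \<in> ball x d" "t \<in> {a..b}" for y t
    by (rule has_derivative_compose[OF has_derivative_Pair[OF has_derivative_ident
        has_derivative_const] F])
       (use that sub in auto)
  have G: "blinfun_apply (G y t) = (\<lambda>v. F' (y, t) (v, 0))" if "y \<in> ball x d" "t \<in> {a..b}" for y t
    unfolding G_def
    by (rule bounded_linear_Blinfun_apply[OF has_derivative_bounded_linear[OF F_slice[OF that]]])
  have "continuous_on (ball x d \<times> {a..b}) (\<lambda>p. G (fst p) (snd p) v)" for v
    by (rule continuous_on_eq[OF continuous_on_subset[OF F'[of "(v, 0)"] sub]]) (auto simp: G)
  then have cont_G: "continuous_on (ball x d \<times> {a..b}) (\<lambda>(y, t). G y t)"
    unfolding case_prod_unfold by (rule continuous_on_blinfun_componentwise)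
  have cont_F: "continuous_on (ball x d \<times> {a..b}) F"
    using has_derivative_continuous[OF F] sub by (blast intro: continuous_at_imp_continuous_on)
  have slice: "continuous_on {a..b} (\<lambda>t. h (y, t))"
    if "continuous_on (ball x d \<times> {a..b}) h" "y \<in> ball x d"
    for h :: "'a \<times> real \<Rightarrow> 'c::topological_space" and y
    by (rule continuous_on_compose2[OF that(1)]) (use that(2) in \<open>auto intro!: continuous_intros\<close>)
  have xd: "x \<in> ball x d" using d by simp
  have int_G: "G x integrable_on {a..b}"
    using slice[OF cont_G xd] by (intro integrable_continuous_real) simp
  have "((\<lambda>x. integral (cbox a b) (\<lambda>t. F (x, t))) has_derivative integral (cbox a b) (G x))
    (at x within ball x d)"
  proof (rule leibniz_rule)
    show "((\<lambda>x. F (x, t)) has_derivative blinfun_apply (G y t)) (at y within ball x d)"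
      if "y \<in> ball x d" "t \<in> cbox a b" for y t
      using that F_slice[of y t] G[of y t] by (auto intro: has_derivative_at_withinI)
  qed (use cont_G slice[OF cont_F] xd in \<open>auto intro: integrable_continuous_real\<close>)
  moreover have "blinfun_apply (integral {a..b} (G x)) = (\<lambda>v. integral {a..b} (\<lambda>t. F' (x, t) (v, 0)))"
    using G[OF xd] by (auto simp: fun_eq_iff blinfun_apply_integral[OF int_G] intro!: integral_cong)
  ultimately show ?thesis using at_within_open[OF xd] by simp
qed

lemma Ck_on_integral:
  fixes F :: "'a::euclidean_space \<times> real \<Rightarrow> 'b::banach"
  assumes U: "open U" "U \<times> {a..b} \<subseteq> W" and "Ck_on n W F"
  shows "Ck_on n U (\<lambda>x. integral {a..b} (\<lambda>t. F (x, t)))"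
  using assms(3)
proof (induction n arbitrary: F)
  case 0
  then have "continuous_on (U \<times> cbox a b) (\<lambda>(x, t). F (x, t))"
    using U(2) by (auto intro: continuous_on_subset)
  from integral_continuous_on_param[OF this] show ?case by simp
next
  case (Suc n)
  let ?F' = "\<lambda>p. frechet_derivative F (at p)"
  show ?case
  proof (rule Ck_on_SucI[OF U(1)])
    show "((\<lambda>x. integral {a..b} (\<lambda>t. F (x, t))) has_derivative
        (\<lambda>v. integral {a..b} (\<lambda>t. ?F' (x, t) (v, 0)))) (at x)" if "x \<in> U" for x
    proof (rule has_derivative_integral_parameter[OF U Ck_on_Suc_has_derivative[OF Suc.prems] _ that])
      show "continuous_on W (\<lambda>p. ?F' p v)" for v
        using Suc.prems Ck_on_imp_continuous_on unfolding Ck_on.simps(2) by blast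
    qed
    show "Ck_on n U (\<lambda>x. integral {a..b} (\<lambda>t. ?F' (x, t) (v, 0)))" for v
      by (rule Suc.IH) (use Suc.prems in \<open>unfold Ck_on.simps(2), blast\<close>)
  qed
qed

lemma hadamard_division:
  fixes f :: "'a::euclidean_space \<times> real \<Rightarrow> 'b::banach"
  assumes f: "smooth_on U f"
    and star: "\<And>x y t. (x, y) \<in> U \<Longrightarrow> 0 \<le> t \<Longrightarrow> t \<le> 1 \<Longrightarrow> (x, t * y) \<in> U"
    and zero: "\<And>x. (x, 0) \<in> U \<Longrightarrow> f (x, 0) = 0"
  obtains g where "smooth_on U g" "\<And>x y. (x, y) \<in> U \<Longrightarrow> f (x, y) = y *\<^sub>R g (x, y)"
    "\<And>x. g (x, 0) = frechet_derivative f (at (x, 0)) (0, 1)"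
proof
  let ?f' = "\<lambda>p. frechet_derivative f (at p) (0, 1)"
  let ?scale = "\<lambda>q :: ('a \<times> real) \<times> real. (fst (fst q), snd q * snd (fst q))"
  define g where "g p = integral {0..1} (\<lambda>t. ?f' (?scale (p, t)))" for p
  have U: "open U" using f by (rule smooth_on_imp_open)
  have f': "smooth_on U ?f'" using f by (rule smooth_on_frechet_derivative)
  have W: "open (?scale -` U)"
    using U by (intro open_vimage continuous_intros)
  have sub: "U \<times> {0..1} \<subseteq> ?scale -` U" using star by auto
  have "smooth_on (?scale -` U) (\<lambda>q. ?f' (?scale q))"
    by (intro smooth_on_compose[OF f'] smooth_on_intros W) auto
  then show "smooth_on U g"
    unfolding g_def[abs_def] smooth_on_iff_Ck_on
    by (intro conjI allI U Ck_on_integral[OF U sub]) blast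
  show "g (x, 0) = ?f' (x, 0)" for x by (simp add: g_def)
  show "f (x, y) = y *\<^sub>R g (x, y)" if p: "(x, y) \<in> U" for x y
  proof -
    have "((\<lambda>t. y *\<^sub>R ?f' (x, t * y)) has_integral f (x, 1 * y) - f (x, 0 * y)) {0..1}"
    proof (rule fundamental_theorem_of_calculus)
      fix t :: real assume "t \<in> {0..1}"
      then have Df: "(f has_derivative frechet_derivative f (at (x, t * y))) (at (x, t * y))"
        using star[OF p] by (auto intro: smooth_on_has_derivative[OF f])
      have "((\<lambda>t. (x, t * y)) has_derivative (\<lambda>s. (s * y) *\<^sub>R (0, 1))) (at t)"
        by (auto intro!: derivative_eq_intros)
      from has_derivative_compose[OF this Df]
      have "((\<lambda>t. f (x, t * y)) has_derivative (\<lambda>s. s *\<^sub>R (y *\<^sub>R ?f' (x, t * y)))) (at t)"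
        by (simp only: linear_cmul[OF has_derivative_linear[OF Df]] scaleR_scaleR)
      then show "((\<lambda>t. f (x, t * y)) has_vector_derivative y *\<^sub>R ?f' (x, t * y)) (at t within {0..1})"
        unfolding has_vector_derivative_def by (rule has_derivative_at_withinI)
    qed simp
    from integral_unique[OF this] show ?thesis
      using zero star[OF p, of 0] by (simp add: g_def)
  qed
qed

lemma cylinder_star_shaped:
  "(x, y) \<in> A \<times> {-r<..<r} \<Longrightarrow> 0 \<le> t \<Longrightarrow> t \<le> 1 \<Longrightarrow> (x, t * y) \<in> A \<times> {-r<..<r::real}"
  using mult_left_le_one_le[of "\<bar>y\<bar>" t] abs_mult[of t y] by auto

lemma smooth_germ_cylinder:
  fixes f :: "'a::real_normed_vector \<times> real \<Rightarrow> 'b::real_normed_vector"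
  assumes "smooth_germ f"
  obtains A r where "open A" "0 \<in> A" "r > 0" "smooth_on (A \<times> {-r<..<r}) f"
proof -
  obtain U where U: "0 \<in> U" "smooth_on U f" using assms unfolding smooth_germ_def by blast
  obtain A B where AB: "open A" "open B" "(0, 0) \<in> A \<times> B" "A \<times> B \<subseteq> U"
    using open_prod_elim[OF smooth_on_imp_open[OF U(2)] U(1)] unfolding zero_prod_def by metis
  then obtain r where r: "r > 0" "ball 0 r \<subseteq> B" using open_contains_ball by blast
  then have "A \<times> {-r<..<r} \<subseteq> U" using AB(4) by (auto simp: ball_def subset_iff dist_real_def)
  then have "smooth_on (A \<times> {-r<..<r}) f"
    by (intro smooth_on_subset[OF U(2)] open_Times AB(1) open_greaterThanLessThan)
  then show ?thesis using that AB(1,3) r(1) by blast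
qed

lemma hadamard_division_germ:
  fixes f :: "'a::euclidean_space \<times> real \<Rightarrow> 'b::banach"
  assumes f: "smooth_germ f" and zero: "\<forall>\<^sub>F x in nhds 0. f (x, 0) = 0"
  obtains g where "smooth_germ g" "\<forall>\<^sub>F p in nhds 0. f p = snd p *\<^sub>R g p" "g 0 = D\<^sub>0 f (0, 1)"
proof -
  obtain A r where A: "open A" "0 \<in> A" and r: "r > 0" and smooth: "smooth_on (A \<times> {-r<..<r}) f"
    by (rule smooth_germ_cylinder[OF f])
  obtain B where B: "open B" "0 \<in> B" "\<And>x. x \<in> B \<Longrightarrow> f (x, 0) = 0"
    using zero unfolding eventually_nhds by blast
  let ?U = "(A \<inter> B) \<times> {-r<..<r}"
  have U: "open ?U" "0 \<in> ?U" using A B r by (auto simp: zero_prod_def intro: open_Times)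
  have "smooth_on ?U f" by (rule smooth_on_subset[OF smooth U(1)]) auto
  then obtain g where g: "smooth_on ?U g" "\<And>x y. (x, y) \<in> ?U \<Longrightarrow> f (x, y) = y *\<^sub>R g (x, y)"
      "\<And>x. g (x, 0) = frechet_derivative f (at (x, 0)) (0, 1)"
    by (rule hadamard_division[OF _ cylinder_star_shaped]) (use B(3) in auto)
  have "\<forall>\<^sub>F p in nhds 0. p \<in> ?U" by (rule eventually_nhds_in_open[OF U])
  then have "\<forall>\<^sub>F p in nhds 0. f p = snd p *\<^sub>R g p"
    by eventually_elim (use g(2) in force)
  then show ?thesis
    using that[OF smooth_germI[OF g(1) U(2)]] g(3)[of 0] by (simp add: zero_prod_def)
qed

lemma hadamard_division_real:
  fixes f :: "real \<Rightarrow> 'b::banach"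
  assumes "smooth_germ f" "f 0 = 0"
  obtains g where "smooth_germ g" "\<forall>\<^sub>F x in nhds 0. f x = x *\<^sub>R g x" "g 0 = D\<^sub>0 f 1"
proof -
  obtain g :: "real \<times> real \<Rightarrow> 'b" where g: "smooth_germ g"
      "\<forall>\<^sub>F p in nhds 0. f (snd p) = snd p *\<^sub>R g p" "g 0 = D\<^sub>0 (\<lambda>p :: real \<times> real. f (snd p)) (0, 1)"
  proof (rule hadamard_division_germ)
    show "smooth_germ (\<lambda>p :: real \<times> real. f (snd p))"
      by (intro smooth_germ_compose[OF assms(1)] smooth_germ_intros) simp
    show "\<forall>\<^sub>F x :: real in nhds 0. f (snd (x, 0)) = 0" using assms(2) by simp
  qed (rule that)
  have axis: "smooth_germ (\<lambda>x::real. (0::real, x))" by (intro smooth_germ_intros)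
  show ?thesis
  proof (rule that)
    show "smooth_germ (\<lambda>x. g (0, x))"
      by (rule smooth_germ_compose[OF g(1) axis]) (simp add: zero_prod_def)
    show "\<forall>\<^sub>F x in nhds 0. f x = x *\<^sub>R g (0, x)"
      using smooth_germ_eventually_compose[OF axis _ g(2)] by (simp add: zero_prod_def)
    show "g (0, 0) = D\<^sub>0 f 1"
      using g(3) D0_compose[OF assms(1) smooth_germ_snd[OF smooth_germ_ident], of "(0::real, 1)"]
      by (simp add: D0_linear bounded_linear_snd flip: zero_prod_def)
  qed
qed

subsection \<open>Gluing flat functions\<close>

definition half_plane_glue :: "('a \<times> real \<Rightarrow> 'b::zero) \<Rightarrow> 'a \<times> real \<Rightarrow> 'b" where
  "half_plane_glue z p = (if snd p > 0 then z (fst p, sqrt (snd p)) else 0)"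

lemma half_plane_glue_square:
  assumes "z (x, 0) = 0" "z (x, -y) = z (x, y)"
  shows "half_plane_glue z (x, y\<^sup>2) = z (x, y)"
  using assms by (cases "y \<ge> 0") (auto simp: half_plane_glue_def abs_if)

definition flat_on ::
  "('a::real_normed_vector \<times> real) set \<Rightarrow> ('a \<times> real \<Rightarrow> 'b::real_normed_vector) \<Rightarrow> bool" where
  "flat_on U z \<longleftrightarrow> (\<forall>n. \<exists>w. smooth_on U w \<and> (\<forall>p\<in>U. z p = snd p ^ n *\<^sub>R w p))"

lemma flat_on_imp_smooth_on: "flat_on U z \<Longrightarrow> smooth_on U z"
  unfolding flat_on_def by (drule spec[of _ 0]) (auto intro: smooth_on_cong)

lemma frechet_derivative_snd_power_scaleR:
  assumes w: "smooth_on U w" "\<And>p. p \<in> U \<Longrightarrow> z p = snd p ^ Suc n *\<^sub>R w p" and p: "p \<in> U"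
  shows "frechet_derivative z (at p) v =
    snd p ^ Suc n *\<^sub>R frechet_derivative w (at p) v + (real (Suc n) * snd p ^ n * snd v) *\<^sub>R w p"
proof -
  have "((\<lambda>p. snd p ^ Suc n) has_derivative (\<lambda>v. real (Suc n) * snd p ^ n * snd v)) (at p)"
    by (rule has_derivative_eq_rhs[OF has_derivative_power[OF
        has_derivative_snd[OF has_derivative_ident]]])
       (simp add: fun_eq_iff)
  from has_derivative_scaleR[OF this smooth_on_has_derivative[OF w(1) p]]
  have "(z has_derivative (\<lambda>v. snd p ^ Suc n *\<^sub>R frechet_derivative w (at p) v
      + (real (Suc n) * snd p ^ n * snd v) *\<^sub>R w p)) (at p)"
    by (rule has_derivative_transform_within_open[OF _ smooth_on_imp_open[OF w(1)] p])
       (simp only: w(2))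
  from fun_cong[OF frechet_derivative_at[OF this], of v] show ?thesis by (rule sym)
qed

lemma flat_on_derivative_fst:
  assumes "flat_on U z"
  shows "flat_on U (\<lambda>p. frechet_derivative z (at p) (v, 0))"
  unfolding flat_on_def
proof
  fix n
  obtain w where w: "smooth_on U w" "\<And>p. p \<in> U \<Longrightarrow> z p = snd p ^ Suc n *\<^sub>R w p"
    using assms unfolding flat_on_def by blast
  let ?w = "\<lambda>p. snd p *\<^sub>R frechet_derivative w (at p) (v, 0)"
  have "smooth_on U ?w"
    by (intro smooth_on_intros smooth_on_frechet_derivative w(1) smooth_on_imp_open[OF w(1)])
  moreover have "frechet_derivative z (at p) (v, 0) = snd p ^ n *\<^sub>R ?w p" if "p \<in> U" for p
    using frechet_derivative_snd_power_scaleR[OF w that] by (simp add: mult.commute)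
  ultimately show "\<exists>w. smooth_on U w \<and> (\<forall>p\<in>U. frechet_derivative z (at p) (v, 0) = snd p ^ n *\<^sub>R w p)"
    by blast
qed

lemma flat_on_derivative_snd_divide:
  assumes "flat_on U z"
  shows "flat_on U (\<lambda>p. (1 / (2 * snd p)) *\<^sub>R frechet_derivative z (at p) (0, 1))"
  unfolding flat_on_def
proof
  fix n
  obtain w where w: "smooth_on U w" "\<And>p. p \<in> U \<Longrightarrow> z p = snd p ^ Suc (Suc (Suc n)) *\<^sub>R w p"
    using assms unfolding flat_on_def by blast
  let ?w = "\<lambda>p. (1/2) *\<^sub>R (snd p ^ 2 *\<^sub>R frechet_derivative w (at p) (0, 1)
      + (real (n + 3) * snd p) *\<^sub>R w p)"
  have "smooth_on U ?w"
    by (intro smooth_on_intros smooth_on_frechet_derivative w(1) smooth_on_imp_open[OF w(1)])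
  moreover have "(1 / (2 * snd p)) *\<^sub>R frechet_derivative z (at p) (0, 1) = snd p ^ n *\<^sub>R ?w p"
    if "p \<in> U" for p
    using frechet_derivative_snd_power_scaleR[OF w that, of "(0, 1)"]
    by (cases "snd p = 0") (simp_all add: scaleR_add_right power2_eq_square mult_ac add.commute)
  ultimately show "\<exists>w. smooth_on U w \<and>
      (\<forall>p\<in>U. (1 / (2 * snd p)) *\<^sub>R frechet_derivative z (at p) (0, 1) = snd p ^ n *\<^sub>R w p)"
    by blast
qed

lemma has_derivative_zero_if_quadratic:
  assumes "\<forall>\<^sub>F q in nhds p. norm (f q) \<le> C * (norm (q - p))\<^sup>2"
  shows "(f has_derivative (\<lambda>v. 0)) (at p)"
  unfolding has_derivative_iff_norm
proof (intro conjI bounded_linear_zero)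
  have "f p = 0" using eventually_nhds_x_imp_x[OF assms] by simp
  have "\<forall>\<^sub>F q in at p. norm (f q) \<le> C * (norm (q - p))\<^sup>2 \<and> q \<noteq> p"
    using assms by (auto simp: eventually_at_filter elim: eventually_mono)
  then have "\<forall>\<^sub>F q in at p. norm (norm (f q - f p - 0) / norm (q - p)) \<le> C * norm (q - p)"
    by eventually_elim (simp add: \<open>f p = 0\<close> divide_le_eq power2_eq_square mult.assoc)
  moreover have "((\<lambda>q. C * norm (q - p)) \<longlongrightarrow> 0) (at p)"
    by (auto intro!: tendsto_eq_intros)
  ultimately show "((\<lambda>q. norm (f q - f p - 0) / norm (q - p)) \<longlongrightarrow> 0) (at p)"
    by (rule Lim_null_comparison)
qed

lemma sqrt_in_cylinder:
  assumes "r > 0" "q \<in> A \<times> {..<r\<^sup>2}" "snd q > 0"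
  shows "(fst q, sqrt (snd q)) \<in> A \<times> {-r<..<r}"
  using assms real_sqrt_gt_zero[OF assms(3)] by (auto intro: real_less_lsqrt
      order.strict_trans[of "-r" 0])

lemma half_plane_glue_has_derivative_pos:
  fixes z :: "'a::real_normed_vector \<times> real \<Rightarrow> 'b::real_normed_vector"
  assumes r: "r > 0" and z: "smooth_on (A \<times> {-r<..<r}) z"
    and p: "p \<in> A \<times> {..<r\<^sup>2}" "snd p > 0"
  shows "(half_plane_glue z has_derivative (\<lambda>v.
      half_plane_glue (\<lambda>q. frechet_derivative z (at q) (fst v, 0)) p
      + snd v *\<^sub>R half_plane_glue
          (\<lambda>q. (1 / (2 * snd q)) *\<^sub>R frechet_derivative z (at q) (0, 1)) p)) (at p)"
proof -
  let ?q = "(fst p, sqrt (snd p))"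
  have "((\<lambda>p. (fst p, sqrt (snd p))) has_derivative (\<lambda>v. (fst v, snd v / (2 * sqrt (snd p))))) (at p)"
    using p(2) by (auto intro!: derivative_eq_intros simp: field_simps)
  moreover have Dz: "(z has_derivative frechet_derivative z (at ?q)) (at ?q)"
    by (rule smooth_on_has_derivative[OF z sqrt_in_cylinder[OF r p]])
  ultimately have "((\<lambda>p. z (fst p, sqrt (snd p))) has_derivative
      (\<lambda>v. frechet_derivative z (at ?q) (fst v, snd v / (2 * sqrt (snd p))))) (at p)"
    by (rule has_derivative_compose)
  moreover have "frechet_derivative z (at ?q) (fst v, snd v / (2 * sqrt (snd p))) =
      frechet_derivative z (at ?q) (fst v, 0)
      + snd v *\<^sub>R (1 / (2 * sqrt (snd p))) *\<^sub>R frechet_derivative z (at ?q) (0, 1)" for v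
  proof -
    interpret linear "frechet_derivative z (at ?q)" using Dz by (rule has_derivative_linear)
    have "(fst v, snd v / (2 * sqrt (snd p)))
      = (fst v, 0) + (snd v / (2 * sqrt (snd p))) *\<^sub>R (0, 1)" by simp
    then show ?thesis unfolding scaleR_scaleR by (simp only: add scale) simp
  qed
  ultimately have "((\<lambda>p. z (fst p, sqrt (snd p))) has_derivative
      (\<lambda>v. frechet_derivative z (at ?q) (fst v, 0)
        + snd v *\<^sub>R (1 / (2 * sqrt (snd p))) *\<^sub>R frechet_derivative z (at ?q) (0, 1))) (at p)"
    by simp
  moreover have "\<forall>\<^sub>F q in nhds p. q \<in> UNIV \<times> {0<..}"
    using p(2) by (intro eventually_nhds_in_open open_Times) (auto simp: mem_Times_iff)
  then have "\<forall>\<^sub>F q in nhds p. z (fst q, sqrt (snd q)) = half_plane_glue z q"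
    by eventually_elim (auto simp: half_plane_glue_def)
  ultimately have "(half_plane_glue z has_derivative (\<lambda>v. frechet_derivative z (at ?q) (fst v, 0)
        + snd v *\<^sub>R (1 / (2 * sqrt (snd p))) *\<^sub>R frechet_derivative z (at ?q) (0, 1))) (at p)"
    by (rule has_derivative_transform_nhds)
  then show ?thesis using p(2) by (simp add: half_plane_glue_def)
qed

lemma half_plane_glue_has_derivative_boundary:
  fixes z :: "'a::real_normed_vector \<times> real \<Rightarrow> 'b::real_normed_vector"
  assumes r: "r > 0" and A: "open A" and flat: "flat_on (A \<times> {-r<..<r}) z"
    and p: "p \<in> A \<times> {..<r\<^sup>2}" "snd p = 0"
  shows "(half_plane_glue z has_derivative (\<lambda>v. 0)) (at p)"
proof -
  obtain w where w: "smooth_on (A \<times> {-r<..<r}) w"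
      "\<And>q. q \<in> A \<times> {-r<..<r} \<Longrightarrow> z q = snd q ^ 4 *\<^sub>R w q"
    using flat unfolding flat_on_def by blast
  define s where "s q = (fst q, sqrt (max 0 (snd q)))" for q :: "'a \<times> real"
  have sp: "s p = p" using p(2) by (simp add: s_def prod_eq_iff)
  have "p \<in> A \<times> {-r<..<r}" using p r by (auto simp: mem_Times_iff)
  then have "isCont w (s p)"
    using smooth_on_imp_continuous_on[OF w(1)]
      continuous_on_eq_continuous_at[OF smooth_on_imp_open[OF w(1)]]
    unfolding sp by blast
  moreover have "(s \<longlongrightarrow> s p) (nhds p)"
    unfolding s_def by (intro tendsto_intros filterlim_ident)
  ultimately have "((\<lambda>q. w (s q)) \<longlongrightarrow> w (s p)) (nhds p)"
    by (rule isCont_tendsto_compose)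
  then have "((\<lambda>q. norm (w (s q))) \<longlongrightarrow> norm (w p)) (nhds p)" unfolding sp by (rule tendsto_norm)
  then have "\<forall>\<^sub>F q in nhds p. norm (w (s q)) < norm (w p) + 1" by (rule order_tendstoD) simp
  moreover have "\<forall>\<^sub>F q in nhds p. q \<in> A \<times> {..<r\<^sup>2}"
    by (rule eventually_nhds_in_open[OF open_Times[OF A] p(1)]) simp
  ultimately have "\<forall>\<^sub>F q in nhds p. norm (half_plane_glue z q) \<le> (norm (w p) + 1) * (norm (q - p))\<^sup>2"
  proof eventually_elim
    case (elim q)
    show ?case
    proof (cases "snd q > 0")
      case True
      have "norm (snd q) \<le> norm (q - p)"
        using norm_snd_le[of "snd (q - p)" "fst (q - p)", unfolded prod.collapse] p(2) by simp
      then have le: "(snd q)\<^sup>2 \<le> (norm (q - p))\<^sup>2" using True by (simp add: power_mono)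
      have "s q \<in> A \<times> {-r<..<r}" using sqrt_in_cylinder[OF r elim(2) True] True by (simp add: s_def)
      then have "half_plane_glue z q = (snd q)\<^sup>2 *\<^sub>R w (s q)"
        using w(2)[of "s q"] True power_mult[of "sqrt (snd q)" 2 2]
        by (simp add: s_def half_plane_glue_def)
      then have "norm (half_plane_glue z q) = (snd q)\<^sup>2 * norm (w (s q))" by simp
      also have "\<dots> \<le> (norm (q - p))\<^sup>2 * (norm (w p) + 1)"
        using le elim(1) by (intro mult_mono) auto
      finally show ?thesis by (simp add: mult.commute)
    qed (simp add: half_plane_glue_def)
  qed
  then show ?thesis by (rule has_derivative_zero_if_quadratic)
qed

lemma half_plane_glue_has_derivative:
  fixes z :: "'a::real_normed_vector \<times> real \<Rightarrow> 'b::real_normed_vector"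
  assumes r: "r > 0" and A: "open A" and flat: "flat_on (A \<times> {-r<..<r}) z"
    and p: "p \<in> A \<times> {..<r\<^sup>2}"
  shows "(half_plane_glue z has_derivative (\<lambda>v.
      half_plane_glue (\<lambda>q. frechet_derivative z (at q) (fst v, 0)) p
      + snd v *\<^sub>R half_plane_glue
          (\<lambda>q. (1 / (2 * snd q)) *\<^sub>R frechet_derivative z (at q) (0, 1)) p)) (at p)"
proof -
  consider (pos) "snd p > 0" | (neg) "snd p < 0" | (zero) "snd p = 0" by linarith
  then show ?thesis
  proof cases
    case pos
    then show ?thesis
      by (rule half_plane_glue_has_derivative_pos[OF r flat_on_imp_smooth_on[OF flat] p])
  next
    case neg
    have "\<forall>\<^sub>F q in nhds p. q \<in> UNIV \<times> {..<0}"
      using neg by (intro eventually_nhds_in_open open_Times) (auto simp: mem_Times_iff)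
    then have "\<forall>\<^sub>F q in nhds p. 0 = half_plane_glue z q"
      by eventually_elim (auto simp: half_plane_glue_def)
    from has_derivative_transform_nhds[OF has_derivative_const this] show ?thesis
      using neg by (simp add: half_plane_glue_def[of _ p])
  next
    case zero
    then show ?thesis
      using half_plane_glue_has_derivative_boundary[OF r A flat p]
      by (simp add: half_plane_glue_def[of _ p])
  qed
qed

lemma smooth_on_half_plane_glue:
  fixes z :: "'a::real_normed_vector \<times> real \<Rightarrow> 'b::real_normed_vector"
  assumes r: "r > 0" and A: "open A" and flat: "flat_on (A \<times> {-r<..<r}) z"
  shows "smooth_on (A \<times> {..<r\<^sup>2}) (half_plane_glue z)"
proof -
  have U: "open (A \<times> {..<r\<^sup>2})" using A by (intro open_Times) auto
  have "Ck_on n (A \<times> {..<r\<^sup>2}) (half_plane_glue z)" for n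
    using flat
  proof (induction n arbitrary: z)
    case 0
    show ?case
      using has_derivative_continuous[OF half_plane_glue_has_derivative[OF r A 0]]
      by (simp add: continuous_at_imp_continuous_on)
  next
    case (Suc n)
    show ?case
      by (rule Ck_on_SucI[OF U half_plane_glue_has_derivative[OF r A Suc.prems]])
         (auto intro!: Ck_on_add Ck_on_scaleR Ck_on_const U Suc flat_on_derivative_fst
             flat_on_derivative_snd_divide)
  qed
  then show ?thesis using U smooth_on_iff_Ck_on by blast
qed

subsection \<open>Borel's theorem with a parameter\<close>

definition flat_exp :: "nat \<Rightarrow> real \<Rightarrow> real" where
  "flat_exp m t = (if t > 0 then inverse t ^ m * exp (- inverse t) else 0)"

lemma flat_exp_has_derivative_pos:
  assumes "t > 0"
  shows "(flat_exp m has_real_derivative flat_exp (m + 2) t - m * flat_exp (Suc m) t) (at t)"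
proof -
  have "((\<lambda>t. inverse t ^ m) has_real_derivative - real m * inverse t ^ Suc m) (at t)"
    using DERIV_power[OF DERIV_inverse, of t m] assms by (cases m) (auto simp: algebra_simps)
  moreover have "((\<lambda>t. exp (- inverse t)) has_real_derivative exp (- inverse t) * (inverse t)\<^sup>2) (at t)"
    using assms by (auto intro!: derivative_eq_intros simp: power2_eq_square)
  ultimately have "((\<lambda>t. inverse t ^ m * exp (- inverse t)) has_real_derivative
      flat_exp (m + 2) t - m * flat_exp (Suc m) t) (at t)"
    by (rule DERIV_cong[OF DERIV_mult])
      (use assms in \<open>simp add: flat_exp_def algebra_simps power2_eq_square\<close>)
  then show ?thesis
    by (rule has_field_derivative_transform_within_open[where S="{0<..}"])
       (use assms in \<open>auto simp: flat_exp_def\<close>)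
qed

lemma flat_exp_has_derivative_0: "(flat_exp m has_real_derivative 0) (at 0)"
proof -
  have "((\<lambda>t. inverse t ^ Suc m / exp (inverse t)) \<longlongrightarrow> (0::real)) (at_right 0)"
    by (rule filterlim_compose[OF tendsto_power_div_exp_0 filterlim_inverse_at_top_right])
  then have "((\<lambda>t. (flat_exp m t - flat_exp m 0) / (t - 0)) \<longlongrightarrow> 0) (at_right 0)"
    by (rule Lim_transform_eventually)
       (auto simp: eventually_at_right_field flat_exp_def exp_minus field_simps intro!: exI[of _ 1])
  moreover have "((\<lambda>t. (flat_exp m t - flat_exp m 0) / (t - 0)) \<longlongrightarrow> 0) (at_left 0)"
    by (rule Lim_transform_eventually[OF tendsto_const])
       (auto simp: eventually_at_left_field flat_exp_def intro!: exI[of _ "-1"])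
  ultimately have "((\<lambda>t. (flat_exp m t - flat_exp m 0) / (t - 0)) \<longlongrightarrow> 0) (at 0)"
    by (rule filterlim_split_at_real[rotated])
  then show ?thesis by (simp add: has_field_derivative_iff)
qed

lemma flat_exp_has_derivative:
  "(flat_exp m has_real_derivative flat_exp (m + 2) t - m * flat_exp (Suc m) t) (at t)"
proof -
  consider (pos) "t > 0" | (neg) "t < 0" | (zero) "t = 0" by linarith
  then show ?thesis
  proof cases
    case neg
    have "((\<lambda>t. 0) has_real_derivative flat_exp (m + 2) t - m * flat_exp (Suc m) t) (at t)"
      using neg by (simp add: flat_exp_def)
    then show ?thesis
      by (rule has_field_derivative_transform_within_open[where S="{..<0}"])
         (use neg in \<open>auto simp: flat_exp_def\<close>)
  qed (use flat_exp_has_derivative_pos flat_exp_has_derivative_0 in \<open>auto simp: flat_exp_def[of _ 0]\<close>)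
qed

lemma smooth_on_flat_exp: "smooth_on UNIV (flat_exp m)"
proof -
  have "Ck_on n UNIV (flat_exp m)" for n
  proof (induction n arbitrary: m)
    case 0
    show ?case
      by (auto intro!: continuous_at_imp_continuous_on DERIV_isCont flat_exp_has_derivative)
  next
    case (Suc n)
    have "Ck_on n UNIV (\<lambda>t. flat_exp (m + 2) t + - real m * flat_exp (Suc m) t)"
      by (intro Ck_on_add Ck_on_mult Ck_on_const Suc open_UNIV)
    then show ?case
      by (intro Ck_on_Suc_realI[OF open_UNIV flat_exp_has_derivative]) simp
  qed
  then show ?thesis by (simp add: smooth_on_iff_Ck_on)
qed

definition bump :: "real \<Rightarrow> real" where
  "bump t = flat_exp 0 (4 - t\<^sup>2) * inverse (flat_exp 0 (4 - t\<^sup>2) + flat_exp 0 (t\<^sup>2 - 1))"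

lemma bump_eq_1: "\<bar>t\<bar> \<le> 1 \<Longrightarrow> bump t = 1"
  using abs_square_le_1[of t] by (auto simp: bump_def flat_exp_def)

lemma bump_eq_0: "\<bar>t\<bar> > 2 \<Longrightarrow> bump t = 0"
  using power_strict_mono[of 2 "\<bar>t\<bar>" 2] by (simp add: bump_def flat_exp_def)

lemma smooth_on_bump: "smooth_on UNIV bump"
proof -
  have smooth: "smooth_on UNIV (\<lambda>t. flat_exp 0 (4 - t\<^sup>2))" "smooth_on UNIV (\<lambda>t. flat_exp 0 (t\<^sup>2 - 1))"
    by (auto intro!: smooth_on_compose[OF smooth_on_flat_exp] smooth_on_intros)
  have "flat_exp 0 (4 - t\<^sup>2) + flat_exp 0 (t\<^sup>2 - 1) > 0" for t
    by (simp add: flat_exp_def add_pos_pos)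
  then have "smooth_on UNIV (\<lambda>t. inverse (flat_exp 0 (4 - t\<^sup>2) + flat_exp 0 (t\<^sup>2 - 1)))"
    by (intro smooth_on_compose[OF smooth_on_inverse] smooth_on_add smooth) (auto simp: less_le)
  then show ?thesis unfolding bump_def[abs_def] by (intro smooth_on_mult smooth)
qed

lemma smooth_on_bump_divide: "smooth_on UNIV (\<lambda>y. bump (y / \<epsilon>))"
  by (rule smooth_on_compose[OF smooth_on_bump
      smooth_on_linear_compose[OF bounded_linear_divide smooth_on_ident]])
     auto

lemma smooth_on_bump_minus_1_quotient:
  assumes "\<epsilon> > 0"
  shows "smooth_on UNIV (\<lambda>y. (bump (y / \<epsilon>) - 1) * inverse y ^ m)"
proof -
  have "smooth_on (- {0}) (\<lambda>y. (bump (y / \<epsilon>) - 1) * inverse y ^ m)"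
    by (intro smooth_on_intros smooth_on_inverse smooth_on_subset[OF smooth_on_bump_divide]) auto
  moreover have "smooth_on {-\<epsilon><..<\<epsilon>} (\<lambda>y. (bump (y / \<epsilon>) - 1) * inverse y ^ m)"
  proof (rule smooth_on_cong[OF smooth_on_const[of _ 0]])
    fix y assume "y \<in> {-\<epsilon><..<\<epsilon>}"
    then have "\<bar>y / \<epsilon>\<bar> \<le> 1" using assms by (simp add: abs_le_iff field_simps)
    then show "0 = (bump (y / \<epsilon>) - 1) * inverse y ^ m" using bump_eq_1 by simp
  qed auto
  ultimately have "smooth_on (- {0} \<union> {-\<epsilon><..<\<epsilon>}) (\<lambda>y. (bump (y / \<epsilon>) - 1) * inverse y ^ m)"
    by (rule smooth_on_Un)
  moreover have "- {0} \<union> {-\<epsilon><..<\<epsilon>} = UNIV" using assms by auto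
  ultimately show ?thesis by simp
qed

lemma compact_support_derivs_bounded:
  fixes f :: "real \<Rightarrow> real"
  assumes f: "smooth_on UNIV f" and supp: "\<And>t. \<bar>t\<bar> > c \<Longrightarrow> f t = 0"
  shows "\<exists>B\<ge>0. \<forall>t. \<bar>(deriv ^^ j) f t\<bar> \<le> B"
proof -
  have zero: "(deriv ^^ j) f t = 0" if "\<bar>t\<bar> > c" for t
    using that
  proof (induction j arbitrary: t)
    case 0
    then show ?case using supp by simp
  next
    case (Suc j)
    have "open {t::real. \<bar>t\<bar> > c}" by (intro open_Collect_less continuous_intros)
    from has_field_derivative_transform_within_open[OF DERIV_const this, of t 0]
    have "((deriv ^^ j) f has_real_derivative 0) (at t)" using Suc by simp
    then show ?case by (simp add: DERIV_imp_deriv)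
  qed
  have "continuous_on {-c..c} ((deriv ^^ j) f)"
    using smooth_on_imp_continuous_on[OF smooth_on_funpow_deriv[OF f]] continuous_on_subset by blast
  then obtain B where "B \<ge> 0" "\<forall>t\<in>{-c..c}. norm ((deriv ^^ j) f t) \<le> B"
    using continuous_on_compact_bound[OF compact_Icc] by metis
  then have "\<forall>t. \<bar>(deriv ^^ j) f t\<bar> \<le> B"
    using zero by (metis abs_le_iff abs_zero atLeastAtMost_iff linorder_not_less minus_le_iff
        real_norm_def)
  with \<open>B \<ge> 0\<close> show ?thesis by blast
qed

definition truncated_power :: "nat \<Rightarrow> real \<Rightarrow> real \<Rightarrow> real" where
  "truncated_power k \<epsilon> y = y ^ k * bump (y / \<epsilon>)"

lemma smooth_on_truncated_power: "smooth_on UNIV (truncated_power k \<epsilon>)"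
  unfolding truncated_power_def[abs_def] by (intro smooth_on_intros smooth_on_bump_divide open_UNIV)

lemma funpow_deriv_rescale:
  fixes f :: "real \<Rightarrow> real"
  assumes "smooth_on UNIV f"
  shows "(deriv ^^ j) (\<lambda>y. c * f (y / \<epsilon>)) = (\<lambda>y. c / \<epsilon> ^ j * (deriv ^^ j) f (y / \<epsilon>))"
proof (induction j)
  case (Suc j)
  have "((\<lambda>y. c / \<epsilon> ^ j * (deriv ^^ j) f (y / \<epsilon>)) has_real_derivative
      c / \<epsilon> ^ Suc j * (deriv ^^ Suc j) f (y / \<epsilon>)) (at y)" for y
  proof -
    have "((deriv ^^ j) f has_real_derivative (deriv ^^ Suc j) f (y / \<epsilon>)) (at (y / \<epsilon>))"
      using smooth_on_has_real_derivative[OF smooth_on_funpow_deriv[OF assms]] by simp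
    from DERIV_cmult[OF DERIV_chain2[OF this DERIV_cdivide[OF DERIV_ident]], of "c / \<epsilon> ^ j"]
    show ?thesis by (rule DERIV_cong) simp
  qed
  then have "deriv (\<lambda>y. c / \<epsilon> ^ j * (deriv ^^ j) f (y / \<epsilon>))
    = (\<lambda>y. c / \<epsilon> ^ Suc j * (deriv ^^ Suc j) f (y / \<epsilon>))"
    using DERIV_imp_deriv by blast
  with Suc show ?case by simp
qed simp

lemma truncated_power_derivs_bounded:
  "\<exists>C\<ge>0. \<forall>\<epsilon> y. 0 < \<epsilon> \<longrightarrow> \<bar>(deriv ^^ j) (truncated_power k \<epsilon>) y\<bar> \<le> \<epsilon> ^ k / \<epsilon> ^ j * C"
proof -
  obtain C where C: "C \<ge> 0" "\<And>t. \<bar>(deriv ^^ j) (truncated_power k 1) t\<bar> \<le> C"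
    using compact_support_derivs_bounded[OF smooth_on_truncated_power, of 2 k 1 j]
    by (auto simp: truncated_power_def bump_eq_0)
  have "\<bar>(deriv ^^ j) (truncated_power k \<epsilon>) y\<bar> \<le> \<epsilon> ^ k / \<epsilon> ^ j * C" if "0 < \<epsilon>" for \<epsilon> y
  proof -
    have "truncated_power k \<epsilon> = (\<lambda>y. \<epsilon> ^ k * truncated_power k 1 (y / \<epsilon>))"
      using that by (auto simp: truncated_power_def power_divide)
    then show ?thesis
      using C(2)[of "y / \<epsilon>"] that
      by (simp add: funpow_deriv_rescale[OF smooth_on_truncated_power] abs_mult mult_left_mono
          divide_right_mono)
  qed
  with C(1) show ?thesis by blast
qed

lemma norm_linear_diff_le:
  fixes L :: "'a::euclidean_space \<Rightarrow> 'b::real_normed_vector"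
  assumes L: "linear L" and le: "\<And>b. b \<in> Basis \<Longrightarrow> norm (L b - g b) \<le> e / DIM('a)"
  shows "norm (L h - (\<Sum>b\<in>Basis. (h \<bullet> b) *\<^sub>R g b)) \<le> e * norm h"
proof -
  have "L h - (\<Sum>b\<in>Basis. (h \<bullet> b) *\<^sub>R g b) = (\<Sum>b\<in>Basis. (h \<bullet> b) *\<^sub>R (L b - g b))"
    unfolding linear_euclidean_expansion[OF L, of h] by (simp add: sum_subtractf scaleR_diff_right)
  also have "norm \<dots> \<le> (\<Sum>b\<in>(Basis :: 'a set). norm h * (e / DIM('a)))"
  proof (rule sum_norm_le)
    show "norm ((h \<bullet> b) *\<^sub>R (L b - g b)) \<le> norm h * (e / DIM('a))" if "b \<in> Basis" for b
      unfolding norm_scaleR using Basis_le_norm[OF that] le[OF that] by (intro mult_mono) auto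
  qed
  also have "\<dots> = e * norm h" by simp
  finally show ?thesis .
qed

lemma has_derivative_suminf:
  fixes f :: "nat \<Rightarrow> 'a::euclidean_space \<Rightarrow> 'b::banach"
  assumes U: "open U" "x \<in> U"
    and f: "\<And>k x. x \<in> U \<Longrightarrow> (f k has_derivative f' k x) (at x)"
    and summable: "\<And>x. x \<in> U \<Longrightarrow> summable (\<lambda>k. f k x)"
    and unif: "\<And>b. b \<in> Basis \<Longrightarrow> uniform_limit U (\<lambda>n x. \<Sum>k<n. f' k x b) (g b) sequentially"
  shows "((\<lambda>x. \<Sum>k. f k x) has_derivative (\<lambda>h. \<Sum>b\<in>Basis. (h \<bullet> b) *\<^sub>R g b x)) (at x)"
proof -
  obtain d where d: "d > 0" "ball x d \<subseteq> U" using U open_contains_ball by blast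
  have "\<exists>S. \<forall>y\<in>ball x d. (\<lambda>k. f k y) sums S y \<and>
      (S has_derivative (\<lambda>h. \<Sum>b\<in>Basis. (h \<bullet> b) *\<^sub>R g b y)) (at y within ball x d)"
  proof (rule has_derivative_series[where f'=f'])
    show "(f k has_derivative f' k y) (at y within ball x d)" if "y \<in> ball x d" for k y
      using that d(2) by (blast intro: has_derivative_at_withinI f)
    show "(\<lambda>k. f k x) sums (\<Sum>k. f k x)" using summable[OF U(2)] by (rule summable_sums)
  next
    fix e :: real assume "e > 0"
    then have "\<forall>\<^sub>F n in sequentially. \<forall>b\<in>Basis. \<forall>y\<in>U. dist (\<Sum>k<n. f' k y b) (g b y) < e / DIM('a)"
      by (intro eventually_ball_finite ballI uniform_limitD[OF unif]) auto
    then show "\<forall>\<^sub>F n in sequentially. \<forall>y\<in>ball x d. \<forall>h.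
        norm ((\<Sum>k<n. f' k y h) - (\<Sum>b\<in>Basis. (h \<bullet> b) *\<^sub>R g b y)) \<le> e * norm h"
    proof (eventually_elim, intro ballI allI)
      case (elim n)
      fix y h assume "y \<in> ball x d"
      then have y: "y \<in> U" using d by blast
      show "norm ((\<Sum>k<n. f' k y h) - (\<Sum>b\<in>Basis. (h \<bullet> b) *\<^sub>R g b y)) \<le> e * norm h"
      proof (rule norm_linear_diff_le)
        show "linear (\<lambda>h. \<Sum>k<n. f' k y h)"
          by (intro linear_compose_sum ballI has_derivative_linear[OF f[OF y]])
        show "norm ((\<Sum>k<n. f' k y b) - g b y) \<le> e / DIM('a)" if "b \<in> Basis" for b
          using elim that y by (auto simp: dist_norm less_imp_le)
      qed
    qed
  qed (use d in auto)
  then obtain S where S: "\<And>y. y \<in> ball x d \<Longrightarrow> (\<lambda>k. f k y) sums S y"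
      "\<And>y. y \<in> ball x d \<Longrightarrow>
        (S has_derivative (\<lambda>h. \<Sum>b\<in>Basis. (h \<bullet> b) *\<^sub>R g b y)) (at y within ball x d)"
    by blast
  have x: "x \<in> ball x d" using d(1) by simp
  have "(S has_derivative (\<lambda>h. \<Sum>b\<in>Basis. (h \<bullet> b) *\<^sub>R g b x)) (at x)"
    using S(2)[OF x] at_within_open[OF x open_ball] by simp
  then show ?thesis
    by (rule has_derivative_transform_within_open[OF _ open_ball x]) (rule sums_unique[OF S(1)])
qed

lemma smooth_on_suminf:
  fixes f :: "nat \<Rightarrow> 'a::euclidean_space \<Rightarrow> 'b::banach"
  assumes U: "open U" and f: "\<And>k. smooth_on U (f k)"
    and M: "\<And>vs. set vs \<subseteq> Basis \<Longrightarrow> summable (M vs)"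
    and le: "\<And>vs. set vs \<subseteq> Basis \<Longrightarrow> \<forall>\<^sub>F k in sequentially. \<forall>x\<in>U. norm (iter_dd vs (f k) x) \<le> M vs k"
  shows "smooth_on U (\<lambda>x. \<Sum>k. f k x)"
proof -
  have summable: "summable (\<lambda>k. iter_dd vs (f k) x)" if "set vs \<subseteq> Basis" "x \<in> U" for vs x
    by (rule summable_comparison_test_ev[OF _ M[OF that(1)]])
       (use le[OF that(1)] that(2) in \<open>auto elim: eventually_mono\<close>)
  have unif: "uniform_limit U (\<lambda>n x. \<Sum>k<n. iter_dd vs (f k) x) (\<lambda>x. \<Sum>k. iter_dd vs (f k) x) sequentially"
    if "set vs \<subseteq> Basis" for vs
    by (rule Weierstrass_m_test_ev[OF le[OF that] M[OF that]])
  have deriv: "((\<lambda>x. \<Sum>k. iter_dd vs (f k) x) has_derivative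
      (\<lambda>h. \<Sum>b\<in>Basis. (h \<bullet> b) *\<^sub>R (\<Sum>k. iter_dd (b # vs) (f k) x))) (at x)"
    if vs: "set vs \<subseteq> Basis" and x: "x \<in> U" for vs x
  proof (rule has_derivative_suminf[OF U x])
    show "(iter_dd vs (f k) has_derivative frechet_derivative (iter_dd vs (f k)) (at y)) (at y)"
      if "y \<in> U" for k y
      by (rule smooth_on_has_derivative[OF smooth_on_iter_dd[OF f] that])
    show "uniform_limit U (\<lambda>n x. \<Sum>k<n. frechet_derivative (iter_dd vs (f k)) (at x) b)
        (\<lambda>x. \<Sum>k. iter_dd (b # vs) (f k) x) sequentially" if "b \<in> Basis" for b
      using unif[of "b # vs"] vs that by simp
  qed (rule summable[OF vs])
  have "Ck_on n U (\<lambda>x. \<Sum>k. iter_dd vs (f k) x)" if "set vs \<subseteq> Basis" for n vs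
    using that
  proof (induction n arbitrary: vs)
    case 0
    then show ?case
      using has_derivative_continuous[OF deriv] by (simp add: continuous_at_imp_continuous_on)
  next
    case (Suc n)
    show ?case
      by (rule Ck_on_SucI[OF U deriv[OF Suc.prems]])
         (use Suc in \<open>auto simp del: iter_dd.simps(2) intro!: Ck_on_sum Ck_on_scaleR Ck_on_const U\<close>)
  qed
  from this[of "[]"] show ?thesis using U by (simp add: smooth_on_iff_Ck_on)
qed

lemma iter_dd_scaleR_product:
  fixes e :: "'a::euclidean_space \<Rightarrow> 'b::real_normed_vector" and m :: "real \<Rightarrow> real"
  assumes m: "smooth_on UNIV m" and e: "smooth_on U e"
    and "set vs \<subseteq> Basis" "p \<in> U \<times> UNIV"
  shows "iter_dd vs (\<lambda>p. m (snd p) *\<^sub>R e (fst p)) p =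
    (deriv ^^ length (filter (\<lambda>v. snd v \<noteq> 0) vs)) m (snd p) *\<^sub>R
      iter_dd (map fst (filter (\<lambda>v. snd v = 0) vs)) e (fst p)"
  using assms(3,4)
proof (induction vs arbitrary: p)
  case (Cons v vs)
  let ?j = "length (filter (\<lambda>v. snd v \<noteq> 0) vs)" and ?ws = "map fst (filter (\<lambda>v. snd v = 0) vs)"
  let ?m = "(deriv ^^ ?j) m" and ?e = "iter_dd ?ws e"
  have U: "open (U \<times> (UNIV :: real set))" using smooth_on_imp_open[OF e] by (intro open_Times) auto
  have p: "fst p \<in> U" using Cons.prems(2) by auto
  have De: "(?e has_derivative frechet_derivative ?e (at (fst p))) (at (fst p))"
    by (rule smooth_on_has_derivative[OF smooth_on_iter_dd[OF e] p])
  have "((\<lambda>p. ?m (snd p)) has_derivative (\<lambda>h. deriv ?m (snd p) * snd h)) (at p)"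
    using has_derivative_compose[OF has_derivative_snd[OF has_derivative_ident]
        smooth_on_has_real_derivative[OF smooth_on_funpow_deriv[OF m], unfolded
            has_field_derivative_def]]
    by simp
  moreover have "((\<lambda>p. ?e (fst p)) has_derivative
      (\<lambda>h. frechet_derivative ?e (at (fst p)) (fst h))) (at p)"
    by (rule has_derivative_compose[OF has_derivative_fst[OF has_derivative_ident] De])
  ultimately have "((\<lambda>p. ?m (snd p) *\<^sub>R ?e (fst p)) has_derivative
      (\<lambda>h. ?m (snd p) *\<^sub>R frechet_derivative ?e (at (fst p)) (fst h)
        + (deriv ?m (snd p) * snd h) *\<^sub>R ?e (fst p))) (at p)"
    by (rule has_derivative_scaleR)
  then have "(iter_dd vs (\<lambda>p. m (snd p) *\<^sub>R e (fst p)) has_derivative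
      (\<lambda>h. ?m (snd p) *\<^sub>R frechet_derivative ?e (at (fst p)) (fst h)
        + (deriv ?m (snd p) * snd h) *\<^sub>R ?e (fst p))) (at p)"
    by (rule has_derivative_transform_within_open[OF _ U Cons.prems(2)]) (use Cons in auto)
  from frechet_derivative_at[OF this, symmetric]
  have D: "iter_dd (v # vs) (\<lambda>p. m (snd p) *\<^sub>R e (fst p)) p =
      ?m (snd p) *\<^sub>R frechet_derivative ?e (at (fst p)) (fst v)
      + (deriv ?m (snd p) * snd v) *\<^sub>R ?e (fst p)"
    by simp
  consider b where "v = (b, 0)" | "v = (0, 1)"
    using Cons.prems(1) by (auto simp: Basis_prod_def)
  then show ?case
    by cases (unfold D, simp_all add: linear_0[OF has_derivative_linear[OF De]])
qed simp

lemma smooth_on_product_series: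
  fixes e :: "nat \<Rightarrow> 'a::euclidean_space \<Rightarrow> 'b::banach" and m :: "nat \<Rightarrow> real \<Rightarrow> real"
  assumes U: "open U" and e: "\<And>k. smooth_on U (e k)" and m: "\<And>k. smooth_on UNIV (m k)"
    and le: "\<And>j ws. set ws \<subseteq> Basis \<Longrightarrow> \<forall>\<^sub>F k in sequentially. \<forall>x\<in>U. \<forall>y.
      norm ((deriv ^^ j) (m k) y *\<^sub>R iter_dd ws (e k) x) \<le> (1/2) ^ k"
  shows "smooth_on (U \<times> UNIV) (\<lambda>p. \<Sum>k. m k (snd p) *\<^sub>R e k (fst p))"
    and "x \<in> U \<Longrightarrow> summable (\<lambda>k. m k y *\<^sub>R e k x)"
proof -
  show "smooth_on (U \<times> UNIV) (\<lambda>p. \<Sum>k. m k (snd p) *\<^sub>R e k (fst p))"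
  proof (rule smooth_on_suminf[where M="\<lambda>vs k. (1/2) ^ k"])
    show UV: "open (U \<times> (UNIV :: real set))" using U by (intro open_Times) auto
    show "smooth_on (U \<times> UNIV) (\<lambda>p. m k (snd p) *\<^sub>R e k (fst p))" for k
      by (intro smooth_on_scaleR smooth_on_compose[OF m] smooth_on_compose[OF e] smooth_on_intros
          UV) auto
    fix vs :: "('a \<times> real) list" assume vs: "set vs \<subseteq> Basis"
    then have "set (map fst (filter (\<lambda>v. snd v = 0) vs)) \<subseteq> Basis"
      by (auto simp: Basis_prod_def)
    from le[OF this, of "length (filter (\<lambda>v. snd v \<noteq> 0) vs)"]
    show "\<forall>\<^sub>F k in sequentially. \<forall>p\<in>U \<times> UNIV. norm (iter_dd vs (\<lambda>p. m k (snd p) *\<^sub>R e k (fst p)) p)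
      \<le> (1/2) ^ k"
      by eventually_elim (use iter_dd_scaleR_product[OF m e vs] in auto)
  qed (simp add: summable_geometric)
  show "summable (\<lambda>k. m k y *\<^sub>R e k x)" if "x \<in> U"
  proof (rule summable_comparison_test_ev)
    show "\<forall>\<^sub>F k in sequentially. norm (m k y *\<^sub>R e k x) \<le> (1/2) ^ k"
      using le[of "[]" 0] by (auto elim!: eventually_mono simp: that)
  qed (simp add: summable_geometric)
qed

lemma finite_ex_small_scale:
  fixes F :: "real set"
  assumes "finite F" "\<delta> > 0"
  obtains \<epsilon> where "0 < \<epsilon>" "\<epsilon> \<le> 1" "\<And>c. c \<in> F \<Longrightarrow> \<epsilon> * c \<le> \<delta>"
proof -
  define S where "S = (\<Sum>c\<in>F. \<bar>c\<bar>)"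
  have S: "S \<ge> 0" unfolding S_def by (rule sum_nonneg) simp
  define \<epsilon> where "\<epsilon> = min 1 (\<delta> / (1 + S))"
  have \<epsilon>: "0 < \<epsilon>" "\<epsilon> \<le> \<delta> / (1 + S)" using assms(2) S by (auto simp: \<epsilon>_def)
  have "\<epsilon> * c \<le> \<delta>" if "c \<in> F" for c
  proof -
    have "\<bar>c\<bar> \<le> S" unfolding S_def by (rule member_le_sum) (use that assms(1) in auto)
    then have "\<epsilon> * c \<le> \<epsilon> * (1 + S)" using \<epsilon>(1) by (intro mult_left_mono) auto
    also have "\<dots> \<le> \<delta>" using \<epsilon>(2) S by (simp add: pos_le_divide_eq)
    finally show ?thesis .
  qed
  then show ?thesis using that[of \<epsilon>] \<epsilon>(1) by (simp add: \<epsilon>_def)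
qed

lemma ex_small_scales:
  fixes F :: "nat \<Rightarrow> real set"
  assumes "\<And>k. finite (F k)" "\<And>k. \<delta> k > 0"
  obtains \<epsilon> where "\<And>k. 0 < \<epsilon> k" "\<And>k. \<epsilon> k \<le> 1" "\<And>k c. c \<in> F k \<Longrightarrow> \<epsilon> k * c \<le> \<delta> k"
proof -
  have "\<forall>k. \<exists>\<epsilon>. 0 < \<epsilon> \<and> \<epsilon> \<le> 1 \<and> (\<forall>c\<in>F k. \<epsilon> * c \<le> \<delta> k)"
    using finite_ex_small_scale[OF assms] by metis
  then show ?thesis unfolding choice_iff using that by blast
qed

lemma iter_dd_bounded:
  fixes e :: "'a::euclidean_space \<Rightarrow> 'b::real_normed_vector"
  assumes "smooth_on U e" "bounded A" "closure A \<subseteq> U"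
  shows "\<exists>B\<ge>0. \<forall>x\<in>A. norm (iter_dd ws e x) \<le> B"
proof -
  have "continuous_on (closure A) (iter_dd ws e)"
    using smooth_on_imp_continuous_on[OF smooth_on_iter_dd[OF assms(1)]] assms(3)
      continuous_on_subset by blast
  moreover have "compact (closure A)" using assms(2) by (simp add: compact_closure)
  ultimately show ?thesis
    using continuous_on_compact_bound closure_subset by (metis subsetD)
qed

lemma borel_scales:
  fixes e :: "nat \<Rightarrow> 'a::euclidean_space \<Rightarrow> 'b::real_normed_vector"
  assumes e: "\<And>k. smooth_on U (e k)" and A: "bounded A" "closure A \<subseteq> U"
  obtains \<epsilon> where "\<And>k. 0 < \<epsilon> k"
    "\<And>n j ws. set ws \<subseteq> Basis \<Longrightarrow> \<forall>\<^sub>F k in sequentially. \<forall>x\<in>A. \<forall>y.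
      norm ((deriv ^^ j) (truncated_power k (\<epsilon> (k + n))) y *\<^sub>R iter_dd ws (e (k + n)) x) \<le> (1/2) ^ k"
proof -
  have "\<forall>k j. \<exists>C\<ge>0. \<forall>\<epsilon> y. 0 < \<epsilon> \<longrightarrow> \<bar>(deriv ^^ j) (truncated_power k \<epsilon>) y\<bar> \<le> \<epsilon> ^ k / \<epsilon> ^ j * C"
    using truncated_power_derivs_bounded by blast
  then obtain C where C: "\<And>k j. C k j \<ge> 0"
      "\<And>k j \<epsilon> y. 0 < \<epsilon> \<Longrightarrow> \<bar>(deriv ^^ j) (truncated_power k \<epsilon>) y\<bar> \<le> \<epsilon> ^ k / \<epsilon> ^ j * C k j"
    unfolding choice_iff by blast
  have "\<forall>k ws. \<exists>B\<ge>0. \<forall>x\<in>A. norm (iter_dd ws (e k) x) \<le> B"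
    using iter_dd_bounded[OF e A] by blast
  then obtain B where B: "\<And>k ws. B k ws \<ge> 0" "\<And>k ws x. x \<in> A \<Longrightarrow> norm (iter_dd ws (e k) x) \<le> B k ws"
    unfolding choice_iff by blast
  define L where "L k = {ws :: 'a list. set ws \<subseteq> Basis \<and> length ws \<le> k}" for k
  let ?F = "\<lambda>k. (\<lambda>(l, j, ws). C l j * B k ws) ` ({..k} \<times> {..k} \<times> L k)"
  have "finite (?F k)" for k
    unfolding L_def by (intro finite_imageI finite_cartesian_product finite_lists_length_le) auto
  then obtain \<epsilon> where \<epsilon>: "\<And>k. 0 < \<epsilon> k" "\<And>k. \<epsilon> k \<le> 1" "\<And>k c. c \<in> ?F k \<Longrightarrow> \<epsilon> k * c \<le> (1/2) ^ k"
    by (rule ex_small_scales[of ?F "\<lambda>k. (1/2) ^ k"]) (simp, rule that)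
  have "norm ((deriv ^^ j) (truncated_power k (\<epsilon> (k + n))) y *\<^sub>R iter_dd ws (e (k + n)) x) \<le> (1/2) ^ k"
    if "j < k" "set ws \<subseteq> Basis" "length ws \<le> k" "x \<in> A" for n j k ws x y
  proof -
    let ?\<epsilon> = "\<epsilon> (k + n)"
    have "?\<epsilon> ^ k / ?\<epsilon> ^ j = ?\<epsilon> ^ (k - j)" using \<epsilon>(1)[of "k + n"] that(1) by (simp add: power_diff)
    also have "\<dots> \<le> ?\<epsilon> ^ 1" using \<epsilon>(1,2)[of "k + n"] that(1) by (intro power_decreasing) auto
    finally have "?\<epsilon> ^ k / ?\<epsilon> ^ j * C k j \<le> ?\<epsilon> * C k j" using C(1) by (intro mult_right_mono) auto
    then have "\<bar>(deriv ^^ j) (truncated_power k ?\<epsilon>) y\<bar> \<le> ?\<epsilon> * C k j"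
      using C(2)[OF \<epsilon>(1)] order_trans by blast
    then have "norm ((deriv ^^ j) (truncated_power k ?\<epsilon>) y *\<^sub>R iter_dd ws (e (k + n)) x) \<le>
        (?\<epsilon> * C k j) * B (k + n) ws"
      unfolding norm_scaleR real_norm_def
      using B(2)[OF that(4)] C(1) less_imp_le[OF \<epsilon>(1)] by (intro mult_mono) auto
    also have "\<dots> = ?\<epsilon> * (C k j * B (k + n) ws)" by simp
    also have "\<dots> \<le> (1/2) ^ (k + n)" using that
      by (intro \<epsilon>(3) image_eqI[of _ _ "(k, j, ws)"]) (auto simp: L_def)
    also have "\<dots> \<le> (1/2) ^ k" by (intro power_decreasing) auto
    finally show ?thesis .
  qed
  then have "\<forall>\<^sub>F k in sequentially. \<forall>x\<in>A. \<forall>y.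
      norm ((deriv ^^ j) (truncated_power k (\<epsilon> (k + n))) y *\<^sub>R iter_dd ws (e (k + n)) x) \<le> (1/2) ^ k"
    if "set ws \<subseteq> Basis" for n j ws
    using that eventually_ge_at_top[of "max (Suc j) (length ws)"] by (auto elim!: eventually_mono)
  with \<epsilon>(1) that show ?thesis by blast
qed

lemma truncated_power_split:
  assumes "\<epsilon> > 0" "k < n"
  shows "truncated_power k \<epsilon> y = y ^ k + y ^ n * ((bump (y / \<epsilon>) - 1) * inverse y ^ (n - k))"
proof (cases "y = 0")
  case False
  have "y ^ n = y ^ k * y ^ (n - k)" using assms(2) by (simp flip: power_add)
  then have "y ^ n * ((bump (y / \<epsilon>) - 1) * inverse y ^ (n - k))
    = y ^ k * (y * inverse y) ^ (n - k) * (bump (y / \<epsilon>) - 1)"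
    by (simp only: power_mult_distrib mult_ac)
  also have "y * inverse y = 1" using False by simp
  finally have "y ^ n * ((bump (y / \<epsilon>) - 1) * inverse y ^ (n - k)) = y ^ k * (bump (y / \<epsilon>) - 1)"
    by simp
  then show ?thesis by (simp add: truncated_power_def algebra_simps)
qed (use assms in \<open>simp add: truncated_power_def bump_eq_1\<close>)

lemma borel_with_parameter:
  fixes e :: "nat \<Rightarrow> 'a::euclidean_space \<Rightarrow> 'b::banach"
  assumes e: "\<And>k. smooth_on U (e k)" and A: "open A" "bounded A" "closure A \<subseteq> U"
  obtains b B where "smooth_on (A \<times> UNIV) b" "\<And>n. smooth_on (A \<times> UNIV) (B n)"
    "\<And>n x y. x \<in> A \<Longrightarrow> b (x, y) = (\<Sum>k<n. y ^ k *\<^sub>R e k x) + y ^ n *\<^sub>R B n (x, y)"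
proof -
  obtain \<epsilon> where \<epsilon>: "\<And>k. 0 < \<epsilon> k" and le: "\<And>n j ws. set ws \<subseteq> Basis \<Longrightarrow> \<forall>\<^sub>F k in sequentially. \<forall>x\<in>A. \<forall>y.
      norm ((deriv ^^ j) (truncated_power k (\<epsilon> (k + n))) y *\<^sub>R iter_dd ws (e (k + n)) x) \<le> (1/2) ^ k"
    by (rule borel_scales[OF e A(2,3)]) (rule that)
  have eA: "smooth_on A (e k)" for k
    using smooth_on_subset[OF e A(1)] closure_subset A(3) by blast
  define T where "T n p = (\<Sum>k. truncated_power k (\<epsilon> (k + n)) (snd p) *\<^sub>R e (k + n) (fst p))" for n p
  define c where "c n k y = (bump (y / \<epsilon> k) - 1) * inverse y ^ (n - k)" for n k y
  define B where "B n p = (\<Sum>k<n. c n k (snd p) *\<^sub>R e k (fst p)) + T n p" for n p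
  have T: "smooth_on (A \<times> UNIV) (T n)" for n
    unfolding T_def[abs_def] by (rule smooth_on_product_series(1)[OF A(1) eA
        smooth_on_truncated_power le])
  have summable: "summable (\<lambda>k. truncated_power k (\<epsilon> (k + n)) y *\<^sub>R e (k + n) x)" if "x \<in> A" for n x y
    by (rule smooth_on_product_series(2)[OF A(1) eA smooth_on_truncated_power le that])
  show ?thesis
  proof (rule that[of "T 0" B])
    have "open (A \<times> (UNIV :: real set))" using A(1) by (intro open_Times) auto
    then show "smooth_on (A \<times> UNIV) (B n)" for n
      unfolding B_def[abs_def] c_def
      by (intro smooth_on_add smooth_on_sum smooth_on_scaleR T smooth_on_fst smooth_on_snd
          smooth_on_ident
          smooth_on_compose[OF smooth_on_bump_minus_1_quotient[OF \<epsilon>]] smooth_on_compose[OF eA]) auto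
    fix n y and x :: 'a assume x: "x \<in> A"
    let ?t = "\<lambda>k. truncated_power k (\<epsilon> k) y *\<^sub>R e k x"
    have shift: "?t (k + n) = y ^ n *\<^sub>R (truncated_power k (\<epsilon> (k + n)) y *\<^sub>R e (k + n) x)" for k
      by (simp add: truncated_power_def power_add mult_ac)
    have tail: "(\<Sum>k. ?t (k + n)) = y ^ n *\<^sub>R T n (x, y)"
      unfolding shift T_def fst_conv snd_conv by (rule suminf_scaleR_right[OF summable[OF x], symmetric])
    have head: "(\<Sum>k<n. ?t k) = (\<Sum>k<n. y ^ k *\<^sub>R e k x + y ^ n *\<^sub>R (c n k y *\<^sub>R e k x))"
      by (intro sum.cong) (auto simp: truncated_power_split[OF \<epsilon>] c_def scaleR_add_left)
    have "T 0 (x, y) = (\<Sum>k. ?t (k + n)) + (\<Sum>k<n. ?t k)"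
      unfolding T_def using suminf_split_initial_segment[OF summable[OF x, of 0], of y n] by simp
    then show "T 0 (x, y) = (\<Sum>k<n. y ^ k *\<^sub>R e k x) + y ^ n *\<^sub>R B n (x, y)"
      unfolding tail head by (simp add: B_def sum.distrib scaleR_sum_right scaleR_add_right)
  qed (rule T)
qed

subsection \<open>Whitney's theorem on even functions\<close>

lemma hadamard_division_parity:
  fixes f :: "'a::euclidean_space \<times> real \<Rightarrow> 'b::banach"
  assumes f: "smooth_on (A \<times> {-r<..<r}) f" and zero: "\<And>x. x \<in> A \<Longrightarrow> f (x, 0) = 0"
    and parity: "\<And>x y. x \<in> A \<Longrightarrow> \<bar>y\<bar> < r \<Longrightarrow> f (x, -y) = s *\<^sub>R f (x, y)" and s: "s = 1 \<or> s = -1"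
  obtains g where "smooth_on (A \<times> {-r<..<r}) g" "\<And>x y. g (x, -y) = - (s *\<^sub>R g (x, y))"
    "\<And>x y. x \<in> A \<Longrightarrow> \<bar>y\<bar> < r \<Longrightarrow> f (x, y) = y *\<^sub>R g (x, y)"
proof -
  let ?U = "A \<times> {-r<..<r}"
  have U: "open ?U" using f by (rule smooth_on_imp_open)
  obtain g where g: "smooth_on ?U g" "\<And>x y. (x, y) \<in> ?U \<Longrightarrow> f (x, y) = y *\<^sub>R g (x, y)"
    by (rule hadamard_division[OF f cylinder_star_shaped]) (use zero in auto)
  define g' where "g' p = (1/2) *\<^sub>R (g p - s *\<^sub>R g (fst p, - snd p))" for p
  show ?thesis
  proof (rule that[of g'])
    have "smooth_on ?U (\<lambda>p. g (fst p, - snd p))"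
      by (rule smooth_on_compose[OF g(1)]) (auto intro!: smooth_on_intros U)
    then show "smooth_on ?U g'"
      unfolding g'_def[abs_def] by (intro smooth_on_intros g(1) U)
    show "g' (x, -y) = - (s *\<^sub>R g' (x, y))" for x y
      using s by (auto simp: g'_def scaleR_diff_right scaleR_add_right)
    fix x y assume xy: "x \<in> A" "\<bar>y\<bar> < r"
    then have "y *\<^sub>R g (x, y) = f (x, y)" "y *\<^sub>R g (x, -y) = - f (x, -y)"
      using g(2)[of x y] g(2)[of x "-y"] by (auto simp: abs_less_iff)
    moreover have "y *\<^sub>R g' (x, y) = (1/2) *\<^sub>R (y *\<^sub>R g (x, y) - s *\<^sub>R y *\<^sub>R g (x, -y))"
      by (simp add: g'_def scaleR_diff_right mult.commute)
    ultimately have "y *\<^sub>R g' (x, y) = (1/2) *\<^sub>R (f (x, y) + s *\<^sub>R f (x, -y))"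
      by (simp only: scaleR_minus_right diff_minus_eq_add)
    also have "s *\<^sub>R f (x, -y) = f (x, y)" using parity[OF xy] s by auto
    finally show "f (x, y) = y *\<^sub>R g' (x, y)" by (simp flip: scaleR_2)
  qed
qed

lemma even_taylor_step:
  fixes f :: "'a::euclidean_space \<times> real \<Rightarrow> 'b::banach"
  assumes f: "smooth_on (A \<times> {-r<..<r}) f" and "r > 0"
    and even: "\<And>x y. x \<in> A \<Longrightarrow> \<bar>y\<bar> < r \<Longrightarrow> f (x, -y) = f (x, y)"
  obtains h where "smooth_on (A \<times> {-r<..<r}) h" "\<And>x y. x \<in> A \<Longrightarrow> \<bar>y\<bar> < r \<Longrightarrow> h (x, -y) = h (x, y)"
    "\<And>x y. x \<in> A \<Longrightarrow> \<bar>y\<bar> < r \<Longrightarrow> f (x, y) = f (x, 0) + y\<^sup>2 *\<^sub>R h (x, y)"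
proof -
  let ?U = "A \<times> {-r<..<r}"
  have U: "open ?U" using f by (rule smooth_on_imp_open)
  have "smooth_on ?U (\<lambda>p. f (fst p, 0))"
    by (rule smooth_on_compose[OF f]) (use \<open>r > 0\<close> in \<open>auto intro!: smooth_on_intros U\<close>)
  then have "smooth_on ?U (\<lambda>p. f p - f (fst p, 0))" by (rule smooth_on_diff[OF f])
  then obtain g where g: "smooth_on ?U g" "\<And>x y. g (x, -y) = - (1 *\<^sub>R g (x, y))"
      "\<And>x y. x \<in> A \<Longrightarrow> \<bar>y\<bar> < r \<Longrightarrow> f (x, y) - f (fst (x, y), 0) = y *\<^sub>R g (x, y)"
    by (rule hadamard_division_parity[where s=1]) (use even in auto)
  have "2 *\<^sub>R g (x, 0) = 0" for x
    using g(2)[of x 0] by (simp only: scaleR_2 minus_zero scaleR_one eq_neg_iff_add_eq_0)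
  then have "g (x, 0) = 0" for x by simp
  then obtain h where h: "smooth_on ?U h" "\<And>x y. h (x, -y) = - ((-1) *\<^sub>R h (x, y))"
      "\<And>x y. x \<in> A \<Longrightarrow> \<bar>y\<bar> < r \<Longrightarrow> g (x, y) = y *\<^sub>R h (x, y)"
    by (rule hadamard_division_parity[where s="-1", OF g(1)]) (use g(2) in auto)
  show ?thesis
  proof (rule that[OF h(1)])
    show "h (x, -y) = h (x, y)" for x y using h(2)[of x y] by simp
    show "f (x, y) = f (x, 0) + y\<^sup>2 *\<^sub>R h (x, y)" if "x \<in> A" "\<bar>y\<bar> < r" for x y
      using g(3)[OF that] h(3)[OF that] by (simp add: power2_eq_square diff_eq_eq add.commute)
  qed
qed

lemma even_taylor:
  fixes f :: "'a::euclidean_space \<times> real \<Rightarrow> 'b::banach"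
  assumes f: "smooth_on (A \<times> {-r<..<r}) f" and r: "r > 0"
    and even: "\<And>x y. x \<in> A \<Longrightarrow> \<bar>y\<bar> < r \<Longrightarrow> f (x, -y) = f (x, y)"
  obtains E where "\<And>n. smooth_on (A \<times> {-r<..<r}) (E n)"
    "\<And>n x y. x \<in> A \<Longrightarrow> \<bar>y\<bar> < r \<Longrightarrow>
      f (x, y) = (\<Sum>k<n. (y\<^sup>2) ^ k *\<^sub>R E k (x, 0)) + (y\<^sup>2) ^ n *\<^sub>R E n (x, y)"
proof -
  define P where "P n g \<longleftrightarrow> (n = 0 \<longrightarrow> g = f) \<and> smooth_on (A \<times> {-r<..<r}) g \<and>
    (\<forall>x\<in>A. \<forall>y. \<bar>y\<bar> < r \<longrightarrow> g (x, -y) = g (x, y))" for n :: nat and g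
  define Q where "Q g h \<longleftrightarrow> (\<forall>x\<in>A. \<forall>y. \<bar>y\<bar> < r \<longrightarrow> g (x, y) = g (x, 0) + y\<^sup>2 *\<^sub>R h (x, y))"
    for g h :: "'a \<times> real \<Rightarrow> 'b"
  have "\<exists>E. \<forall>n. P n (E n) \<and> Q (E n) (E (Suc n))"
  proof (rule dependent_nat_choice)
    show "\<exists>g. P 0 g" unfolding P_def using f even by blast
    fix g n assume "P n g"
    then have "smooth_on (A \<times> {-r<..<r}) g" "\<And>x y. x \<in> A \<Longrightarrow> \<bar>y\<bar> < r \<Longrightarrow> g (x, -y) = g (x, y)"
      unfolding P_def by blast+
    from even_taylor_step[OF this(1) r this(2)] show "\<exists>h. P (Suc n) h \<and> Q g h"
      unfolding P_def Q_def by (metis nat.distinct(2))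
  qed
  then obtain E where E: "\<And>n. P n (E n)" "\<And>n. Q (E n) (E (Suc n))" by blast
  have "E 0 = f" using E(1)[of 0] by (simp add: P_def)
  have "f (x, y) = (\<Sum>k<n. (y\<^sup>2) ^ k *\<^sub>R E k (x, 0)) + (y\<^sup>2) ^ n *\<^sub>R E n (x, y)"
    if "x \<in> A" "\<bar>y\<bar> < r" for n x y
  proof (induction n)
    case (Suc n)
    have "E n (x, y) = E n (x, 0) + y\<^sup>2 *\<^sub>R E (Suc n) (x, y)"
      using E(2)[of n] that unfolding Q_def by blast
    then show ?case using Suc by (simp add: scaleR_add_right mult.commute)
  qed (simp add: \<open>E 0 = f\<close>)
  then show ?thesis using that[of E] E(1) by (auto simp: P_def)
qed

lemma even_taylor_remainder_flat:
  fixes f :: "'a::euclidean_space \<times> real \<Rightarrow> 'b::banach"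
  assumes A: "open A" "A \<subseteq> A'"
    and E: "\<And>n. smooth_on (A' \<times> {-r<..<r}) (E n)" "\<And>n x y. x \<in> A \<Longrightarrow> \<bar>y\<bar> < r \<Longrightarrow>
      f (x, y) = (\<Sum>k<n. (y\<^sup>2) ^ k *\<^sub>R e k x) + (y\<^sup>2) ^ n *\<^sub>R E n (x, y)"
    and B: "\<And>n. smooth_on (A \<times> UNIV) (B n)" "\<And>n x y. x \<in> A \<Longrightarrow>
      b (x, y) = (\<Sum>k<n. y ^ k *\<^sub>R e k x) + y ^ n *\<^sub>R B n (x, y)"
  shows "flat_on (A \<times> {-r<..<r}) (\<lambda>p. f p - b (fst p, (snd p)\<^sup>2))"
  unfolding flat_on_def
proof
  fix n
  let ?U = "A \<times> {-r<..<r}"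
  let ?w = "\<lambda>p. snd p ^ n *\<^sub>R (E n p - B n (fst p, (snd p)\<^sup>2))"
  have U: "open ?U" using A(1) by (intro open_Times) auto
  have "smooth_on ?U (\<lambda>p. B n (fst p, (snd p)\<^sup>2))"
    by (rule smooth_on_compose[OF B(1)]) (auto intro!: smooth_on_intros U)
  moreover have "smooth_on ?U (E n)" by (rule smooth_on_subset[OF E(1) U]) (use A(2) in auto)
  ultimately have "smooth_on ?U ?w" by (intro smooth_on_intros U)
  moreover have "f p - b (fst p, (snd p)\<^sup>2) = snd p ^ n *\<^sub>R ?w p" if "p \<in> ?U" for p
  proof -
    have "f p - b (fst p, (snd p)\<^sup>2) = ((snd p)\<^sup>2) ^ n *\<^sub>R (E n p - B n (fst p, (snd p)\<^sup>2))"
      using E(2)[of "fst p" "snd p" n] B(2)[of "fst p" "(snd p)\<^sup>2" n] that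
      by (auto simp: scaleR_diff_right)
    then show ?thesis by (simp add: power2_eq_square power_mult_distrib)
  qed
  ultimately show "\<exists>w. smooth_on ?U w \<and> (\<forall>p\<in>?U. f p - b (fst p, (snd p)\<^sup>2) = snd p ^ n *\<^sub>R w p)"
    by blast
qed

lemma whitney_even:
  fixes f :: "'a::euclidean_space \<times> real \<Rightarrow> 'b::banach"
  assumes A: "open A" "0 \<in> A" and r: "r > 0" and f: "smooth_on (A \<times> {-r<..<r}) f"
    and even: "\<And>x y. x \<in> A \<Longrightarrow> \<bar>y\<bar> < r \<Longrightarrow> f (x, -y) = f (x, y)"
  obtains a where "smooth_germ a" "\<forall>\<^sub>F p in nhds 0. f p = a (fst p, (snd p)\<^sup>2)"
proof -
  obtain E where E: "\<And>n. smooth_on (A \<times> {-r<..<r}) (E n)" and taylor: "\<And>n x y. x \<in> A \<Longrightarrow> \<bar>y\<bar> < r \<Longrightarrow>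
      f (x, y) = (\<Sum>k<n. (y\<^sup>2) ^ k *\<^sub>R E k (x, 0)) + (y\<^sup>2) ^ n *\<^sub>R E n (x, y)"
    using even_taylor[OF f r even] by blast
  obtain d where d: "d > 0" "cball 0 d \<subseteq> A" using A open_contains_cball by blast
  let ?D = "ball (0::'a) d"
  have DA: "?D \<subseteq> A" using d(2) ball_subset_cball by blast
  have "smooth_on A (\<lambda>x. E k (x, 0))" for k
    by (rule smooth_on_compose[OF E]) (use r in \<open>auto intro!: smooth_on_intros A(1)\<close>)
  then obtain b B where b: "smooth_on (?D \<times> UNIV) b" and B: "\<And>n. smooth_on (?D \<times> UNIV) (B n)"
    "\<And>n x y. x \<in> ?D \<Longrightarrow> b (x, y) = (\<Sum>k<n. y ^ k *\<^sub>R E k (x, 0)) + y ^ n *\<^sub>R B n (x, y)"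
    using borel_with_parameter[of A "\<lambda>k x. E k (x, 0)" ?D] d by (auto simp: closure_ball)
  define z where "z p = f p - b (fst p, (snd p)\<^sup>2)" for p
  have "flat_on (?D \<times> {-r<..<r}) z"
    unfolding z_def[abs_def]
    by (rule even_taylor_remainder_flat[OF open_ball DA E taylor B]) (use DA in auto)
  then have "smooth_on (?D \<times> {..<r\<^sup>2}) (half_plane_glue z)"
    by (rule smooth_on_half_plane_glue[OF r open_ball])
  moreover have "smooth_on (?D \<times> {..<r\<^sup>2}) b"
    by (rule smooth_on_subset[OF b]) (auto intro: open_Times)
  ultimately have "smooth_on (?D \<times> {..<r\<^sup>2}) (\<lambda>p. b p + half_plane_glue z p)" by (intro smooth_on_add)
  then have "smooth_germ (\<lambda>p. b p + half_plane_glue z p)"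
    by (rule smooth_germI) (use d r in \<open>auto simp: zero_prod_def\<close>)
  moreover have "\<forall>\<^sub>F p in nhds 0. p \<in> ?D \<times> {-r<..<r}"
    using d(1) r by (intro eventually_nhds_in_open open_Times) (auto simp: zero_prod_def)
  then have "\<forall>\<^sub>F p in nhds 0. f p = b (fst p, (snd p)\<^sup>2) + half_plane_glue z (fst p, (snd p)\<^sup>2)"
  proof eventually_elim
    case (elim p)
    obtain x y where p: "p = (x, y)" by (cases p)
    then have xy: "x \<in> ?D" "x \<in> A" "\<bar>y\<bar> < r" using elim DA by auto
    have "z (x, 0) = 0" using taylor[OF xy(2), of 0 1] B(2)[OF xy(1), of 0 1] r by (simp add: z_def)
    moreover have "z (x, -y) = z (x, y)" using even[OF xy(2,3)] by (simp add: z_def)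
    ultimately show ?case using half_plane_glue_square[of z x y] by (simp add: p z_def)
  qed
  ultimately show ?thesis by (rule that)
qed

lemma whitney_decomposition:
  fixes f :: "'a::euclidean_space \<times> real \<Rightarrow> 'b::banach"
  assumes "smooth_germ f"
  obtains a b where "smooth_germ a" "smooth_germ b"
    "\<forall>\<^sub>F p in nhds 0. f p = a (fst p, (snd p)\<^sup>2) + snd p *\<^sub>R b (fst p, (snd p)\<^sup>2)"
proof -
  obtain A r where A: "open A" "0 \<in> A" and r: "r > 0" and f: "smooth_on (A \<times> {-r<..<r}) f"
    by (rule smooth_germ_cylinder[OF assms])
  let ?U = "A \<times> {-r<..<r}"
  have U: "open ?U" using f by (rule smooth_on_imp_open)
  have reflected: "smooth_on ?U (\<lambda>p. f (fst p, - snd p))"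
    by (rule smooth_on_compose[OF f]) (auto intro!: smooth_on_intros U)
  define f_even f_odd where "f_even p = (1/2) *\<^sub>R (f p + f (fst p, - snd p))"
    and "f_odd p = (1/2) *\<^sub>R (f p - f (fst p, - snd p))" for p
  have smooth: "smooth_on ?U f_even" "smooth_on ?U f_odd"
    unfolding f_even_def[abs_def] f_odd_def[abs_def] by (intro smooth_on_intros f reflected U)+
  obtain a where a: "smooth_germ a" "\<forall>\<^sub>F p in nhds 0. f_even p = a (fst p, (snd p)\<^sup>2)"
    by (rule whitney_even[OF A r smooth(1)]) (simp add: f_even_def add.commute)
  obtain h where h: "smooth_on ?U h" "\<And>x y. h (x, -y) = - ((-1) *\<^sub>R h (x, y))"
      "\<And>x y. x \<in> A \<Longrightarrow> \<bar>y\<bar> < r \<Longrightarrow> f_odd (x, y) = y *\<^sub>R h (x, y)"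
    by (rule hadamard_division_parity[where s="-1", OF smooth(2)])
       (auto simp: f_odd_def scaleR_diff_right)
  obtain b where b: "smooth_germ b" "\<forall>\<^sub>F p in nhds 0. h p = b (fst p, (snd p)\<^sup>2)"
    by (rule whitney_even[OF A r h(1)]) (simp add: h(2))
  have "\<forall>\<^sub>F p in nhds 0. p \<in> ?U"
    using A r by (intro eventually_nhds_in_open[OF U]) (auto simp: zero_prod_def)
  then have "\<forall>\<^sub>F p in nhds 0. f p = a (fst p, (snd p)\<^sup>2) + snd p *\<^sub>R b (fst p, (snd p)\<^sup>2)"
    using a(2) b(2)
  proof eventually_elim
    case (elim p)
    have "f p = f_even p + f_odd p" by (simp add: f_even_def f_odd_def flip: scaleR_add_right scaleR_2)
    also have "f_odd p = snd p *\<^sub>R h p" using h(3)[of "fst p" "snd p"] elim(1) by auto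
    finally show ?case using elim(2,3) by simp
  qed
  then show ?thesis by (rule that[OF a(1) b(1)])
qed

subsection \<open>A linear functional equation\<close>

lemma continuous_on_symmetric_intervalI:
  fixes f :: "real \<Rightarrow> 'a::topological_space"
  assumes "\<And>c. c < R \<Longrightarrow> continuous_on {-c..c} f"
  shows "continuous_on {-R<..<R} f"
proof (rule continuous_at_imp_continuous_on, rule ballI)
  fix y assume "y \<in> {-R<..<R}"
  then have "\<bar>y\<bar> < R" by auto
  then obtain c where c: "\<bar>y\<bar> < c" "c < R" using dense by blast
  have "continuous_on {-c..c} f" by (rule assms[OF c(2)])
  then show "isCont f y" by (rule continuous_on_interior) (use c(1) in auto)
qed

locale contracting_equation =
  fixes R q :: real and p :: "real \<Rightarrow> real"
  assumes q: "0 \<le> q" "q < 1"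
    and p_smooth: "smooth_on {-R<..<R} p"
    and p_zero: "p 0 = 0"
    and deriv_p_le: "\<And>y. \<bar>y\<bar> < R \<Longrightarrow> \<bar>deriv p y\<bar> \<le> 1"
begin

abbreviation I where "I \<equiv> {-R<..<R}"

definition admissible :: "(real \<Rightarrow> real) \<Rightarrow> bool" where
  "admissible a \<longleftrightarrow> smooth_on I a \<and> (\<forall>y\<in>I. \<bar>a y\<bar> \<le> q)"

definition solves :: "(real \<Rightarrow> real) \<Rightarrow> (real \<Rightarrow> real) \<Rightarrow> (real \<Rightarrow> real) \<Rightarrow> bool" where
  "solves a \<rho> k \<longleftrightarrow> continuous_on I k \<and> (\<forall>y\<in>I. k y = \<rho> y + a y * k (p y))"

lemma p_le:
  assumes "\<bar>y\<bar> < R"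
  shows "\<bar>p y\<bar> \<le> \<bar>y\<bar>"
proof -
  have "norm (p y - p 0) \<le> 1 * norm (y - 0)"
  proof (rule field_differentiable_bound[of I])
    show "(p has_real_derivative deriv p t) (at t within I)" if "t \<in> I" for t
      by (rule has_field_derivative_at_within[OF smooth_on_has_real_derivative[OF p_smooth that]])
    show "norm (deriv p t) \<le> 1" if "t \<in> I" for t using deriv_p_le[of t] that by auto
  qed (use assms in auto)
  then show ?thesis using p_zero by simp
qed

lemma p_in_I: "y \<in> I \<Longrightarrow> p y \<in> I"
  using p_le[of y] by (auto simp: abs_le_iff abs_less_iff)

lemma ex_bound_on_subinterval:
  fixes g :: "real \<Rightarrow> real"
  assumes "continuous_on I g" "c < R"
  obtains M where "M \<ge> 0" "\<And>y. \<bar>y\<bar> \<le> c \<Longrightarrow> \<bar>g y\<bar> \<le> M"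
proof -
  have "continuous_on {-c..c} g" by (rule continuous_on_subset[OF assms(1)]) (use assms(2) in auto)
  then obtain M where "M \<ge> 0" "\<forall>y\<in>{-c..c}. norm (g y) \<le> M"
    using continuous_on_compact_bound[OF compact_Icc] by metis
  then show ?thesis by (intro that[of M]) (auto simp: abs_le_iff)
qed

lemma solves_unique:
  assumes a: "admissible a" and k: "solves a \<rho> k" and l: "solves a \<rho> l" and y: "y \<in> I"
  shows "k y = l y"
proof -
  have c: "\<bar>y\<bar> < R" using y by auto
  have "continuous_on I (\<lambda>y. k y - l y)"
    using k l by (auto simp: solves_def intro!: continuous_intros)
  then obtain M where M: "M \<ge> 0" "\<And>t. \<bar>t\<bar> \<le> \<bar>y\<bar> \<Longrightarrow> \<bar>k t - l t\<bar> \<le> M"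
    using ex_bound_on_subinterval[OF _ c] by blast
  have bound: "\<bar>k t - l t\<bar> \<le> q ^ n * M" if "\<bar>t\<bar> \<le> \<bar>y\<bar>" for n t
    using that
  proof (induction n arbitrary: t)
    case 0
    then show ?case using M by simp
  next
    case (Suc n)
    have t: "t \<in> I" using Suc.prems c by auto
    have pt: "\<bar>p t\<bar> \<le> \<bar>y\<bar>" using p_le[of t] Suc.prems c by linarith
    have "k t - l t = a t * (k (p t) - l (p t))"
      using k l t by (simp add: solves_def right_diff_distrib)
    then have "\<bar>k t - l t\<bar> = \<bar>a t\<bar> * \<bar>k (p t) - l (p t)\<bar>" by (simp add: abs_mult)
    also have "\<dots> \<le> q * (q ^ n * M)"
      using a t Suc.IH[OF pt] q(1) by (intro mult_mono) (auto simp: admissible_def)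
    finally show ?case by simp
  qed
  have "(\<lambda>n. q ^ n * M) \<longlonglongrightarrow> 0 * M" using q by (intro tendsto_intros LIMSEQ_realpow_zero)
  then have "\<bar>k y - l y\<bar> \<le> 0 * M" by (rule LIMSEQ_le_const) (use bound[of y] in auto)
  then show ?thesis by simp
qed

primrec series_term :: "(real \<Rightarrow> real) \<Rightarrow> (real \<Rightarrow> real) \<Rightarrow> nat \<Rightarrow> real \<Rightarrow> real" where
  "series_term a \<rho> 0 = \<rho>"
| "series_term a \<rho> (Suc n) = (\<lambda>y. a y * series_term a \<rho> n (p y))"

definition series_solution :: "(real \<Rightarrow> real) \<Rightarrow> (real \<Rightarrow> real) \<Rightarrow> real \<Rightarrow> real" where
  "series_solution a \<rho> y = (\<Sum>n. series_term a \<rho> n y)"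

lemma Ck_on_compose_p:
  assumes "Ck_on m I k"
  shows "Ck_on m I (\<lambda>y. k (p y))"
  by (rule Ck_on_compose[OF _ _ assms]) (use p_smooth p_in_I in \<open>auto simp: smooth_on_iff_Ck_on\<close>)

lemma Ck_on_series_term:
  assumes a: "admissible a" and \<rho>: "Ck_on m I \<rho>"
  shows "Ck_on m I (series_term a \<rho> n)"
proof (induction n)
  case (Suc n)
  have "Ck_on m I a" using a by (simp add: admissible_def smooth_on_iff_Ck_on)
  from Ck_on_mult[OF _ this Ck_on_compose_p[OF Suc]] show ?case by simp
qed (simp add: \<rho>)

lemma abs_series_term_le:
  assumes a: "admissible a" and M: "\<And>y. \<bar>y\<bar> \<le> c \<Longrightarrow> \<bar>\<rho> y\<bar> \<le> M" and c: "c < R"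
    and "\<bar>y\<bar> \<le> c"
  shows "\<bar>series_term a \<rho> n y\<bar> \<le> q ^ n * M"
  using assms(4)
proof (induction n arbitrary: y)
  case 0
  then show ?case using M by simp
next
  case (Suc n)
  have "\<bar>p y\<bar> \<le> c" using p_le[of y] Suc.prems c by linarith
  moreover have "y \<in> I" using Suc.prems c by auto
  ultimately have "\<bar>a y\<bar> * \<bar>series_term a \<rho> n (p y)\<bar> \<le> q * (q ^ n * M)"
    using a Suc.IH q(1) by (intro mult_mono) (auto simp: admissible_def)
  then show ?case by (simp add: abs_mult)
qed

lemma uniform_limit_series_solution:
  assumes a: "admissible a" and \<rho>: "continuous_on I \<rho>" and c: "c < R"
  shows "uniform_limit {-c..c} (\<lambda>N y. \<Sum>n<N. series_term a \<rho> n y) (series_solution a \<rho>) sequentially"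
proof -
  obtain M where "M \<ge> 0" and M: "\<And>y. \<bar>y\<bar> \<le> c \<Longrightarrow> \<bar>\<rho> y\<bar> \<le> M"
    by (rule ex_bound_on_subinterval[OF \<rho> c]) (rule that)
  show ?thesis
    unfolding series_solution_def[abs_def]
  proof (rule Weierstrass_m_test)
    show "norm (series_term a \<rho> n y) \<le> q ^ n * M" if "y \<in> {-c..c}" for n y
      using abs_series_term_le[OF a M c, where y=y and n=n] that by (auto simp: abs_le_iff)
    show "summable (\<lambda>n. q ^ n * M)" using q by (intro summable_mult2 summable_geometric) simp
  qed
qed

lemma summable_series_term:
  assumes a: "admissible a" and \<rho>: "continuous_on I \<rho>" and y: "y \<in> I"
  shows "summable (\<lambda>n. series_term a \<rho> n y)"
proof -
  have "\<bar>y\<bar> < R" "y \<in> {-\<bar>y\<bar>..\<bar>y\<bar>}" using y by auto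
  from tendsto_uniform_limitI[OF uniform_limit_series_solution[OF a \<rho> this(1)] this(2)]
  show ?thesis unfolding summable_def sums_def by blast
qed

lemma solves_series_solution:
  assumes a: "admissible a" and \<rho>: "continuous_on I \<rho>"
  shows "solves a \<rho> (series_solution a \<rho>)"
proof -
  have "continuous_on {-c..c} (series_solution a \<rho>)" if c: "c < R" for c
  proof (rule uniform_limit_theorem[OF _ uniform_limit_series_solution[OF a \<rho> c]])
    have "continuous_on I (series_term a \<rho> n)" for n
      using Ck_on_series_term[OF a, of 0] \<rho> by simp
    moreover have "{-c..c} \<subseteq> I" using c by auto
    ultimately show "\<forall>\<^sub>F N in sequentially. continuous_on {-c..c} (\<lambda>y. \<Sum>n<N. series_term a \<rho> n y)"
      by (intro always_eventually allI continuous_on_sum) (rule continuous_on_subset)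
  qed simp
  then have "continuous_on I (series_solution a \<rho>)" by (rule continuous_on_symmetric_intervalI)
  moreover have "series_solution a \<rho> y = \<rho> y + a y * series_solution a \<rho> (p y)" if y: "y \<in> I" for y
    unfolding series_solution_def
    using suminf_split_head[OF summable_series_term[OF a \<rho> y]]
      suminf_mult[OF summable_series_term[OF a \<rho> p_in_I[OF y]], of "a y"] by simp
  ultimately show ?thesis by (simp add: solves_def)
qed

lemma C1_has_real_derivative: "Ck_on 1 I k \<Longrightarrow> y \<in> I \<Longrightarrow> (k has_real_derivative deriv k y) (at y)"
  using Ck_on_Suc_real_iff[of I 0 k] by simp

lemma has_real_derivative_equation:
  assumes a: "admissible a" and k: "Ck_on 1 I k" and y: "y \<in> I"
  shows "((\<lambda>y. a y * k (p y)) has_real_derivative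
    deriv a y * k (p y) + (a y * deriv p y) * deriv k (p y)) (at y)"
proof -
  have "((\<lambda>y. k (p y)) has_real_derivative deriv k (p y) * deriv p y) (at y)"
    by (rule DERIV_chain2[OF C1_has_real_derivative[OF k p_in_I[OF y]]
        smooth_on_has_real_derivative[OF p_smooth y]])
  moreover have "(a has_real_derivative deriv a y) (at y)"
    using a y by (auto simp: admissible_def intro: smooth_on_has_real_derivative)
  ultimately show ?thesis by (rule DERIV_cong[OF DERIV_mult[rotated]]) (simp add: algebra_simps)
qed

lemma abs_deriv_series_term_le:
  assumes a: "admissible a" and \<rho>: "Ck_on 1 I \<rho>" and M: "\<And>y. \<bar>y\<bar> \<le> c \<Longrightarrow> \<bar>\<rho> y\<bar> \<le> M" and c: "c < R"
    and A: "A \<ge> 0" "\<And>y. \<bar>y\<bar> \<le> c \<Longrightarrow> \<bar>deriv a y\<bar> \<le> A" and s: "q \<le> s"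
    and B: "\<And>y. \<bar>y\<bar> \<le> c \<Longrightarrow> \<bar>deriv \<rho> y\<bar> \<le> B" "A * M \<le> (s - q) * B" and "\<bar>y\<bar> \<le> c"
  shows "\<bar>deriv (series_term a \<rho> n) y\<bar> \<le> s ^ n * B"
  using assms(10)
proof (induction n arbitrary: y)
  case 0
  then show ?case using B by simp
next
  case (Suc n)
  let ?t = "series_term a \<rho> n"
  have y: "y \<in> I" "\<bar>y\<bar> < R" using Suc.prems c by auto
  have py: "\<bar>p y\<bar> \<le> c" using p_le[OF y(2)] Suc.prems by linarith
  have M0: "M \<ge> 0" using M[of y] Suc.prems by linarith
  have "\<bar>deriv a y * ?t (p y)\<bar> \<le> A * (q ^ n * M)"
    unfolding abs_mult
    using A Suc.prems abs_series_term_le[OF a M c py] by (intro mult_mono) auto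
  also have "\<dots> = q ^ n * (A * M)" by simp
  also have "\<dots> \<le> s ^ n * (A * M)" using A(1) M0 q(1) s by (intro mult_right_mono power_mono) auto
  also have "\<dots> \<le> s ^ n * ((s - q) * B)" using q(1) s B(2) by (intro mult_left_mono) auto
  finally have left: "\<bar>deriv a y * ?t (p y)\<bar> \<le> s ^ n * ((s - q) * B)" .
  have "\<bar>a y * deriv p y\<bar> \<le> q * 1"
    unfolding abs_mult using a y deriv_p_le q(1) by (intro mult_mono) (auto simp: admissible_def)
  then have right: "\<bar>(a y * deriv p y) * deriv ?t (p y)\<bar> \<le> q * (s ^ n * B)"
    unfolding abs_mult[of "a y * deriv p y"] using Suc.IH[OF py] q(1) by (intro mult_mono) auto
  have "deriv (series_term a \<rho> (Suc n)) y = deriv a y * ?t (p y) + (a y * deriv p y) * deriv ?t (p y)"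
    using DERIV_imp_deriv[OF has_real_derivative_equation[OF a Ck_on_series_term[OF a \<rho>] y(1)]] by simp
  then have "\<bar>deriv (series_term a \<rho> (Suc n)) y\<bar> \<le> s ^ n * ((s - q) * B) + q * (s ^ n * B)"
    using left right by linarith
  also have "\<dots> = s ^ Suc n * B" by (simp add: algebra_simps)
  finally show ?case .
qed

lemma uniform_limit_deriv_series_term:
  assumes a: "admissible a" and \<rho>: "Ck_on 1 I \<rho>" and c: "c < R"
  shows "uniform_limit {-c..c} (\<lambda>N y. \<Sum>n<N. deriv (series_term a \<rho> n) y)
    (\<lambda>y. \<Sum>n. deriv (series_term a \<rho> n) y) sequentially"
proof -
  have cont: "continuous_on I \<rho>" "continuous_on I (deriv \<rho>)" "continuous_on I (deriv a)"
    using \<rho> Ck_on_imp_continuous_on[OF \<rho>] Ck_on_Suc_real_iff[of I 0 \<rho>] a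
    by (auto simp: admissible_def intro: smooth_on_imp_continuous_on smooth_on_deriv)
  obtain M where M: "M \<ge> 0" "\<And>y. \<bar>y\<bar> \<le> c \<Longrightarrow> \<bar>\<rho> y\<bar> \<le> M"
    by (rule ex_bound_on_subinterval[OF cont(1) c]) (rule that)
  obtain B where B: "B \<ge> 0" "\<And>y. \<bar>y\<bar> \<le> c \<Longrightarrow> \<bar>deriv \<rho> y\<bar> \<le> B"
    by (rule ex_bound_on_subinterval[OF cont(2) c]) (rule that)
  obtain A where A: "A \<ge> 0" "\<And>y. \<bar>y\<bar> \<le> c \<Longrightarrow> \<bar>deriv a y\<bar> \<le> A"
    by (rule ex_bound_on_subinterval[OF cont(3) c]) (rule that)
  define s where "s = (1 + q) / 2"
  have s: "q < s" "0 \<le> s" "s < 1" using q by (auto simp: s_def)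
  define B' where "B' = B + A * M / (s - q)"
  have "B \<le> B'" using A(1) M(1) s by (simp add: B'_def)
  then have B': "\<And>y. \<bar>y\<bar> \<le> c \<Longrightarrow> \<bar>deriv \<rho> y\<bar> \<le> B'" using B(2) by force
  have "(s - q) * B' = (s - q) * B + A * M" using s(1) by (simp add: B'_def distrib_left)
  then have AM: "A * M \<le> (s - q) * B'" using B(1) s(1) by simp
  show ?thesis
  proof (rule Weierstrass_m_test)
    show "norm (deriv (series_term a \<rho> n) y) \<le> s ^ n * B'" if "y \<in> {-c..c}" for n y
      using abs_deriv_series_term_le[OF a \<rho> M(2) c A less_imp_le[OF s(1)] B' AM, where y=y and n=n] that
      by (auto simp: abs_le_iff)
    show "summable (\<lambda>n. s ^ n * B')" using s by (intro summable_mult2 summable_geometric) simp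
  qed
qed

lemma C1_series_solution:
  assumes a: "admissible a" and \<rho>: "Ck_on 1 I \<rho>"
  shows "Ck_on 1 I (series_solution a \<rho>)"
proof -
  let ?s' = "\<lambda>y. \<Sum>n. deriv (series_term a \<rho> n) y"
  have terms: "Ck_on 1 I (series_term a \<rho> n)" for n by (rule Ck_on_series_term[OF a \<rho>])
  have "(series_solution a \<rho> has_real_derivative ?s' y) (at y)" if y: "y \<in> I" for y
    unfolding series_solution_def[abs_def]
  proof -
    have "\<bar>y\<bar> < R" using y by auto
    then obtain c where c: "\<bar>y\<bar> < c" "c < R" using dense by blast
    show "((\<lambda>y. \<Sum>n. series_term a \<rho> n y) has_real_derivative ?s' y) (at y)"
    proof (rule has_field_derivative_series'(2)[where S="{-c..c}"])
      show "(series_term a \<rho> n has_real_derivative deriv (series_term a \<rho> n) t) (at t within {-c..c})"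
        if "t \<in> {-c..c}" for n t
        by (rule has_field_derivative_at_within[OF C1_has_real_derivative[OF terms]])
           (use that c in auto)
      show "uniformly_convergent_on {-c..c} (\<lambda>N y. \<Sum>n<N. deriv (series_term a \<rho> n) y)"
        using uniform_limit_deriv_series_term[OF a \<rho> c(2)] unfolding uniformly_convergent_on_def by blast
      show "y \<in> {-c..c}" "y \<in> interior {-c..c}" using c by auto
      show "summable (\<lambda>n. series_term a \<rho> n y)"
        by (rule summable_series_term[OF a Ck_on_imp_continuous_on[OF \<rho>] y])
    qed simp
  qed
  moreover have "continuous_on I ?s'"
  proof (rule continuous_on_symmetric_intervalI)
    fix c :: real assume c: "c < R"
    show "continuous_on {-c..c} ?s'"
    proof (rule uniform_limit_theorem[OF _ uniform_limit_deriv_series_term[OF a \<rho> c]])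
      have "continuous_on I (deriv (series_term a \<rho> n))" for n
        using terms[of n] Ck_on_Suc_real_iff[of I 0] by simp
      moreover have "{-c..c} \<subseteq> I" using c by auto
      ultimately show "\<forall>\<^sub>F N in sequentially. continuous_on {-c..c}
        (\<lambda>y. \<Sum>n<N. deriv (series_term a \<rho> n) y)"
        by (intro always_eventually allI continuous_on_sum) (rule continuous_on_subset)
    qed simp
  qed
  ultimately show ?thesis using Ck_on_Suc_realI[of I "series_solution a \<rho>" ?s' 0] by simp
qed

text \<open>The derivative of a solution solves an equation of the same kind, with coefficient
  \<open>a p'\<close> and inhomogeneity \<open>\<rho>' + a' (k \<circ> p)\<close>; this is why the coefficient \<open>a\<close> is not constant.\<close>

lemma solves_deriv:
  assumes a: "admissible a" and \<rho>: "Ck_on 1 I \<rho>" and k: "solves a \<rho> k" "Ck_on 1 I k"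
  shows "solves (\<lambda>y. a y * deriv p y) (\<lambda>y. deriv \<rho> y + deriv a y * k (p y)) (deriv k)"
proof -
  have "deriv k y = (deriv \<rho> y + deriv a y * k (p y)) + (a y * deriv p y) * deriv k (p y)"
    if y: "y \<in> I" for y
  proof -
    have "((\<lambda>y. \<rho> y + a y * k (p y)) has_real_derivative
        deriv \<rho> y + (deriv a y * k (p y) + (a y * deriv p y) * deriv k (p y))) (at y)"
      by (rule DERIV_add[OF C1_has_real_derivative[OF \<rho> y] has_real_derivative_equation[OF a k(2) y]])
    then have "(k has_real_derivative
        deriv \<rho> y + (deriv a y * k (p y) + (a y * deriv p y) * deriv k (p y))) (at y)"
      by (rule has_field_derivative_transform_within_open[of _ _ _ I])
         (use y k(1) in \<open>auto simp: solves_def\<close>)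
    from DERIV_imp_deriv[OF this] show ?thesis by simp
  qed
  moreover have "continuous_on I (deriv k)" using k(2) Ck_on_Suc_real_iff[of I 0 k] by simp
  ultimately show ?thesis by (simp add: solves_def)
qed

lemma solves_Ck_on:
  assumes "admissible a" "Ck_on n I \<rho>" "solves a \<rho> k"
  shows "Ck_on n I k"
  using assms
proof (induction n arbitrary: a \<rho> k)
  case 0
  then show ?case by (simp add: solves_def)
next
  case (Suc n)
  note a = Suc.prems(1) and k = Suc.prems(3)
  have \<rho>: "Ck_on 1 I \<rho>" "Ck_on n I \<rho>" "Ck_on n I (deriv \<rho>)"
    using Ck_on_mono[OF Suc.prems(2), of 1] Ck_on_SucD[OF Suc.prems(2)]
      Suc.prems(2) Ck_on_Suc_real_iff[of I n \<rho>] by auto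
  have a': "smooth_on I a" "smooth_on I (deriv a)"
    using a by (auto simp: admissible_def intro: smooth_on_deriv)
  have "\<bar>a y * deriv p y\<bar> \<le> q * 1" if "y \<in> I" for y
    unfolding abs_mult using that a deriv_p_le[of y] q(1)
    by (intro mult_mono) (auto simp: admissible_def)
  then have "admissible (\<lambda>y. a y * deriv p y)"
    using a' p_smooth by (auto simp: admissible_def intro: smooth_on_mult smooth_on_deriv)
  moreover have "k y = series_solution a \<rho> y" if "y \<in> I" for y
    by (rule solves_unique[OF a k solves_series_solution[OF a Ck_on_imp_continuous_on[OF \<rho>(1)]] that])
  then have C1: "Ck_on 1 I k"
    by (intro Ck_on_cong[OF open_greaterThanLessThan _ C1_series_solution[OF a \<rho>(1)]]) simp
  moreover have "Ck_on n I (deriv a)" using a'(2) by (simp add: smooth_on_iff_Ck_on)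
  then have "Ck_on n I (\<lambda>y. deriv \<rho> y + deriv a y * k (p y))"
    by (intro Ck_on_add Ck_on_mult \<rho>(3) Ck_on_compose_p[OF Suc.IH[OF a \<rho>(2) k]] open_greaterThanLessThan)
  ultimately have "Ck_on n I (deriv k)"
    using Suc.IH solves_deriv[OF a \<rho>(1) k] by blast
  then show ?case using C1_has_real_derivative[OF C1] by (simp add: Ck_on_Suc_real_iff del: Ck_on.simps)
qed

lemma smooth_solution_exists:
  assumes "admissible a" "smooth_on I \<rho>"
  obtains k where "smooth_on I k" "solves a \<rho> k"
proof
  show "solves a \<rho> (series_solution a \<rho>)"
    by (rule solves_series_solution[OF assms(1) smooth_on_imp_continuous_on[OF assms(2)]])
  from solves_Ck_on[OF assms(1) _ this] show "smooth_on I (series_solution a \<rho>)"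
    using assms(2) unfolding smooth_on_iff_Ck_on by blast
qed

end

lemma functional_equation_germ:
  fixes p a \<rho> :: "real \<Rightarrow> real"
  assumes p: "smooth_germ p" "p 0 = 0" "\<bar>D\<^sub>0 p 1\<bar> < 1" and a: "smooth_germ a" "\<bar>a 0\<bar> < 1"
    and \<rho>: "smooth_germ \<rho>"
  obtains k where "smooth_germ k" "\<forall>\<^sub>F y in nhds 0. k y = \<rho> y + a y * k (p y)"
proof -
  obtain U where U: "0 \<in> U" "smooth_on U (\<lambda>y. (p y, a y))" "smooth_on U \<rho>"
    by (rule smooth_germ_common_domain[OF smooth_germ_Pair[OF p(1) a(1)] \<rho>])
  have pU: "smooth_on U p" and aU: "smooth_on U a"
    using smooth_on_fst[OF U(2)] smooth_on_snd[OF U(2)] by simp_all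
  obtain q where q: "\<bar>a 0\<bar> < q" "q < 1" using a(2) dense by blast
  have "deriv p 0 = D\<^sub>0 p 1"
    using frechet_derivative_real_eq[OF smooth_on_has_real_derivative[OF pU U(1)]] by simp
  moreover have "isCont (deriv p) 0" "isCont a 0"
    using smooth_on_imp_continuous_on[OF smooth_on_deriv[OF pU]] smooth_on_imp_continuous_on[OF aU]
      continuous_on_eq_continuous_at[OF smooth_on_imp_open[OF pU]] U(1) by blast+
  then have "(deriv p \<longlongrightarrow> deriv p 0) (nhds 0)" "(a \<longlongrightarrow> a 0) (nhds 0)"
    by (simp_all add: isCont_def tendsto_at_iff_tendsto_nhds)
  ultimately have "\<forall>\<^sub>F y in nhds 0. \<bar>deriv p y\<bar> < 1" "\<forall>\<^sub>F y in nhds 0. \<bar>a y\<bar> < q"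
    using p(3) q(1) by (auto intro!: order_tendstoD(2)[OF tendsto_rabs])
  moreover have "\<forall>\<^sub>F y in nhds 0. y \<in> U" using smooth_on_imp_open[OF pU] U(1)
  by (rule eventually_nhds_in_open)
  ultimately have "\<forall>\<^sub>F y in nhds 0. \<bar>deriv p y\<bar> < 1 \<and> \<bar>a y\<bar> < q \<and> y \<in> U"
    by eventually_elim blast
  then obtain R where R: "R > 0" "\<And>y. \<bar>y\<bar> < R \<Longrightarrow> \<bar>deriv p y\<bar> < 1 \<and> \<bar>a y\<bar> < q \<and> y \<in> U"
    unfolding eventually_nhds_metric dist_real_def by auto
  have sub: "{-R<..<R} \<subseteq> U" using R(2) by (auto simp: abs_less_iff)
  note smooth = smooth_on_subset[OF _ open_greaterThanLessThan sub]
  interpret contracting_equation R q p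
    using q R(2) p(2) smooth[OF pU] by unfold_locales (auto simp: less_imp_le)
  have "\<bar>a y\<bar> \<le> q" if "y \<in> I" for y using R(2)[of y] that by (auto simp: abs_less_iff less_imp_le)
  then have "admissible a" using smooth[OF aU] by (simp add: admissible_def)
  then obtain k where k: "smooth_on I k" "solves a \<rho> k"
    by (rule smooth_solution_exists[OF _ smooth[OF U(3)]])
  have "\<forall>\<^sub>F y in nhds 0. y \<in> I" by (rule eventually_nhds_in_open) (use R(1) in auto)
  then have "\<forall>\<^sub>F y in nhds 0. k y = \<rho> y + a y * k (p y)"
    by eventually_elim (use k(2) in \<open>simp add: solves_def\<close>)
  moreover have "smooth_germ k" by (rule smooth_germI[OF k(1)]) (use R(1) in auto)
  ultimately show ?thesis by (rule that[rotated])
qed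

subsection \<open>Geometry of a type (III) germ\<close>

definition square_snd :: "real \<times> real \<Rightarrow> real \<times> real" where
  "square_snd p = (fst p, (snd p)\<^sup>2)"

definition square_fst :: "real \<times> real \<Rightarrow> real \<times> real" where
  "square_fst p = ((fst p)\<^sup>2, snd p)"

lemma square_fst_swap: "square_fst (prod.swap p) = prod.swap (square_snd p)"
  by (simp add: square_fst_def square_snd_def)

lemma square_snd_zero: "square_snd 0 = 0"
  by (simp add: square_snd_def zero_prod_def)

lemma square_snd_has_derivative: "(square_snd has_derivative (\<lambda>v. (fst v, 2 * snd q * snd v))) (at q)"
  unfolding square_snd_def[abs_def] by (auto intro!: derivative_eq_intros)

lemma smooth_germ_square_snd: "smooth_germ square_snd"
  unfolding square_snd_def[abs_def] by (intro smooth_germ_intros)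

lemma D0_square_snd: "D\<^sub>0 square_snd v = (fst v, 0)"
  using fun_cong[OF D0_eqI[OF square_snd_has_derivative], of v] by simp

lemma sing_set_square_snd: "sing_set square_snd = {p. snd p = 0}"
proof -
  have "surj (frechet_derivative square_snd (at p)) \<longleftrightarrow> snd p \<noteq> 0" for p
    unfolding frechet_derivative_at[OF square_snd_has_derivative, symmetric]
  proof
    assume "surj (\<lambda>v :: real \<times> real. (fst v, 2 * snd p * snd v))"
    then obtain v :: "real \<times> real" where "(0, 1) = (fst v, 2 * snd p * snd v)" by (meson surjD)
    then show "snd p \<noteq> 0" by auto
  next
    assume "snd p \<noteq> 0"
    then have "(fst (fst w, snd w / (2 * snd p)), 2 * snd p * snd (fst w, snd w / (2 * snd p))) = w"
      for w :: "real \<times> real" by simp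
    then show "surj (\<lambda>v :: real \<times> real. (fst v, 2 * snd p * snd v))" by (rule surjI)
  qed
  then show ?thesis by (simp only: sing_set_def not_not)
qed

lemma sing_set_equivalent:
  assumes \<gamma>: "smooth_germ \<gamma>" "\<gamma> 0 = 0" and \<delta>: "smooth_germ \<delta>"
    and H: "diffeo_germ H" and K: "diffeo_germ K"
    and eq: "\<forall>\<^sub>F p in nhds 0. K (\<gamma> p) = \<delta> (H p)"
  shows "\<forall>\<^sub>F p in nhds 0. p \<in> sing_set \<gamma> \<longleftrightarrow> H p \<in> sing_set \<delta>"
proof -
  note d = smooth_germ_eventually_has_derivative
  have "\<forall>\<^sub>F p in nhds 0. \<forall>\<^sub>F q in nhds p. K (\<gamma> q) = \<delta> (H q)"
    using eq by (simp add: eventually_eventually)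
  then show ?thesis
    using d[OF \<gamma>(1)] d[OF diffeo_germ_smooth[OF H]] diffeo_germ_eventually_bij[OF H]
      smooth_germ_eventually_compose[OF \<gamma> d[OF diffeo_germ_smooth[OF K]]]
      smooth_germ_eventually_compose[OF \<gamma> diffeo_germ_eventually_bij[OF K]]
      diffeo_germ_eventually_compose[OF H d[OF \<delta>]]
  proof eventually_elim
    case (elim p)
    let ?D\<gamma> = "frechet_derivative \<gamma> (at p)" and ?D\<delta> = "frechet_derivative \<delta> (at (H p))"
      and ?DH = "frechet_derivative H (at p)" and ?DK = "frechet_derivative K (at (\<gamma> p))"
    have "?DK \<circ> ?D\<gamma> = frechet_derivative (\<lambda>q. K (\<gamma> q)) (at p)"
      using frechet_derivative_at[OF has_derivative_compose[OF elim(2,5)]] by (simp add: comp_def)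
    also have "\<dots> = frechet_derivative (\<lambda>q. \<delta> (H q)) (at p)"
      by (rule frechet_derivative_cong_eventually[OF elim(1)])
    also have "\<dots> = ?D\<delta> \<circ> ?DH"
      using frechet_derivative_at[OF has_derivative_compose[OF elim(3,7)]] by (simp add: comp_def)
    finally have comm: "?DK \<circ> ?D\<gamma> = ?D\<delta> \<circ> ?DH" .
    have "surj ?D\<gamma> \<longleftrightarrow> ?DK ` range ?D\<gamma> = ?DK ` UNIV"
      by (rule inj_image_eq_iff[OF bij_is_inj[OF elim(6)], symmetric])
    also have "\<dots> \<longleftrightarrow> surj (?D\<delta> \<circ> ?DH)"
      unfolding comm[symmetric] by (simp only: image_comp bij_is_surj[OF elim(6)])
    also have "\<dots> \<longleftrightarrow> surj ?D\<delta>"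
      unfolding image_comp[symmetric] by (simp only: bij_is_surj[OF elim(4)])
    finally show ?case by (simp add: sing_set_def)
  qed
qed

definition fold_chart ::
  "(real \<times> real \<Rightarrow> real \<times> real) \<Rightarrow> (real \<times> real \<Rightarrow> real \<times> real) \<Rightarrow> (real \<times> real \<Rightarrow> real \<times> real) \<Rightarrow> bool" where
  "fold_chart \<gamma> H K \<longleftrightarrow> diffeo_germ H \<and> diffeo_germ K \<and> (\<forall>\<^sub>F p in nhds 0. K (\<gamma> p) = square_snd (H p))"

lemma fold_germ_iff_fold_chart:
  "fold_germ \<gamma> \<longleftrightarrow> smooth_germ \<gamma> \<and> \<gamma> 0 = 0 \<and> (\<exists>H K. fold_chart \<gamma> H K)"
  by (auto simp: fold_germ_def fold_chart_def square_snd_def case_prod_unfold)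

lemma D0_fold_chart:
  assumes \<gamma>: "smooth_germ \<gamma>" "\<gamma> 0 = 0" and "fold_chart \<gamma> H K"
  shows "D\<^sub>0 K (D\<^sub>0 \<gamma> v) = (fst (D\<^sub>0 H v), 0)"
proof -
  have H: "diffeo_germ H" and K: "diffeo_germ K" and eq: "\<forall>\<^sub>F p in nhds 0. K (\<gamma> p) = square_snd (H p)"
    using assms(3) by (auto simp: fold_chart_def)
  have "D\<^sub>0 K (D\<^sub>0 \<gamma> v) = D\<^sub>0 (\<lambda>p. square_snd (H p)) v"
    using D0_compose[OF diffeo_germ_smooth[OF K] \<gamma>] frechet_derivative_cong_eventually[OF eq] by simp
  also have "\<dots> = (fst (D\<^sub>0 H v), 0)"
    by (simp add: D0_compose smooth_germ_square_snd diffeo_germ_smooth[OF H] diffeo_germ_zero[OF H]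
        D0_square_snd)
  finally show ?thesis .
qed

lemma param_curve_eventually_in:
  assumes "param_curve S c"
  shows "smooth_germ c" "c 0 = 0" "\<forall>\<^sub>F t in nhds 0. c t \<in> S"
proof -
  show "smooth_germ c" "c 0 = 0" using assms by (auto simp: param_curve_def)
  obtain U \<epsilon> where "\<epsilon> > 0" "S \<inter> U = c ` {-\<epsilon><..<\<epsilon>}"
    using assms unfolding param_curve_def by blast
  moreover have "\<forall>\<^sub>F t in nhds 0. t \<in> {-\<epsilon><..<\<epsilon>}"
    by (rule eventually_nhds_in_open) (use \<open>\<epsilon> > 0\<close> in auto)
  ultimately show "\<forall>\<^sub>F t in nhds 0. c t \<in> S" by (auto elim!: eventually_mono)
qed

lemma sing_curve_tangent:
  assumes \<gamma>: "smooth_germ \<gamma>" "\<gamma> 0 = 0" and chart: "fold_chart \<gamma> H K"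
    and c: "param_curve (sing_set \<gamma>) c"
  shows "snd (D\<^sub>0 H (D\<^sub>0 c 1)) = 0"
proof -
  have H: "diffeo_germ H" and K: "diffeo_germ K" and eq: "\<forall>\<^sub>F p in nhds 0. K (\<gamma> p) = square_snd (H p)"
    using chart by (auto simp: fold_chart_def)
  note c = param_curve_eventually_in[OF c]
  have Hc: "smooth_germ (\<lambda>t. H (c t))" by (rule smooth_germ_compose[OF diffeo_germ_smooth[OF H] c(1,2)])
  have "\<forall>\<^sub>F t in nhds 0. snd (H (c t)) = 0"
    using smooth_germ_eventually_compose[OF c(1,2)
        sing_set_equivalent[OF \<gamma> smooth_germ_square_snd H K eq]] c(3)
    by eventually_elim (simp add: sing_set_square_snd)
  from frechet_derivative_cong_eventually[OF this] have "D\<^sub>0 (\<lambda>t. snd (H (c t))) 1 = 0" by simp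
  then show ?thesis
    by (simp add: D0_snd[OF Hc] D0_compose[OF diffeo_germ_smooth[OF H] c(1,2)])
qed

lemma typeIII_partial_derivatives_nonzero:
  assumes f: "typeIII f \<gamma>" and chart: "fold_chart \<gamma> H K"
    and g: "smooth_germ g" "\<forall>\<^sub>F p in nhds 0. g (H p) = f p"
  shows "D\<^sub>0 g (1, 0) \<noteq> 0" "D\<^sub>0 g (0, 1) \<noteq> 0"
proof -
  have H: "diffeo_germ H" and K: "diffeo_germ K" using chart by (auto simp: fold_chart_def)
  have \<gamma>: "smooth_germ \<gamma>" "\<gamma> 0 = 0" and f_smooth: "smooth_germ f"
    using f by (auto simp: typeIII_def fold_germ_iff_fold_chart)
  have Dg: "D\<^sub>0 f v = D\<^sub>0 g (D\<^sub>0 H v)" for v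
    using frechet_derivative_cong_eventually[OF g(2)]
      D0_compose[OF g(1) diffeo_germ_smooth[OF H] diffeo_germ_zero[OF H]] by metis
  show "D\<^sub>0 g (1, 0) \<noteq> 0"
  proof
    assume zero: "D\<^sub>0 g (1, 0) = 0"
    obtain c where c: "param_curve (sing_set \<gamma>) c" "D\<^sub>0 (\<lambda>t. f (c t)) 1 \<noteq> 0"
      using f by (auto simp: typeIII_def comp_def)
    let ?w = "D\<^sub>0 H (D\<^sub>0 c 1)"
    have "?w = fst ?w *\<^sub>R (1, 0)" using sing_curve_tangent[OF \<gamma> chart c(1)] by (simp add: prod_eq_iff)
    then have "D\<^sub>0 g ?w = fst ?w *\<^sub>R D\<^sub>0 g (1, 0)" using linear_cmul[OF linear_D0[OF g(1)]] by metis
    then have "D\<^sub>0 (\<lambda>t. f (c t)) 1 = 0"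
      using D0_compose[OF f_smooth param_curve_eventually_in(1,2)[OF c(1)]] by (simp add: Dg zero)
    with c(2) show False by contradiction
  qed
  show "D\<^sub>0 g (0, 1) \<noteq> 0"
  proof
    assume zero: "D\<^sub>0 g (0, 1) = 0"
    obtain v where v: "D\<^sub>0 H v = (0, 1)" using bij_D0_diffeo_germ[OF H] by (metis bij_pointE)
    have "D\<^sub>0 K (D\<^sub>0 \<gamma> v) = D\<^sub>0 K 0"
      using D0_fold_chart[OF \<gamma> chart, of v] linear_0[OF linear_D0[OF diffeo_germ_smooth[OF K]]]
      by (simp add: v prod_eq_iff)
    then have "D\<^sub>0 \<gamma> v = 0" using bij_D0_diffeo_germ[OF K] by (metis bij_def injD)
    moreover have "D\<^sub>0 f v = 0" by (simp add: Dg v zero)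
    ultimately have "D\<^sub>0 (\<lambda>p. (f p, \<gamma> p)) v = D\<^sub>0 (\<lambda>p. (f p, \<gamma> p)) 0"
      by (simp add: D0_Pair linear_0 linear_D0 f_smooth \<gamma>(1))
    then have "v = 0" using f by (auto simp: typeIII_def dest: injD)
    then show False using v linear_0[OF linear_D0[OF diffeo_germ_smooth[OF H]]]
    by (simp add: zero_prod_def)
  qed
qed

lemma snd_nonzero_if_independent:
  fixes L :: "real \<times> real \<Rightarrow> real \<times> real"
  assumes L: "linear L" "inj L" and uv: "fst u * snd v - snd u * fst v \<noteq> 0" and u: "snd (L u) = 0"
  shows "snd (L v) \<noteq> 0"
proof
  assume v: "snd (L v) = 0"
  let ?a = "fst (L u)" and ?b = "fst (L v)"
  have "L (?b *\<^sub>R u) = L (?a *\<^sub>R v)" using u v by (simp add: linear_cmul[OF L(1)] prod_eq_iff)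
  then have "?b *\<^sub>R u = ?a *\<^sub>R v" using L(2) by (simp add: inj_eq)
  then have "?b * fst u = ?a * fst v" "?b * snd u = ?a * snd v"
    by (auto simp: prod_eq_iff)
  then have "?a * (fst u * snd v - snd u * fst v) = 0" by algebra
  then have "L u = L 0" using uv u linear_0[OF L(1)] by (simp add: prod_eq_iff)
  then have "u = 0" using L(2) by (simp add: inj_eq)
  then show False using uv by simp
qed

lemma discr_transversal_transition:
  assumes tr: "discr_transversal \<gamma>1 \<gamma>2"
    and \<gamma>1: "smooth_germ \<gamma>1" "\<gamma>1 0 = 0" and \<gamma>2: "smooth_germ \<gamma>2" "\<gamma>2 0 = 0"
    and chart1: "fold_chart \<gamma>1 H1 K1" and chart2: "fold_chart \<gamma>2 H2 K2"
    and \<Psi>: "smooth_germ \<Psi>" "\<forall>\<^sub>F p in nhds 0. \<Psi> (K2 p) = K1 p"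
  shows "snd (D\<^sub>0 \<Psi> (1, 0)) \<noteq> 0"
proof -
  have K1: "diffeo_germ K1" and K2: "diffeo_germ K2"
    using chart1 chart2 by (auto simp: fold_chart_def)
  obtain c1 c2 where c: "param_curve (sing_set \<gamma>1) c1" "param_curve (sing_set \<gamma>2) c2"
    and indep: "fst (D\<^sub>0 (\<gamma>1 \<circ> c1) 1) * snd (D\<^sub>0 (\<gamma>2 \<circ> c2) 1)
      - snd (D\<^sub>0 (\<gamma>1 \<circ> c1) 1) * fst (D\<^sub>0 (\<gamma>2 \<circ> c2) 1) \<noteq> 0"
    using tr unfolding discr_transversal_def Let_def by blast
  have tangent: "snd (D\<^sub>0 K (D\<^sub>0 (\<gamma> \<circ> c) 1)) = 0"
    if "smooth_germ \<gamma>" "\<gamma> 0 = 0" "fold_chart \<gamma> H K" "param_curve (sing_set \<gamma>) c" for \<gamma> H K c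
    using D0_compose[OF that(1) param_curve_eventually_in(1,2)[OF that(4)]] D0_fold_chart[OF that(1-3)]
    by (simp add: comp_def)
  let ?v = "D\<^sub>0 (\<gamma>2 \<circ> c2) 1"
  have "snd (D\<^sub>0 K1 ?v) \<noteq> 0"
    using bij_D0_diffeo_germ[OF K1] tangent[OF \<gamma>1 chart1 c(1)]
    by (intro snd_nonzero_if_independent[OF linear_D0[OF diffeo_germ_smooth[OF K1]] _ indep])
       (auto simp: bij_def)
  moreover have "D\<^sub>0 K1 ?v = D\<^sub>0 \<Psi> (D\<^sub>0 K2 ?v)"
    using frechet_derivative_cong_eventually[OF \<Psi>(2)]
      D0_compose[OF \<Psi>(1) diffeo_germ_smooth[OF K2] diffeo_germ_zero[OF K2]] by metis
  moreover have "D\<^sub>0 K2 ?v = fst (D\<^sub>0 K2 ?v) *\<^sub>R (1, 0)"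
    using tangent[OF \<gamma>2 chart2 c(2)] by (simp add: prod_eq_iff)
  ultimately have "snd (fst (D\<^sub>0 K2 ?v) *\<^sub>R D\<^sub>0 \<Psi> (1, 0)) \<noteq> 0"
    using linear_cmul[OF linear_D0[OF \<Psi>(1)]] by metis
  then show ?thesis by simp
qed

subsection \<open>Lifting diffeomorphisms through folds\<close>

lemma smooth_germ_axis_fst: "smooth_germ (\<lambda>x :: real. (x, 0 :: real))"
  and smooth_germ_axis_snd: "smooth_germ (\<lambda>y :: real. (0 :: real, y))"
  by (intro smooth_germ_intros)+

lemma smooth_germ_restrict_fst: "smooth_germ g \<Longrightarrow> smooth_germ (\<lambda>x. g (x, 0))"
  and smooth_germ_restrict_snd: "smooth_germ g \<Longrightarrow> smooth_germ (\<lambda>y. g (0, y))"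
  for g :: "real \<times> real \<Rightarrow> 'a::real_normed_vector"
  using smooth_germ_compose[OF _ smooth_germ_axis_fst] smooth_germ_compose[OF _ smooth_germ_axis_snd]
  by (simp_all add: zero_prod_def)

lemma D0_restrict_fst: "smooth_germ g \<Longrightarrow> D\<^sub>0 (\<lambda>x. g (x, 0)) v = D\<^sub>0 g (v, 0)"
  and D0_restrict_snd: "smooth_germ g \<Longrightarrow> D\<^sub>0 (\<lambda>y. g (0, y)) v = D\<^sub>0 g (0, v)"
  for g :: "real \<times> real \<Rightarrow> 'a::real_normed_vector"
proof -
  have "bounded_linear (\<lambda>x :: real. (x, 0 :: real))" "bounded_linear (\<lambda>y :: real. (0 :: real, y))"
    by (intro bounded_linear_Pair bounded_linear_ident bounded_linear_zero)+
  then show "smooth_germ g \<Longrightarrow> D\<^sub>0 (\<lambda>x. g (x, 0)) v = D\<^sub>0 g (v, 0)"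
    "smooth_germ g \<Longrightarrow> D\<^sub>0 (\<lambda>y. g (0, y)) v = D\<^sub>0 g (0, v)"
    by (simp_all add: D0_compose[OF _ smooth_germ_axis_fst] D0_compose[OF _ smooth_germ_axis_snd]
        zero_prod_def D0_linear)
qed

lemma eventually_axis_fst: "\<forall>\<^sub>F p in nhds 0. P p \<Longrightarrow> \<forall>\<^sub>F x in nhds (0::real). P (x, 0::real)"
  and eventually_axis_snd: "\<forall>\<^sub>F p in nhds 0. P p \<Longrightarrow> \<forall>\<^sub>F y in nhds (0::real). P (0::real, y)"
  using smooth_germ_eventually_compose[OF smooth_germ_axis_fst]
    smooth_germ_eventually_compose[OF smooth_germ_axis_snd]
  by (simp_all add: zero_prod_def)

lemma D0_mult_vanishing:
  fixes f g :: "'a::real_normed_vector \<Rightarrow> real"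
  assumes f: "smooth_germ f" and g: "smooth_germ g" "g 0 = 0"
  shows "D\<^sub>0 (\<lambda>x. g x * f x) v = D\<^sub>0 g v * f 0"
proof -
  have "continuous (at 0) f" by (rule has_derivative_continuous[OF smooth_germ_has_derivative[OF f]])
  from has_derivative_bilinear_vanishing[OF bounded_bilinear_mult this
      smooth_germ_has_derivative[OF g(1)] g(2)]
  have "((\<lambda>x. g x * f x) has_derivative (\<lambda>v. D\<^sub>0 g v * f 0)) (at 0)" by (simp add: mult.commute)
  from fun_cong[OF D0_eqI[OF this]] show ?thesis .
qed

lemma diffeo_germ_ident_mult:
  fixes f :: "real \<Rightarrow> real"
  assumes "smooth_germ f" "f 0 \<noteq> 0"
  shows "diffeo_germ (\<lambda>x. x * f x)"
  by (rule diffeo_germ_realI)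
     (use assms in \<open>auto simp: D0_mult_vanishing smooth_germ_ident intro!: smooth_germ_intros\<close>)

lemma bounded_linear_swap: "bounded_linear prod.swap"
  unfolding prod.swap_def by (intro bounded_linear_Pair bounded_linear_fst bounded_linear_snd)

lemma swap_zero: "prod.swap 0 = 0"
  by (simp add: prod_eq_iff)

lemma diffeo_germ_swap: "diffeo_germ (prod.swap :: 'a::euclidean_space \<times> 'a \<Rightarrow> 'a \<times> 'a)"
  by (intro diffeo_germ_linear inj_swap bounded_linear.linear bounded_linear_swap)

lemma diffeo_germ_triangularI:
  fixes a e :: "real \<times> real \<Rightarrow> real"
  assumes a: "smooth_germ a" "a 0 = 0" "D\<^sub>0 a (1, 0) \<noteq> 0" and e: "smooth_germ e" "e 0 \<noteq> 0"
  shows "diffeo_germ (\<lambda>p. (a p, snd p * e p))"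
proof (rule diffeo_germI)
  have b: "smooth_germ (\<lambda>p. snd p * e p)" by (intro smooth_germ_intros e)
  show "smooth_germ (\<lambda>p. (a p, snd p * e p))" by (intro smooth_germ_Pair a b)
  show "(a 0, snd 0 * e 0) = 0" using a(2) by (simp add: zero_prod_def)
  have "D\<^sub>0 (\<lambda>p. snd p * e p) v = snd v * e 0" for v
    by (simp add: D0_mult_vanishing[OF e(1)] smooth_germ_linear D0_linear bounded_linear_snd)
  then have D: "D\<^sub>0 (\<lambda>p. (a p, snd p * e p)) v = (D\<^sub>0 a v, snd v * e 0)" for v
    by (simp add: D0_Pair[OF a(1) b])
  show "inj (D\<^sub>0 (\<lambda>p. (a p, snd p * e p)))"
  proof (rule linear_injective_0[THEN iffD2, rule_format])
    show "linear (D\<^sub>0 (\<lambda>p. (a p, snd p * e p)))" by (intro linear_D0 smooth_germ_Pair a b)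
    fix v assume "D\<^sub>0 (\<lambda>p. (a p, snd p * e p)) v = 0"
    then have "snd v = 0" "D\<^sub>0 a v = 0" using e(2) by (auto simp: D prod_eq_iff)
    then have "v = fst v *\<^sub>R (1, 0)" by (simp add: prod_eq_iff)
    then have "D\<^sub>0 a v = fst v *\<^sub>R D\<^sub>0 a (1, 0)" using linear_cmul[OF linear_D0[OF a(1)]] by metis
    then show "v = 0" using \<open>snd v = 0\<close> \<open>D\<^sub>0 a v = 0\<close> a(3) by (simp add: prod_eq_iff)
  qed
qed

lemma diffeo_germ_maps_axis_fst:
  fixes T :: "real \<times> real \<Rightarrow> real \<times> real"
  assumes T: "diffeo_germ T" and axis: "\<forall>\<^sub>F x in nhds 0. snd (T (x, 0)) = 0"
  shows "fst (D\<^sub>0 T (1, 0)) \<noteq> 0" "snd (D\<^sub>0 T (0, 1)) \<noteq> 0"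
proof -
  note smooth = diffeo_germ_smooth[OF T]
  interpret linear "D\<^sub>0 T" by (rule linear_D0[OF smooth])
  have inj: "D\<^sub>0 T v = 0 \<Longrightarrow> v = 0" for v
    using bij_D0_diffeo_germ[OF T] zero by (metis bij_def injD)
  have zero_snd: "snd (D\<^sub>0 T (1, 0)) = 0"
    using frechet_derivative_cong_eventually[OF axis]
      D0_restrict_fst[OF smooth_germ_snd[OF smooth], of 1]
    by (simp add: D0_snd[OF smooth])
  then show fst: "fst (D\<^sub>0 T (1, 0)) \<noteq> 0" using inj[of "(1, 0)"] by (auto simp: prod_eq_iff)
  show "snd (D\<^sub>0 T (0, 1)) \<noteq> 0"
  proof
    assume "snd (D\<^sub>0 T (0, 1)) = 0"
    let ?v = "fst (D\<^sub>0 T (0, 1)) *\<^sub>R (1, 0) - fst (D\<^sub>0 T (1, 0)) *\<^sub>R (0, 1)"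
    have "D\<^sub>0 T ?v = 0"
      unfolding diff scale using zero_snd \<open>snd (D\<^sub>0 T (0, 1)) = 0\<close> by (simp add: prod_eq_iff)
    from inj[OF this] show False using fst by (simp add: prod_eq_iff)
  qed
qed

lemma lift_square_snd:
  fixes T :: "real \<times> real \<Rightarrow> real \<times> real"
  assumes T: "diffeo_germ T" and axis: "\<forall>\<^sub>F x in nhds 0. snd (T (x, 0)) = 0"
    and pos: "snd (D\<^sub>0 T (0, 1)) > 0"
  obtains e where "smooth_germ e" "e 0 > 0" "diffeo_germ (\<lambda>p. (fst (T (square_snd p)), snd p * e p))"
    "\<forall>\<^sub>F p in nhds 0. T (square_snd p) = square_snd (fst (T (square_snd p)), snd p * e p)"
proof -
  note smooth = diffeo_germ_smooth[OF T] and sq = smooth_germ_square_snd square_snd_zero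
  obtain B where B: "smooth_germ B" "\<forall>\<^sub>F p in nhds 0. snd (T p) = snd p *\<^sub>R B p"
    "B 0 = D\<^sub>0 (\<lambda>p. snd (T p)) (0, 1)"
    by (rule hadamard_division_germ[OF smooth_germ_snd[OF smooth] axis])
  have B0: "B 0 > 0" using B(3) pos by (simp add: D0_snd[OF smooth])
  define e where "e p = sqrt (B (square_snd p))" for p
  have e: "smooth_germ e" "e 0 > 0"
    unfolding e_def[abs_def] using B0 sq(2) by (auto intro!: smooth_germ_sqrt
        smooth_germ_compose[OF B(1) sq])
  have Tsq: "smooth_germ (\<lambda>p. T (square_snd p))" by (rule smooth_germ_compose[OF smooth sq])
  have "D\<^sub>0 (\<lambda>p. fst (T (square_snd p))) (1, 0) = fst (D\<^sub>0 T (1, 0))"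
    by (simp add: D0_fst[OF Tsq] D0_compose[OF smooth sq] D0_square_snd)
  then have "diffeo_germ (\<lambda>p. (fst (T (square_snd p)), snd p * e p))"
    using diffeo_germ_maps_axis_fst(1)[OF T axis] e diffeo_germ_zero[OF T] sq(2)
    by (intro diffeo_germ_triangularI smooth_germ_fst Tsq) auto
  moreover have "\<forall>\<^sub>F p in nhds 0. T (square_snd p) = square_snd (fst (T (square_snd p)), snd p * e p)"
    using smooth_germ_eventually_compose[OF sq B(2)]
      smooth_germ_eventually_compose[OF sq smooth_germ_eventually_pos[OF B(1) B0]]
  proof eventually_elim
    case (elim p)
    then show ?case
      by (auto simp: prod_eq_iff e_def power_mult_distrib square_snd_def)
  qed
  ultimately show ?thesis by (rule that[OF e])
qed

lemma lift_square_fst: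
  fixes T :: "real \<times> real \<Rightarrow> real \<times> real"
  assumes T: "diffeo_germ T" and axis: "\<forall>\<^sub>F y in nhds 0. fst (T (0, y)) = 0"
    and pos: "fst (D\<^sub>0 T (1, 0)) > 0"
  obtains e where "smooth_germ e" "e 0 > 0" "diffeo_germ (\<lambda>p. (fst p * e p, snd (T (square_fst p))))"
    "\<forall>\<^sub>F p in nhds 0. T (square_fst p) = square_fst (fst p * e p, snd (T (square_fst p)))"
proof -
  let ?T = "\<lambda>p. prod.swap (T (prod.swap p))"
  note swap = diffeo_germ_swap smooth_germ_linear[OF bounded_linear_swap] swap_zero
  have T': "diffeo_germ ?T" by (rule diffeo_germ_compose[OF swap(1) diffeo_germ_compose[OF T swap(1)]])
  have Tswap: "smooth_germ (\<lambda>p. T (prod.swap p))"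
    by (rule smooth_germ_compose[OF diffeo_germ_smooth[OF T] swap(2,3)])
  have axis': "\<forall>\<^sub>F x in nhds 0. snd (?T (x, 0)) = 0" using axis by simp
  have "D\<^sub>0 ?T (0, 1) = prod.swap (D\<^sub>0 T (1, 0))"
    by (simp add: D0_linear_compose[OF bounded_linear_swap Tswap]
        D0_compose[OF diffeo_germ_smooth[OF T] swap(2,3)]
        D0_linear[OF bounded_linear_swap])
  then have pos': "snd (D\<^sub>0 ?T (0, 1)) > 0" using pos by simp
  obtain e where e: "smooth_germ e" "e 0 > 0" "diffeo_germ (\<lambda>p. (fst (?T (square_snd p)), snd p * e p))"
    "\<forall>\<^sub>F p in nhds 0. ?T (square_snd p) = square_snd (fst (?T (square_snd p)), snd p * e p)"
    by (rule lift_square_snd[OF T' axis' pos']) (rule that)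
  have "smooth_germ (\<lambda>p. e (prod.swap p))" by (rule smooth_germ_compose[OF e(1) swap(2,3)])
  moreover have "e (prod.swap 0) > 0" using e(2) by (simp add: swap(3))
  moreover have "diffeo_germ (\<lambda>p.
      prod.swap (fst (?T (square_snd (prod.swap p))), snd (prod.swap p) * e (prod.swap p)))"
    by (rule diffeo_germ_compose[OF swap(1) diffeo_germ_compose[OF e(3) swap(1)]])
  then have "diffeo_germ (\<lambda>p. (fst p * e (prod.swap p), snd (T (square_fst p))))"
    by (simp add: square_fst_swap[symmetric])
  moreover have "\<forall>\<^sub>F p in nhds 0. T (square_fst p)
    = square_fst (fst p * e (prod.swap p), snd (T (square_fst p)))"
    using diffeo_germ_eventually_compose[OF swap(1) e(4)]
    by eventually_elim (simp add: prod_eq_iff square_fst_def square_snd_def)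
  ultimately show ?thesis by (rule that)
qed

subsection \<open>Straightening both discriminants\<close>

definition shear :: "(real \<Rightarrow> real) \<Rightarrow> real \<times> real \<Rightarrow> real \<times> real" where
  "shear d p = (fst p - d (snd p), snd p)"

lemma diffeo_germ_shear:
  assumes d: "smooth_germ d" "d 0 = 0"
  shows "diffeo_germ (shear d)"
proof -
  have smooth: "smooth_germ (shear d)" if "smooth_germ d" "d 0 = 0" for d
    unfolding shear_def[abs_def] using that(2)
    by (intro smooth_germ_intros smooth_germ_compose[OF that(1)]) simp
  have "smooth_germ (shear d)" "smooth_germ (shear (\<lambda>y. - d y))"
    using d smooth[OF d] smooth[OF smooth_germ_minus[OF d(1)]] by simp_all
  then show ?thesis
    unfolding diffeo_germ_def using d(2)
    by (intro conjI exI[of _ "shear (\<lambda>y. - d y)"]) (auto simp: shear_def prod_eq_iff)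
qed

definition scale_fst :: "real \<Rightarrow> real \<times> real \<Rightarrow> real \<times> real" where
  "scale_fst \<sigma> p = (\<sigma> * fst p, snd p)"

lemma bounded_linear_scale_fst: "bounded_linear (scale_fst \<sigma>)"
  unfolding scale_fst_def[abs_def]
  by (intro bounded_linear_Pair bounded_linear_const_mult bounded_linear_fst bounded_linear_snd)

lemma diffeo_germ_scale_fst: "\<sigma> \<noteq> 0 \<Longrightarrow> diffeo_germ (scale_fst \<sigma>)"
  by (intro diffeo_germ_linear bounded_linear.linear bounded_linear_scale_fst)
     (auto intro!: injI simp: scale_fst_def prod_eq_iff)

lemma axis_image_graph:
  fixes \<Psi> :: "real \<times> real \<Rightarrow> real \<times> real"
  assumes \<Psi>: "smooth_germ \<Psi>" "\<Psi> 0 = 0" and nz: "snd (D\<^sub>0 \<Psi> (1, 0)) \<noteq> 0"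
  obtains d where "smooth_germ d" "d 0 = 0" "\<forall>\<^sub>F x in nhds 0. fst (\<Psi> (x, 0)) = d (snd (\<Psi> (x, 0)))"
proof -
  have \<Psi>00: "\<Psi> (0, 0) = 0" using \<Psi>(2) by (simp add: zero_prod_def)
  let ?q = "\<lambda>x. snd (\<Psi> (x, 0))"
  have axis: "smooth_germ (\<lambda>x. \<Psi> (x, 0))" by (rule smooth_germ_restrict_fst[OF \<Psi>(1)])
  have "diffeo_germ ?q"
    using nz \<Psi>00
    by (intro diffeo_germ_realI smooth_germ_snd axis)
       (auto simp: D0_snd[OF axis] D0_restrict_fst[OF \<Psi>(1)])
  then obtain h where h: "diffeo_germ h" "\<forall>\<^sub>F x in nhds 0. h (?q x) = x" by (rule diffeo_germ_inverse)
  show ?thesis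
  proof (rule that[of "\<lambda>y. fst (\<Psi> (h y, 0))"])
    show "smooth_germ (\<lambda>y. fst (\<Psi> (h y, 0)))"
      by (intro smooth_germ_fst smooth_germ_compose[OF axis diffeo_germ_smooth[OF h(1)]
          diffeo_germ_zero[OF h(1)]])
    show "fst (\<Psi> (h 0, 0)) = 0" using \<Psi>00 diffeo_germ_zero[OF h(1)] by simp
    show "\<forall>\<^sub>F x in nhds 0. fst (\<Psi> (x, 0)) = fst (\<Psi> (h (?q x), 0))"
      using h(2) by eventually_elim simp
  qed
qed

lemma straighten_axis_image:
  fixes \<Psi> :: "real \<times> real \<Rightarrow> real \<times> real"
  assumes \<Psi>: "diffeo_germ \<Psi>" and nz: "snd (D\<^sub>0 \<Psi> (1, 0)) \<noteq> 0"
  obtains S S' where "diffeo_germ S" "diffeo_germ S'" "\<And>p. S (square_snd p) = square_snd (S' p)"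
    "\<forall>\<^sub>F x in nhds 0. fst (S (\<Psi> (x, 0))) = 0" "fst (D\<^sub>0 (\<lambda>p. S (\<Psi> p)) (0, 1)) > 0"
proof -
  obtain d where d: "smooth_germ d" "d 0 = 0" "\<forall>\<^sub>F x in nhds 0. fst (\<Psi> (x, 0)) = d (snd (\<Psi> (x, 0)))"
    by (rule axis_image_graph[OF diffeo_germ_smooth[OF \<Psi>] diffeo_germ_zero[OF \<Psi>] nz])
  let ?T = "\<lambda>p. shear d (\<Psi> p)"
  have T: "diffeo_germ ?T" by (rule diffeo_germ_compose[OF diffeo_germ_shear[OF d(1,2)] \<Psi>])
  have axis: "\<forall>\<^sub>F x in nhds 0. snd (prod.swap (?T (x, 0))) = 0"
    using d(3) by eventually_elim (simp add: shear_def)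
  have "fst (D\<^sub>0 ?T (0, 1)) \<noteq> 0"
    using diffeo_germ_maps_axis_fst(2)[OF diffeo_germ_compose[OF diffeo_germ_swap T] axis]
    by (simp add: D0_linear_compose[OF bounded_linear_swap diffeo_germ_smooth[OF T]])
  then obtain \<sigma> where \<sigma>: "\<sigma> \<noteq> 0" "\<sigma> * fst (D\<^sub>0 ?T (0, 1)) > 0"
    by (intro that[of "fst (D\<^sub>0 ?T (0, 1))"]) (auto simp: zero_less_mult_iff)
  have d2: "smooth_germ (\<lambda>y. d (y\<^sup>2))" by (intro smooth_germ_compose[OF d(1)] smooth_germ_intros) simp
  show ?thesis
  proof (rule that)
    show "diffeo_germ (\<lambda>p. scale_fst \<sigma> (shear d p))"
      "diffeo_germ (\<lambda>p. scale_fst \<sigma> (shear (\<lambda>y. d (y\<^sup>2)) p))"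
      using d(2) by (intro diffeo_germ_compose[OF diffeo_germ_scale_fst[OF \<sigma>(1)]] diffeo_germ_shear
          d(1) d2; simp)+
    show "scale_fst \<sigma> (shear d (square_snd p)) = square_snd (scale_fst \<sigma> (shear (\<lambda>y. d (y\<^sup>2)) p))" for p
      by (simp add: scale_fst_def shear_def square_snd_def)
    show "\<forall>\<^sub>F x in nhds 0. fst (scale_fst \<sigma> (?T (x, 0))) = 0"
      using axis by eventually_elim (simp add: scale_fst_def)
    show "fst (D\<^sub>0 (\<lambda>p. scale_fst \<sigma> (?T p)) (0, 1)) > 0"
      unfolding D0_linear_compose[OF bounded_linear_scale_fst diffeo_germ_smooth[OF T]]
      using \<sigma>(2) by (simp add: scale_fst_def)
  qed
qed

lemma straighten_transition:
  fixes \<Psi> :: "real \<times> real \<Rightarrow> real \<times> real"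
  assumes \<Psi>: "diffeo_germ \<Psi>" and nz: "snd (D\<^sub>0 \<Psi> (1, 0)) \<noteq> 0"
  obtains S S' E where "diffeo_germ S" "diffeo_germ S'" "diffeo_germ E"
    "\<And>p. S (square_snd p) = square_snd (S' p)"
    "\<forall>\<^sub>F p in nhds 0. prod.swap (S (\<Psi> (square_snd p))) = square_snd (E p)"
proof -
  obtain S S' where S: "diffeo_germ S" and S': "diffeo_germ S'"
    and SS': "\<And>p. S (square_snd p) = square_snd (S' p)"
    and axis: "\<forall>\<^sub>F x in nhds 0. fst (S (\<Psi> (x, 0))) = 0" and pos: "fst (D\<^sub>0 (\<lambda>p. S (\<Psi> p)) (0, 1)) > 0"
    by (rule straighten_axis_image[OF \<Psi> nz]) (rule that)
  let ?T = "\<lambda>p. prod.swap (S (\<Psi> p))"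
  have S\<Psi>: "diffeo_germ (\<lambda>p. S (\<Psi> p))" by (rule diffeo_germ_compose[OF S \<Psi>])
  have T: "diffeo_germ ?T" by (rule diffeo_germ_compose[OF diffeo_germ_swap S\<Psi>])
  have axis': "\<forall>\<^sub>F x in nhds 0. snd (?T (x, 0)) = 0" using axis by simp
  have pos': "snd (D\<^sub>0 ?T (0, 1)) > 0"
    using pos by (simp add: D0_linear_compose[OF bounded_linear_swap diffeo_germ_smooth[OF S\<Psi>]])
  show ?thesis by (rule lift_square_snd[OF T axis' pos']) (rule that[OF S S' _ SS'])
qed

lemma straighten_discriminants:
  assumes \<gamma>1: "smooth_germ \<gamma>1" "\<gamma>1 0 = 0" and \<gamma>2: "smooth_germ \<gamma>2" "\<gamma>2 0 = 0"
    and chart1: "fold_chart \<gamma>1 H1 K1" and chart2: "fold_chart \<gamma>2 H2 K2"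
    and tr: "discr_transversal \<gamma>1 \<gamma>2"
  obtains K H H' where "fold_chart \<gamma>1 H K" "fold_chart \<gamma>2 H' (\<lambda>p. prod.swap (K p))"
proof -
  have H1: "diffeo_germ H1" and K1: "diffeo_germ K1"
    and eq1: "\<forall>\<^sub>F p in nhds 0. K1 (\<gamma>1 p) = square_snd (H1 p)"
    and H2: "diffeo_germ H2" and K2: "diffeo_germ K2"
    and eq2: "\<forall>\<^sub>F p in nhds 0. K2 (\<gamma>2 p) = square_snd (H2 p)"
    using chart1 chart2 by (auto simp: fold_chart_def)
  obtain L where L: "diffeo_germ L" "\<forall>\<^sub>F p in nhds 0. L (K2 p) = p" by (rule diffeo_germ_inverse[OF K2])
  define \<Psi> where "\<Psi> p = K1 (L p)" for p
  have \<Psi>: "diffeo_germ \<Psi>" unfolding \<Psi>_def[abs_def] by (rule diffeo_germ_compose[OF K1 L(1)])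
  have \<Psi>K2: "\<forall>\<^sub>F p in nhds 0. \<Psi> (K2 p) = K1 p" using L(2) by eventually_elim (simp add: \<Psi>_def)
  have "snd (D\<^sub>0 \<Psi> (1, 0)) \<noteq> 0"
    by (rule discr_transversal_transition[OF tr \<gamma>1 \<gamma>2 chart1 chart2 diffeo_germ_smooth[OF \<Psi>] \<Psi>K2])
  then obtain S S' E where S: "diffeo_germ S" and S': "diffeo_germ S'" and E: "diffeo_germ E"
    and SS': "\<And>p. S (square_snd p) = square_snd (S' p)"
    and lift: "\<forall>\<^sub>F p in nhds 0. prod.swap (S (\<Psi> (square_snd p))) = square_snd (E p)"
    by (rule straighten_transition[OF \<Psi>]) (rule that)
  have SK1: "diffeo_germ (\<lambda>p. S (K1 p))" by (rule diffeo_germ_compose[OF S K1])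
  show ?thesis
  proof (rule that)
    have "\<forall>\<^sub>F p in nhds 0. S (K1 (\<gamma>1 p)) = square_snd (S' (H1 p))"
      using eq1 by eventually_elim (simp add: SS')
    then show "fold_chart \<gamma>1 (\<lambda>p. S' (H1 p)) (\<lambda>p. S (K1 p))"
      using diffeo_germ_compose[OF S' H1] SK1 by (simp add: fold_chart_def)
    have "\<forall>\<^sub>F p in nhds 0. prod.swap (S (K1 (\<gamma>2 p))) = square_snd (E (H2 p))"
      using smooth_germ_eventually_compose[OF \<gamma>2 \<Psi>K2] eq2 diffeo_germ_eventually_compose[OF H2 lift]
      by eventually_elim metis
    then show "fold_chart \<gamma>2 (\<lambda>p. E (H2 p)) (\<lambda>p. prod.swap (S (K1 p)))"
      using diffeo_germ_compose[OF E H2] diffeo_germ_compose[OF diffeo_germ_swap SK1]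
      by (simp add: fold_chart_def)
  qed
qed

lemma typeIII_normal_chart:
  assumes f: "typeIII f \<gamma>" and chart: "fold_chart \<gamma> H K"
  obtains H' g where "fold_chart \<gamma> H' K" "smooth_germ g" "g 0 = 0" "\<forall>\<^sub>F p in nhds 0. g (H' p) = f p"
    "D\<^sub>0 g (1, 0) * D\<^sub>0 g (0, 1) > 0"
proof -
  have H: "diffeo_germ H" and K: "diffeo_germ K" and eq: "\<forall>\<^sub>F p in nhds 0. K (\<gamma> p) = square_snd (H p)"
    using chart by (auto simp: fold_chart_def)
  obtain L where L: "diffeo_germ L" "\<forall>\<^sub>F p in nhds 0. L (H p) = p" by (rule diffeo_germ_inverse[OF H])
  let ?g = "\<lambda>p. f (L p)"
  have g: "smooth_germ ?g" "?g 0 = 0" "\<forall>\<^sub>F p in nhds 0. ?g (H p) = f p"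
    using f L(2) diffeo_germ_smooth[OF L(1)] diffeo_germ_zero[OF L(1)]
    by (auto simp: typeIII_def intro: smooth_germ_compose elim!: eventually_mono)
  define \<sigma> where "\<sigma> = sgn (D\<^sub>0 ?g (1, 0) * D\<^sub>0 ?g (0, 1))"
  have nz: "D\<^sub>0 ?g (1, 0) * D\<^sub>0 ?g (0, 1) \<noteq> 0"
    using typeIII_partial_derivatives_nonzero[OF f chart g(1,3)] by simp
  then have \<sigma>: "\<sigma> * \<sigma> = 1" "\<sigma> * (D\<^sub>0 ?g (1, 0) * D\<^sub>0 ?g (0, 1)) > 0"
    unfolding \<sigma>_def by (auto simp: sgn_if zero_less_mult_iff mult_less_0_iff)
  define F where "F p = (fst p, \<sigma> * snd p)" for p :: "real \<times> real"
  have F_lin: "bounded_linear F"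
    unfolding F_def[abs_def]
    by (intro bounded_linear_Pair bounded_linear_fst bounded_linear_const_mult bounded_linear_snd)
  have FF: "F (F p) = p" for p using \<sigma>(1) by (simp add: F_def flip: mult.assoc)
  have F: "diffeo_germ F"
    using F_lin FF by (intro diffeo_germ_linear bounded_linear.linear) (metis injI)+
  note F' = diffeo_germ_smooth[OF F] diffeo_germ_zero[OF F]
  show ?thesis
  proof (rule that[of "\<lambda>p. F (H p)" "\<lambda>p. ?g (F p)"])
    have "square_snd (F p) = square_snd p" for p
      using \<sigma>(1) by (simp add: square_snd_def F_def power2_eq_square mult.left_commute[of \<sigma>]
        flip: mult.assoc)
    then show "fold_chart \<gamma> (\<lambda>p. F (H p)) K"
      using chart diffeo_germ_compose[OF F H] by (simp add: fold_chart_def)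
    show "smooth_germ (\<lambda>p. ?g (F p))" by (rule smooth_germ_compose[OF g(1) F'])
    show "?g (F 0) = 0" using g(2) F'(2) by simp
    show "\<forall>\<^sub>F p in nhds 0. ?g (F (F (H p))) = f p" using g(3) by (simp add: FF)
    have "D\<^sub>0 (\<lambda>p. ?g (F p)) v = D\<^sub>0 ?g (F v)" for v
      by (simp add: D0_compose[OF g(1) F'] D0_linear[OF F_lin])
    moreover have "F (1, 0) = (1, 0)" "F (0, 1) = \<sigma> *\<^sub>R (0, 1)" by (simp_all add: F_def)
    ultimately show "D\<^sub>0 (\<lambda>p. ?g (F p)) (1, 0) * D\<^sub>0 (\<lambda>p. ?g (F p)) (0, 1) > 0"
      using \<sigma>(2) by (simp only: linear_cmul[OF linear_D0[OF g(1)]] real_scaleR_def mult.left_commute)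
  qed
qed

lemma diagram_equiv_trans:
  assumes "diagram_equiv f1 \<gamma>1 f2 \<gamma>2 g1 \<delta>1 g2 \<delta>2" "diagram_equiv g1 \<delta>1 g2 \<delta>2 k1 \<eta>1 k2 \<eta>2"
  shows "diagram_equiv f1 \<gamma>1 f2 \<gamma>2 k1 \<eta>1 k2 \<eta>2"
proof -
  obtain h1 h2 H1 H2 K where d: "diffeo_germ h1" "diffeo_germ h2" "diffeo_germ H1" "diffeo_germ H2"
    "diffeo_germ K"
    and eq: "\<forall>\<^sub>F p in nhds 0. h1 (f1 p) = g1 (H1 p)" "\<forall>\<^sub>F p in nhds 0. h2 (f2 p) = g2 (H2 p)"
      "\<forall>\<^sub>F p in nhds 0. K (\<gamma>1 p) = \<delta>1 (H1 p)" "\<forall>\<^sub>F p in nhds 0. K (\<gamma>2 p) = \<delta>2 (H2 p)"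
    using assms(1) unfolding diagram_equiv_def by blast
  obtain h1' h2' H1' H2' K' where d': "diffeo_germ h1'" "diffeo_germ h2'" "diffeo_germ H1'"
    "diffeo_germ H2'" "diffeo_germ K'"
    and eq': "\<forall>\<^sub>F p in nhds 0. h1' (g1 p) = k1 (H1' p)" "\<forall>\<^sub>F p in nhds 0. h2' (g2 p) = k2 (H2' p)"
      "\<forall>\<^sub>F p in nhds 0. K' (\<delta>1 p) = \<eta>1 (H1' p)" "\<forall>\<^sub>F p in nhds 0. K' (\<delta>2 p) = \<eta>2 (H2' p)"
    using assms(2) unfolding diagram_equiv_def by blast
  have "\<forall>\<^sub>F p in nhds 0. h1' (h1 (f1 p)) = k1 (H1' (H1 p))"
    using eq(1) diffeo_germ_eventually_compose[OF d(3) eq'(1)] by eventually_elim simp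
  moreover have "\<forall>\<^sub>F p in nhds 0. h2' (h2 (f2 p)) = k2 (H2' (H2 p))"
    using eq(2) diffeo_germ_eventually_compose[OF d(4) eq'(2)] by eventually_elim simp
  moreover have "\<forall>\<^sub>F p in nhds 0. K' (K (\<gamma>1 p)) = \<eta>1 (H1' (H1 p))"
    using eq(3) diffeo_germ_eventually_compose[OF d(3) eq'(3)] by eventually_elim simp
  moreover have "\<forall>\<^sub>F p in nhds 0. K' (K (\<gamma>2 p)) = \<eta>2 (H2' (H2 p))"
    using eq(4) diffeo_germ_eventually_compose[OF d(4) eq'(4)] by eventually_elim simp
  ultimately show ?thesis
    unfolding diagram_equiv_def
    using diffeo_germ_compose[OF d'(1) d(1)] diffeo_germ_compose[OF d'(2) d(2)]
      diffeo_germ_compose[OF d'(3) d(3)] diffeo_germ_compose[OF d'(4) d(4)]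
          diffeo_germ_compose[OF d'(5) d(5)]
    by blast
qed

lemma typeIII_III_equiv_square_maps:
  assumes "typeIII_III f1 \<gamma>1 f2 \<gamma>2"
  obtains g1 g2 where "smooth_germ g1" "g1 0 = 0" "D\<^sub>0 g1 (1, 0) * D\<^sub>0 g1 (0, 1) > 0"
    "smooth_germ g2" "g2 0 = 0" "D\<^sub>0 g2 (1, 0) * D\<^sub>0 g2 (0, 1) > 0"
    "diagram_equiv f1 \<gamma>1 f2 \<gamma>2 g1 square_snd g2 square_fst"
proof -
  from assms have f1: "typeIII f1 \<gamma>1" and f2: "typeIII f2 \<gamma>2" and tr: "discr_transversal \<gamma>1 \<gamma>2"
    by (auto simp: typeIII_III_def)
  have "fold_germ \<gamma>1" "fold_germ \<gamma>2" using f1 f2 by (auto simp: typeIII_def)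
  then obtain G1' K1 G2' K2 where \<gamma>1: "smooth_germ \<gamma>1" "\<gamma>1 0 = 0" "fold_chart \<gamma>1 G1' K1"
    and \<gamma>2: "smooth_germ \<gamma>2" "\<gamma>2 0 = 0" "fold_chart \<gamma>2 G2' K2"
    unfolding fold_germ_iff_fold_chart by blast
  obtain K G1 G2 where charts: "fold_chart \<gamma>1 G1 K" "fold_chart \<gamma>2 G2 (\<lambda>p. prod.swap (K p))"
    by (rule straighten_discriminants[OF \<gamma>1(1,2) \<gamma>2(1,2) \<gamma>1(3) \<gamma>2(3) tr])
  obtain H1 g1 where H1: "fold_chart \<gamma>1 H1 K" and g1: "smooth_germ g1" "g1 0 = 0"
    "\<forall>\<^sub>F p in nhds 0. g1 (H1 p) = f1 p" "D\<^sub>0 g1 (1, 0) * D\<^sub>0 g1 (0, 1) > 0"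
    by (rule typeIII_normal_chart[OF f1 charts(1)])
  obtain H2 g2 where H2: "fold_chart \<gamma>2 H2 (\<lambda>p. prod.swap (K p))" and g2: "smooth_germ g2" "g2 0 = 0"
    "\<forall>\<^sub>F p in nhds 0. g2 (H2 p) = f2 p" "D\<^sub>0 g2 (1, 0) * D\<^sub>0 g2 (0, 1) > 0"
    by (rule typeIII_normal_chart[OF f2 charts(2)])
  let ?g2 = "\<lambda>p. g2 (prod.swap p)"
  note swap = smooth_germ_linear[OF bounded_linear_swap] swap_zero
  have "\<forall>\<^sub>F p in nhds 0. K (\<gamma>2 p) = square_fst (prod.swap (H2 p))"
    using H2 unfolding fold_chart_def square_fst_swap by (auto elim!: eventually_mono simp: prod_eq_iff)
  moreover have "diffeo_germ (\<lambda>p. prod.swap (H2 p))"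
    using diffeo_germ_compose[OF diffeo_germ_swap] H2 unfolding fold_chart_def by blast
  moreover have "diffeo_germ (\<lambda>t :: real. t)" by (rule diffeo_germ_linear) (auto intro: linearI)
  ultimately have "diagram_equiv f1 \<gamma>1 f2 \<gamma>2 g1 square_snd ?g2 square_fst"
    unfolding diagram_equiv_def using H1 g1(3) g2(3)
    by - (rule exI[of _ "\<lambda>t. t"], rule exI[of _ "\<lambda>t. t"], rule exI[of _ H1],
        rule exI[of _ "\<lambda>p. prod.swap (H2 p)"], rule exI[of _ K], simp add: fold_chart_def eq_commute)
  moreover have "D\<^sub>0 ?g2 v = D\<^sub>0 g2 (prod.swap v)" for v
    by (simp add: D0_compose[OF g2(1) swap] D0_linear[OF bounded_linear_swap])
  ultimately show ?thesis
    using g1 g2 by (intro that[of g1 ?g2] smooth_germ_compose[OF g2(1) swap])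
      (auto simp: swap_zero mult.commute)
qed

subsection \<open>Normalising the two functions\<close>

lemma ex_compatible_odd_germ_log:
  fixes Q :: "real \<Rightarrow> real"
  assumes Q: "smooth_germ Q" "Q 0 > 0"
  obtains k where "smooth_germ k" "\<And>y. k y > 0" "\<forall>\<^sub>F y in nhds 0. Q y * k ((y\<^sup>2 * Q y)\<^sup>2) = k y ^ 4"
proof -
  let ?p = "\<lambda>y. (y\<^sup>2 * Q y)\<^sup>2" and ?r = "\<lambda>y. y ^ 3 * (Q y)\<^sup>2"
  have p: "smooth_germ ?p" and r: "smooth_germ ?r" by (intro smooth_germ_intros Q)+
  have "?p = (\<lambda>y. y * ?r y)" by (simp add: fun_eq_iff power2_eq_square power3_eq_cube)
  then have Dp: "D\<^sub>0 ?p 1 = 0" using D0_mult_vanishing[OF r smooth_germ_ident] by simp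
  have \<rho>: "smooth_germ (\<lambda>y. 1/4 * ln (Q y))"
    by (intro smooth_germ_mult smooth_germ_const smooth_germ_ln Q)
  obtain \<kappa> where \<kappa>: "smooth_germ \<kappa>" "\<forall>\<^sub>F y in nhds 0. \<kappa> y = 1/4 * ln (Q y) + 1/4 * \<kappa> (?p y)"
    by (rule functional_equation_germ[OF p _ _ smooth_germ_const[of "1/4"] _ \<rho>]) (use Dp in auto)
  show ?thesis
  proof (rule that)
    show "smooth_germ (\<lambda>y. exp (\<kappa> y))" by (rule smooth_germ_exp[OF \<kappa>(1)])
    show "\<forall>\<^sub>F y in nhds 0. Q y * exp (\<kappa> (?p y)) = exp (\<kappa> y) ^ 4"
      using \<kappa>(2) smooth_germ_eventually_pos[OF Q]
    proof eventually_elim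
      case (elim y)
      have "exp (\<kappa> y) ^ 4 = exp (4 * \<kappa> y)" by (simp add: exp_of_nat_mult[of 4, symmetric])
      also have "4 * \<kappa> y = ln (Q y) + \<kappa> (?p y)" using elim(1) by simp
      finally show ?case using elim(2) by (simp add: exp_add)
    qed
  qed simp
qed

lemma ex_compatible_odd_germ:
  fixes r s :: "real \<Rightarrow> real"
  assumes r: "smooth_germ r" "r 0 = 0" "D\<^sub>0 r 1 > 0" and s: "smooth_germ s" "s 0 = 0" "D\<^sub>0 s 1 > 0"
  obtains k where "smooth_germ k" "\<And>y. k y > 0"
    "\<forall>\<^sub>F y in nhds 0. r ((s y)\<^sup>2) * k ((r ((s y)\<^sup>2))\<^sup>2) = (y * (k y)\<^sup>2)\<^sup>2"
proof -
  obtain R where R: "smooth_germ R" "\<forall>\<^sub>F x in nhds 0. r x = x *\<^sub>R R x" "R 0 = D\<^sub>0 r 1"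
    by (rule hadamard_division_real[OF r(1,2)])
  obtain S where S: "smooth_germ S" "\<forall>\<^sub>F y in nhds 0. s y = y *\<^sub>R S y" "S 0 = D\<^sub>0 s 1"
    by (rule hadamard_division_real[OF s(1,2)])
  let ?Q = "\<lambda>y. (S y)\<^sup>2 * R ((s y)\<^sup>2)"
  have s2: "smooth_germ (\<lambda>y. (s y)\<^sup>2)" "(s 0)\<^sup>2 = 0" using s by (auto intro: smooth_germ_power)
  have Q: "smooth_germ ?Q" "?Q 0 > 0"
    using R(3) S(3) r(3) s(2,3) by (auto intro!: smooth_germ_intros S(1) smooth_germ_compose[OF R(1) s2])
  have rs: "\<forall>\<^sub>F y in nhds 0. r ((s y)\<^sup>2) = y\<^sup>2 * ?Q y"
    using smooth_germ_eventually_compose[OF s2 R(2)] S(2)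
    by eventually_elim (simp add: power_mult_distrib)
  obtain k where k: "smooth_germ k" "\<And>y. k y > 0"
    "\<forall>\<^sub>F y in nhds 0. ?Q y * k ((y\<^sup>2 * ?Q y)\<^sup>2) = k y ^ 4"
    by (rule ex_compatible_odd_germ_log[OF Q]) (rule that)
  have "\<forall>\<^sub>F y in nhds 0. r ((s y)\<^sup>2) * k ((r ((s y)\<^sup>2))\<^sup>2) = (y * (k y)\<^sup>2)\<^sup>2"
    using rs k(3)
  proof eventually_elim
    case (elim y)
    have "r ((s y)\<^sup>2) * k ((r ((s y)\<^sup>2))\<^sup>2) = y\<^sup>2 * (?Q y * k ((y\<^sup>2 * ?Q y)\<^sup>2))"
      unfolding elim(1) by (simp only: mult.assoc)
    also have "\<dots> = (y * (k y)\<^sup>2)\<^sup>2" unfolding elim(2) by (simp add: power_mult_distrib)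
    finally show ?case .
  qed
  then show ?thesis by (rule that[OF k(1,2)])
qed

lemma whitney_decomposition_odd_on_axis:
  fixes f :: "real \<times> real \<Rightarrow> real"
  assumes f: "smooth_germ f" "\<forall>\<^sub>F y in nhds 0. f (0, y) = y * k (y\<^sup>2)" and k: "smooth_germ k"
  obtains a b where "smooth_germ a" "\<And>y. a (0, y) = 0" "smooth_germ b" "\<And>y. b (0, y) = k y"
    "\<forall>\<^sub>F p in nhds 0. f p = a (square_snd p) + snd p * b (square_snd p)"
proof -
  obtain a b where a: "smooth_germ a" and b: "smooth_germ b"
    and ab: "\<forall>\<^sub>F p in nhds 0. f p = a (square_snd p) + snd p * b (square_snd p)"
    by (rule whitney_decomposition[OF f(1)]) (rule that, auto simp: square_snd_def)
  have neg: "\<forall>\<^sub>F y in nhds 0. P (- y)" if "\<forall>\<^sub>F y in nhds (0::real). P y" for P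
    by (rule smooth_germ_eventually_compose[OF smooth_germ_minus[OF smooth_germ_ident] _ that]) simp
  have ab_axis: "\<forall>\<^sub>F y in nhds 0. y * k (y\<^sup>2) = a (0, y\<^sup>2) + y * b (0, y\<^sup>2)"
    using f(2) eventually_axis_snd[OF ab] by eventually_elim (simp add: square_snd_def)
  have "\<forall>\<^sub>F y in nhds 0. a (0, y\<^sup>2) = 0 \<and> y * b (0, y\<^sup>2) = y * k (y\<^sup>2)"
    using ab_axis neg[OF ab_axis] by eventually_elim auto
  from smooth_germ_eventually_compose[OF smooth_germ_snd[OF smooth_germ_ident] _ this]
  have axis: "\<forall>\<^sub>F p :: real \<times> real in nhds 0.
      a (0, (snd p)\<^sup>2) = 0 \<and> snd p * b (0, (snd p)\<^sup>2) = snd p * k ((snd p)\<^sup>2)" by simp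
  have axis_snd: "smooth_germ (\<lambda>p :: real \<times> real. c (0, snd p))" if "smooth_germ c"
    for c :: "real \<times> real \<Rightarrow> real"
    by (rule smooth_germ_compose[OF smooth_germ_restrict_snd[OF that]
        smooth_germ_snd[OF smooth_germ_ident]]) simp
  show ?thesis
  proof (rule that)
    show "smooth_germ (\<lambda>p. a p - a (0, snd p))" by (intro smooth_germ_diff a axis_snd)
    show "smooth_germ (\<lambda>p. b p + k (snd p) - b (0, snd p))"
      by (intro smooth_germ_diff smooth_germ_add b axis_snd smooth_germ_compose[OF k]
          smooth_germ_intros) simp
    show "\<forall>\<^sub>F p in nhds 0. f p = a (square_snd p) - a (0, snd (square_snd p))
        + snd p * (b (square_snd p) + k (snd (square_snd p)) - b (0, snd (square_snd p)))"
      using ab axis by eventually_elim (simp add: square_snd_def algebra_simps)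
  qed simp_all
qed

lemma normalise_first_function:
  fixes f :: "real \<times> real \<Rightarrow> real"
  assumes f: "smooth_germ f" "\<forall>\<^sub>F y in nhds 0. f (0, y) = y * k (y\<^sup>2)" "D\<^sub>0 f (1, 0) > 0"
    and k: "smooth_germ k" "k 0 > 0"
  obtains K N where "diffeo_germ K" "diffeo_germ N" "\<And>p. K (square_snd p) = square_snd (N p)"
    "\<forall>\<^sub>F p in nhds 0. f p = fst (N p) + snd (N p)"
    "\<And>y. K (0, y) = (0, y * (k y)\<^sup>2)" "\<forall>\<^sub>F x in nhds 0. K (x, 0) = (f (x, 0), 0)"
    "fst (D\<^sub>0 K (1, 0)) > 0"
proof -
  obtain a b where a: "smooth_germ a" "\<And>y. a (0, y) = 0" and b: "smooth_germ b" "\<And>y. b (0, y) = k y"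
    and ab: "\<forall>\<^sub>F p in nhds 0. f p = a (square_snd p) + snd p * b (square_snd p)"
    by (rule whitney_decomposition_odd_on_axis[OF f(1,2) k(1)]) (rule that)
  have a0: "a 0 = 0" and b0: "b 0 > 0" using a(2)[of 0] b(2)[of 0] k(2) by (simp_all add: zero_prod_def)
  have f_axis: "\<forall>\<^sub>F x in nhds 0. f (x, 0) = a (x, 0)"
    using eventually_axis_fst[OF ab] by (simp add: square_snd_def)
  have Da: "D\<^sub>0 a (1, 0) > 0"
    using f(3) frechet_derivative_cong_eventually[OF f_axis] D0_restrict_fst[OF a(1), of 1]
      D0_restrict_fst[OF f(1), of 1]
    by simp
  note sq = smooth_germ_square_snd square_snd_zero
  define K where "K p = (a p, snd p * (b p)\<^sup>2)" for p
  define N where "N p = (a (square_snd p), snd p * b (square_snd p))" for p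
  have a_sq: "smooth_germ (\<lambda>p. a (square_snd p))" by (rule smooth_germ_compose[OF a(1) sq])
  have K: "diffeo_germ K"
    unfolding K_def[abs_def] using a0 b0 Da by (intro diffeo_germ_triangularI a smooth_germ_power b) auto
  show ?thesis
  proof (rule that[OF K])
    show "diffeo_germ N"
      unfolding N_def[abs_def] using a0 b0 Da sq(2)
      by (intro diffeo_germ_triangularI a_sq smooth_germ_compose[OF b(1) sq])
         (auto simp: D0_compose[OF a(1) sq] D0_square_snd)
    show "K (square_snd p) = square_snd (N p)" for p
      by (simp add: K_def N_def square_snd_def power_mult_distrib)
    show "\<forall>\<^sub>F p in nhds 0. f p = fst (N p) + snd (N p)" using ab by (simp add: N_def)
    show "K (0, y) = (0, y * (k y)\<^sup>2)" for y by (simp add: K_def a b)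
    show "\<forall>\<^sub>F x in nhds 0. K (x, 0) = (f (x, 0), 0)" using f_axis by eventually_elim (simp add: K_def)
    show "fst (D\<^sub>0 K (1, 0)) > 0"
      using Da D0_fst[OF diffeo_germ_smooth[OF K], of "(1, 0)"] by (simp add: K_def)
  qed
qed

lemma diffeo_germ_inverse_on_line:
  fixes N M :: "'a::euclidean_space \<Rightarrow> 'a"
  assumes N: "diffeo_germ N" and MN: "\<forall>\<^sub>F p in nhds 0. M (N p) = p" and "w \<noteq> 0"
    and \<alpha>: "smooth_germ \<alpha>" "\<forall>\<^sub>F t in nhds (0::real). N (t *\<^sub>R w) = \<alpha> t *\<^sub>R w"
  obtains \<beta> where "diffeo_germ \<beta>" "\<forall>\<^sub>F t in nhds 0. \<alpha> (\<beta> t) = t"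
    "\<forall>\<^sub>F t in nhds 0. M (t *\<^sub>R w) = \<beta> t *\<^sub>R w"
proof -
  have line: "bounded_linear (\<lambda>t::real. t *\<^sub>R w)" by (rule bounded_linear_scaleR_left)
  note line' = smooth_germ_linear[OF line] scaleR_zero_left
  have "\<alpha> 0 = 0"
    using eventually_nhds_x_imp_x[OF \<alpha>(2)] diffeo_germ_zero[OF N] \<open>w \<noteq> 0\<close> by simp
  have "D\<^sub>0 \<alpha> 1 *\<^sub>R w = D\<^sub>0 (\<lambda>t. \<alpha> t *\<^sub>R w) 1"
    using D0_linear_compose[OF line \<alpha>(1)] by simp
  also have "\<dots> = D\<^sub>0 N w"
    using frechet_derivative_cong_eventually[OF \<alpha>(2)] D0_compose[OF diffeo_germ_smooth[OF N] line', of 1]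
    by (simp add: D0_linear[OF line])
  finally have "D\<^sub>0 \<alpha> 1 *\<^sub>R w = D\<^sub>0 N w" .
  moreover have "D\<^sub>0 N w \<noteq> 0"
    using bij_D0_diffeo_germ[OF N] linear_0[OF linear_D0[OF diffeo_germ_smooth[OF N]]] \<open>w \<noteq> 0\<close>
    by (metis bij_def injD)
  ultimately have "diffeo_germ \<alpha>" using \<open>\<alpha> 0 = 0\<close> by (intro diffeo_germ_realI \<alpha>(1)) auto
  then obtain \<beta> where \<beta>: "diffeo_germ \<beta>" "\<forall>\<^sub>F t in nhds 0. \<alpha> (\<beta> t) = t" by (rule diffeo_germ_inverse)
  have "\<forall>\<^sub>F t in nhds 0. M (t *\<^sub>R w) = \<beta> t *\<^sub>R w"
    using \<beta>(2) diffeo_germ_eventually_compose[OF \<beta>(1) \<alpha>(2)]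
      diffeo_germ_eventually_compose[OF \<beta>(1) smooth_germ_eventually_compose[OF line' MN]]
    by eventually_elim metis
  then show ?thesis by (rule that[OF \<beta>])
qed

lemma ex_axis_flat_remainder:
  fixes f :: "real \<times> real \<Rightarrow> real" and N :: "real \<times> real \<Rightarrow> real \<times> real"
  assumes N: "diffeo_germ N" and f: "smooth_germ f" "f 0 = 0"
    and axis_fst: "\<forall>\<^sub>F x in nhds 0. N (x, 0) = (f (x, 0), 0)"
    and axis_snd: "\<forall>\<^sub>F y in nhds 0. N (0, y) = (0, f (0, y))"
  obtains \<theta> where "smooth_germ \<theta>" "\<theta> 0 = 0"
    "\<forall>\<^sub>F x in nhds 0. \<theta> (x, 0) = 0" "\<forall>\<^sub>F y in nhds 0. \<theta> (0, y) = 0"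
    "\<forall>\<^sub>F p in nhds 0. f p = fst (N p) + snd (N p) + \<theta> (N p)"
proof -
  obtain M where M: "diffeo_germ M" "\<forall>\<^sub>F p in nhds 0. M (N p) = p" by (rule diffeo_germ_inverse[OF N])
  obtain \<beta> where \<beta>: "diffeo_germ \<beta>" "\<forall>\<^sub>F t in nhds 0. f (\<beta> t, 0) = t"
    "\<forall>\<^sub>F t in nhds 0. M (t *\<^sub>R (1, 0)) = \<beta> t *\<^sub>R (1, 0)"
    by (rule diffeo_germ_inverse_on_line[OF N M(2) _ smooth_germ_restrict_fst[OF f(1)], of "(1, 0)"])
       (use axis_fst in \<open>auto simp: prod_eq_iff\<close>)
  obtain \<beta>' where \<beta>': "diffeo_germ \<beta>'" "\<forall>\<^sub>F t in nhds 0. f (0, \<beta>' t) = t"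
    "\<forall>\<^sub>F t in nhds 0. M (t *\<^sub>R (0, 1)) = \<beta>' t *\<^sub>R (0, 1)"
    by (rule diffeo_germ_inverse_on_line[OF N M(2) _ smooth_germ_restrict_snd[OF f(1)], of "(0, 1)"])
       (use axis_snd in \<open>auto simp: prod_eq_iff\<close>)
  show ?thesis
  proof (rule that[of "\<lambda>p. f (M p) - (fst p + snd p)"])
    show "smooth_germ (\<lambda>p. f (M p) - (fst p + snd p))"
      by (intro smooth_germ_intros smooth_germ_compose[OF f(1) diffeo_germ_smooth[OF M(1)]
          diffeo_germ_zero[OF M(1)]])
    show "f (M 0) - (fst 0 + snd 0) = 0" using f(2) diffeo_germ_zero[OF M(1)] by simp
    show "\<forall>\<^sub>F x in nhds 0. f (M (x, 0)) - (fst (x, 0) + snd (x, 0)) = 0"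
      using \<beta>(2,3) by eventually_elim simp
    show "\<forall>\<^sub>F y in nhds 0. f (M (0, y)) - (fst (0, y) + snd (0, y)) = 0"
      using \<beta>'(2,3) by eventually_elim simp
    show "\<forall>\<^sub>F p in nhds 0. f p = fst (N p) + snd (N p) + (f (M (N p)) - (fst (N p) + snd (N p)))"
      using M(2) by eventually_elim simp
  qed
qed

lemma ex_axis_coordinate:
  fixes u :: "real \<Rightarrow> real" and g :: "real \<Rightarrow> real"
  assumes u: "smooth_germ u" "u 0 = 0" and g: "smooth_germ g" "g 0 = 0" and pos: "D\<^sub>0 u 1 * D\<^sub>0 g 1 > 0"
  obtains h where "diffeo_germ h" "\<forall>\<^sub>F t in nhds 0. h (u t) = t" "D\<^sub>0 (\<lambda>t. h (g t)) 1 > 0"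
proof -
  have "diffeo_germ u" using pos by (intro diffeo_germ_realI u) auto
  then obtain h where h: "diffeo_germ h" "\<forall>\<^sub>F t in nhds 0. h (u t) = t" by (rule diffeo_germ_inverse)
  note h' = diffeo_germ_smooth[OF h(1)]
  have D: "D\<^sub>0 h x = x * D\<^sub>0 h 1" for x
    using linear_cmul[OF linear_D0[OF h'], of x 1] by simp
  have "D\<^sub>0 h (D\<^sub>0 u 1) = 1"
    using frechet_derivative_cong_eventually[OF h(2)] D0_compose[OF h' u, of 1] by simp
  then have "D\<^sub>0 u 1 * D\<^sub>0 h 1 = 1" using D by metis
  then have "D\<^sub>0 h 1 = 1 / D\<^sub>0 u 1" using pos
  by (metis eq_divide_imp mult.commute mult_zero_left less_irrefl)
  then have "D\<^sub>0 (\<lambda>t. h (g t)) 1 > 0"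
    using pos D0_compose[OF h' g, of 1] D[of "D\<^sub>0 g 1"]
    by (auto simp: zero_less_divide_iff zero_less_mult_iff)
  then show ?thesis by (rule that[OF h])
qed

lemma eventually_eq_if_square_eq:
  fixes f g :: "real \<Rightarrow> real"
  assumes f: "smooth_germ f" "f 0 = 0" "D\<^sub>0 f 1 > 0" and g: "smooth_germ g" "g 0 = 0" "D\<^sub>0 g 1 > 0"
    and sq: "\<forall>\<^sub>F t in nhds 0. (f t)\<^sup>2 = (g t)\<^sup>2"
  shows "\<forall>\<^sub>F t in nhds 0. f t = g t"
proof -
  obtain F where F: "smooth_germ F" "\<forall>\<^sub>F t in nhds 0. f t = t *\<^sub>R F t" "F 0 = D\<^sub>0 f 1"
    by (rule hadamard_division_real[OF f(1,2)])
  obtain G where G: "smooth_germ G" "\<forall>\<^sub>F t in nhds 0. g t = t *\<^sub>R G t" "G 0 = D\<^sub>0 g 1"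
    by (rule hadamard_division_real[OF g(1,2)])
  have "F 0 > 0" "G 0 > 0" using f(3) g(3) F(3) G(3) by simp_all
  from smooth_germ_eventually_pos[OF F(1) this(1)] smooth_germ_eventually_pos[OF G(1) this(2)] sq
      F(2) G(2)
  show ?thesis
  proof eventually_elim
    case (elim t)
    then have "t = 0 \<or> (F t)\<^sup>2 = (G t)\<^sup>2" by (simp add: power_mult_distrib)
    then have "t = 0 \<or> F t = G t" using elim(1,2) by (simp add: power2_eq_iff_nonneg)
    then show ?case using elim(4,5) by auto
  qed
qed

text \<open>A lift \<open>N\<close> of \<open>K\<close> through the second fold is determined up to the sign of its first
  component, so its restriction to an axis can be read off from squares.\<close>

lemma ex_lift_square_fst_axes:
  fixes K :: "real \<times> real \<Rightarrow> real \<times> real" and b c s :: "real \<Rightarrow> real"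
  assumes K: "diffeo_germ K" "fst (D\<^sub>0 K (1, 0)) > 0"
    and K_axes: "\<And>y. K (0, y) = (0, y * b y)" "\<forall>\<^sub>F x in nhds 0. K (x, 0) = (c x, 0)"
    and b: "smooth_germ b" "b 0 > 0" and s: "smooth_germ s" "s 0 = 0" "D\<^sub>0 s 1 > 0"
    and compat: "\<forall>\<^sub>F y in nhds 0. c ((s y)\<^sup>2) = (y * b y)\<^sup>2"
  obtains \<alpha> N where "diffeo_germ \<alpha>" "diffeo_germ N"
    "\<forall>\<^sub>F p in nhds 0. K (square_fst p) = square_fst (N p)"
    "\<forall>\<^sub>F x in nhds 0. N (x, 0) = (\<alpha> x, 0)" "\<forall>\<^sub>F y in nhds 0. N (0, y) = (0, \<alpha> (s y))"
proof -
  have K_axis: "\<forall>\<^sub>F y in nhds 0. fst (K (0, y)) = 0" by (simp add: K_axes)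
  obtain e where e: "smooth_germ e" "e 0 > 0"
    and N: "diffeo_germ (\<lambda>p. (fst p * e p, snd (K (square_fst p))))"
    and lift: "\<forall>\<^sub>F p in nhds 0. K (square_fst p) = square_fst (fst p * e p, snd (K (square_fst p)))"
    by (rule lift_square_fst[OF K(1) K_axis K(2)]) (rule that)
  define \<alpha> where "\<alpha> x = x * e (x, 0)" for x
  have e_axis: "smooth_germ (\<lambda>x. e (x, 0))" "e (0, 0) > 0"
    using smooth_germ_restrict_fst[OF e(1)] e(2) by (simp_all add: zero_prod_def)
  have \<alpha>: "diffeo_germ \<alpha>" "D\<^sub>0 \<alpha> x = x * e (0, 0)" for x
    unfolding \<alpha>_def[abs_def] using D0_mult_vanishing[OF e_axis(1) smooth_germ_ident] e_axis(2)
    by (auto intro: diffeo_germ_ident_mult[OF e_axis(1)] simp: D0_linear[OF bounded_linear_ident])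
  have K_sq: "\<forall>\<^sub>F x in nhds 0. K (x\<^sup>2, 0) = (c (x\<^sup>2), 0)"
    by (rule smooth_germ_eventually_compose[OF smooth_germ_power[OF smooth_germ_ident] _ K_axes(2)]) simp
  have \<alpha>_sq: "\<forall>\<^sub>F x in nhds 0. (\<alpha> x)\<^sup>2 = c (x\<^sup>2)"
    using eventually_axis_fst[OF lift] K_sq by eventually_elim (simp add: square_fst_def \<alpha>_def)
  have \<alpha>_s: "\<forall>\<^sub>F y in nhds 0. \<alpha> (s y) = y * b y"
  proof (rule eventually_eq_if_square_eq)
    show "smooth_germ (\<lambda>y. \<alpha> (s y))" by (rule smooth_germ_compose[OF diffeo_germ_smooth[OF \<alpha>(1)] s(1,2)])
    show "smooth_germ (\<lambda>y. y * b y)" by (intro smooth_germ_mult smooth_germ_ident b(1))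
    show "D\<^sub>0 (\<lambda>y. \<alpha> (s y)) 1 > 0"
      using s(3) e_axis(2) by (simp add: D0_compose[OF diffeo_germ_smooth[OF \<alpha>(1)] s(1,2)] \<alpha>(2))
    show "D\<^sub>0 (\<lambda>y. y * b y) 1 > 0"
      using D0_mult_vanishing[OF b(1) smooth_germ_ident] b(2)
      by (simp add: D0_linear[OF bounded_linear_ident])
    show "\<forall>\<^sub>F y in nhds 0. (\<alpha> (s y))\<^sup>2 = (y * b y)\<^sup>2"
      using compat smooth_germ_eventually_compose[OF s(1,2) \<alpha>_sq] by eventually_elim simp
  qed (simp_all add: s(2) \<alpha>_def)
  show ?thesis
  proof (rule that[OF \<alpha>(1) N lift])
    show "\<forall>\<^sub>F x in nhds 0. (fst (x, 0) * e (x, 0), snd (K (square_fst (x, 0)))) = (\<alpha> x, 0)"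
      using K_sq by eventually_elim (simp add: square_fst_def \<alpha>_def)
    show "\<forall>\<^sub>F y in nhds 0. (fst (0, y) * e (0, y), snd (K (square_fst (0, y)))) = (0, \<alpha> (s y))"
      using \<alpha>_s by eventually_elim (simp add: square_fst_def K_axes(1))
  qed
qed

lemma ex_compatible_target_coordinates:
  fixes g1 g2 :: "real \<times> real \<Rightarrow> real"
  assumes g1: "smooth_germ g1" "g1 0 = 0" "D\<^sub>0 g1 (1, 0) * D\<^sub>0 g1 (0, 1) > 0"
    and g2: "smooth_germ g2" "g2 0 = 0" "D\<^sub>0 g2 (1, 0) * D\<^sub>0 g2 (0, 1) > 0"
  obtains h v k where "diffeo_germ h" "diffeo_germ v" "smooth_germ k" "\<And>y. k y > 0"
    "\<forall>\<^sub>F y in nhds 0. h (g1 (0, y)) = y * k (y\<^sup>2)" "D\<^sub>0 (\<lambda>p. h (g1 p)) (1, 0) > 0"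
    "\<forall>\<^sub>F x in nhds 0. v (g2 (x, 0)) = x" "D\<^sub>0 (\<lambda>y. v (g2 (0, y))) 1 > 0"
    "\<forall>\<^sub>F y in nhds 0. h (g1 ((v (g2 (0, y)))\<^sup>2, 0)) = (y * (k y)\<^sup>2)\<^sup>2"
proof -
  note axes = smooth_germ_restrict_fst smooth_germ_restrict_snd
  have zero: "g1 (0, 0) = 0" "g2 (0, 0) = 0" using g1(2) g2(2) by (simp_all add: zero_prod_def)
  have pos: "D\<^sub>0 (\<lambda>y. g1 (0, y)) 1 * D\<^sub>0 (\<lambda>x. g1 (x, 0)) 1 > 0"
    "D\<^sub>0 (\<lambda>x. g2 (x, 0)) 1 * D\<^sub>0 (\<lambda>y. g2 (0, y)) 1 > 0"
    using g1 g2 by (simp_all add: D0_restrict_fst D0_restrict_snd mult.commute)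
  obtain u where u: "diffeo_germ u" "\<forall>\<^sub>F y in nhds 0. u (g1 (0, y)) = y" "D\<^sub>0 (\<lambda>x. u (g1 (x, 0))) 1 > 0"
    by (rule ex_axis_coordinate[OF _ _ _ _ pos(1)]) (auto simp: zero intro: axes g1(1))
  obtain v where v: "diffeo_germ v" "\<forall>\<^sub>F x in nhds 0. v (g2 (x, 0)) = x" "D\<^sub>0 (\<lambda>y. v (g2 (0, y))) 1 > 0"
    by (rule ex_axis_coordinate[OF _ _ _ _ pos(2)]) (auto simp: zero intro: axes g2(1))
  define r where "r x = u (g1 (x, 0))" for x
  have r: "smooth_germ r" "r 0 = 0" "D\<^sub>0 r 1 > 0"
    using smooth_germ_compose[OF diffeo_germ_smooth[OF u(1)] axes(1)[OF g1(1)]] u(3)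
    by (simp_all add: r_def[abs_def] zero diffeo_germ_zero[OF u(1)])
  have s: "smooth_germ (\<lambda>y. v (g2 (0, y)))" "v (g2 (0, 0)) = 0"
    using smooth_germ_compose[OF diffeo_germ_smooth[OF v(1)] axes(2)[OF g2(1)]]
    by (simp_all add: zero diffeo_germ_zero[OF v(1)])
  obtain k where k: "smooth_germ k" "\<And>y. k y > 0" and compat: "\<forall>\<^sub>F y in nhds 0.
      r ((v (g2 (0, y)))\<^sup>2) * k ((r ((v (g2 (0, y)))\<^sup>2))\<^sup>2) = (y * (k y)\<^sup>2)\<^sup>2"
    by (rule ex_compatible_odd_germ[OF r s v(3)]) (rule that)
  define h where "h t = u t * k ((u t)\<^sup>2)" for t
  have k_sq: "smooth_germ (\<lambda>t. k (t\<^sup>2))"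
    by (rule smooth_germ_compose[OF k(1) smooth_germ_power[OF smooth_germ_ident]]) simp
  have h: "diffeo_germ h"
    unfolding h_def[abs_def]
    by (rule diffeo_germ_compose[OF diffeo_germ_ident_mult[OF k_sq] u(1)]) (use k(2)[of 0] in simp)
  show ?thesis
  proof (rule that[OF h v(1) k _ _ v(2,3)])
    show "\<forall>\<^sub>F y in nhds 0. h (g1 (0, y)) = y * k (y\<^sup>2)" using u(2) by eventually_elim (simp add: h_def)
    show "\<forall>\<^sub>F y in nhds 0. h (g1 ((v (g2 (0, y)))\<^sup>2, 0)) = (y * (k y)\<^sup>2)\<^sup>2"
      using compat by (simp add: h_def r_def)
    have "smooth_germ (\<lambda>p. h (g1 p))" by (rule smooth_germ_compose[OF diffeo_germ_smooth[OF h] g1(1,2)])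
    then have "D\<^sub>0 (\<lambda>p. h (g1 p)) (1, 0) = D\<^sub>0 (\<lambda>x. r x * k ((r x)\<^sup>2)) 1"
      using D0_restrict_fst[of "\<lambda>p. h (g1 p)" 1] by (simp add: h_def r_def)
    also have "\<dots> = D\<^sub>0 r 1 * k 0"
      using D0_mult_vanishing[OF smooth_germ_compose[OF k_sq r(1,2)] r(1,2)] r(2) by simp
    finally show "D\<^sub>0 (\<lambda>p. h (g1 p)) (1, 0) > 0" using r(3) k(2) by simp
  qed
qed

lemma normalise_functions:
  fixes g1 g2 :: "real \<times> real \<Rightarrow> real"
  assumes g1: "smooth_germ g1" "g1 0 = 0" "D\<^sub>0 g1 (1, 0) * D\<^sub>0 g1 (0, 1) > 0"
    and g2: "smooth_germ g2" "g2 0 = 0" "D\<^sub>0 g2 (1, 0) * D\<^sub>0 g2 (0, 1) > 0"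
  obtains \<theta> where "smooth_germ \<theta>" "\<theta> 0 = 0" "\<forall>\<^sub>F x in nhds 0. \<theta> (x, 0) = 0"
    "\<forall>\<^sub>F y in nhds 0. \<theta> (0, y) = 0"
    "diagram_equiv g1 square_snd g2 square_fst
       (\<lambda>p. fst p + snd p) square_snd (\<lambda>p. fst p + snd p + \<theta> p) square_fst"
proof -
  obtain h1 v k where h1: "diffeo_germ h1" and v: "diffeo_germ v" and k: "smooth_germ k" "\<And>y. k y > 0"
    and f1: "\<forall>\<^sub>F y in nhds 0. h1 (g1 (0, y)) = y * k (y\<^sup>2)" "D\<^sub>0 (\<lambda>p. h1 (g1 p)) (1, 0) > 0"
    and v_axes: "\<forall>\<^sub>F x in nhds 0. v (g2 (x, 0)) = x" "D\<^sub>0 (\<lambda>y. v (g2 (0, y))) 1 > 0"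
    and compat: "\<forall>\<^sub>F y in nhds 0. h1 (g1 ((v (g2 (0, y)))\<^sup>2, 0)) = (y * (k y)\<^sup>2)\<^sup>2"
    by (rule ex_compatible_target_coordinates[OF g1 g2]) (rule that)
  obtain K N1 where K: "diffeo_germ K" and N1: "diffeo_germ N1"
    "\<And>p. K (square_snd p) = square_snd (N1 p)"
      "\<forall>\<^sub>F p in nhds 0. h1 (g1 p) = fst (N1 p) + snd (N1 p)"
    and K_axes: "\<And>y. K (0, y) = (0, y * (k y)\<^sup>2)" "\<forall>\<^sub>F x in nhds 0. K (x, 0) = (h1 (g1 (x, 0)), 0)"
      "fst (D\<^sub>0 K (1, 0)) > 0"
    by (rule normalise_first_function[OF smooth_germ_compose[OF diffeo_germ_smooth[OF h1] g1(1,2)]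
        f1 k]) (rule that)
  have s: "smooth_germ (\<lambda>y. v (g2 (0, y)))" "v (g2 (0, 0)) = 0"
    using smooth_germ_compose[OF diffeo_germ_smooth[OF v] smooth_germ_restrict_snd[OF g2(1)]]
      g2(2) diffeo_germ_zero[OF v] by (simp_all add: zero_prod_def)
  have "(k 0)\<^sup>2 > 0" using k(2)[of 0] by simp
  from ex_lift_square_fst_axes[OF K K_axes(3,1,2) smooth_germ_power[OF k(1)] this s v_axes(2) compat]
  obtain \<alpha> N2 where \<alpha>: "diffeo_germ \<alpha>" and N2: "diffeo_germ N2"
    "\<forall>\<^sub>F p in nhds 0. K (square_fst p) = square_fst (N2 p)"
      "\<forall>\<^sub>F x in nhds 0. N2 (x, 0) = (\<alpha> x, 0)" "\<forall>\<^sub>F y in nhds 0. N2 (0, y) = (0, \<alpha> (v (g2 (0, y))))" .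
  define h2 where "h2 t = \<alpha> (v t)" for t
  have h2: "diffeo_germ h2" unfolding h2_def[abs_def] by (rule diffeo_germ_compose[OF \<alpha> v])
  obtain \<theta> where \<theta>: "smooth_germ \<theta>" "\<theta> 0 = 0" "\<forall>\<^sub>F x in nhds 0. \<theta> (x, 0) = 0"
    "\<forall>\<^sub>F y in nhds 0. \<theta> (0, y) = 0"
    and h2g2: "\<forall>\<^sub>F p in nhds 0. h2 (g2 p) = fst (N2 p) + snd (N2 p) + \<theta> (N2 p)"
  proof (rule ex_axis_flat_remainder[OF N2(1) smooth_germ_compose[OF diffeo_germ_smooth[OF h2] g2(1,2)]])
    show "\<forall>\<^sub>F x in nhds 0. N2 (x, 0) = (h2 (g2 (x, 0)), 0)"
      using N2(3) v_axes(1) by eventually_elim (simp add: h2_def)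
    show "\<forall>\<^sub>F y in nhds 0. N2 (0, y) = (0, h2 (g2 (0, y)))" using N2(4) by (simp add: h2_def)
  qed (use diffeo_germ_zero[OF h2] g2(2) in simp)
  have "diagram_equiv g1 square_snd g2 square_fst
      (\<lambda>p. fst p + snd p) square_snd (\<lambda>p. fst p + snd p + \<theta> p) square_fst"
    unfolding diagram_equiv_def
    by (rule exI[of _ h1], rule exI[of _ h2], rule exI[of _ N1], rule exI[of _ N2], rule exI[of _ K])
       (simp add: h1 h2 N1 N2(1,2) K h2g2)
  then show ?thesis by (rule that[OF \<theta>])
qed

theorem theoremA:
  fixes f1 f2 :: "real \<times> real \<Rightarrow> real" and \<gamma>1 \<gamma>2 :: "real \<times> real \<Rightarrow> real \<times> real"
  assumes "typeIII_III f1 \<gamma>1 f2 \<gamma>2"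
  shows "\<exists>\<theta> :: real \<times> real \<Rightarrow> real.
           smooth_germ \<theta> \<and> \<theta> 0 = 0 \<and>
           (\<forall>\<^sub>F x in nhds 0. \<theta> (x, 0) = 0) \<and> (\<forall>\<^sub>F y in nhds 0. \<theta> (0, y) = 0) \<and>
           diagram_equiv f1 \<gamma>1 f2 \<gamma>2
             (\<lambda>(x, y). x + y) (\<lambda>(x, y). (x, y ^ 2))
             (\<lambda>(x, y). x + y + \<theta> (x, y)) (\<lambda>(x, y). (x ^ 2, y))"
proof -
  obtain g1 g2 where g1: "smooth_germ g1" "g1 0 = 0" "D\<^sub>0 g1 (1, 0) * D\<^sub>0 g1 (0, 1) > 0"
    and g2: "smooth_germ g2" "g2 0 = 0" "D\<^sub>0 g2 (1, 0) * D\<^sub>0 g2 (0, 1) > 0"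
    and straightened: "diagram_equiv f1 \<gamma>1 f2 \<gamma>2 g1 square_snd g2 square_fst"
    by (rule typeIII_III_equiv_square_maps[OF assms])
  obtain \<theta> where \<theta>: "smooth_germ \<theta>" "\<theta> 0 = 0" "\<forall>\<^sub>F x in nhds 0. \<theta> (x, 0) = 0"
    "\<forall>\<^sub>F y in nhds 0. \<theta> (0, y) = 0"
    and normalised: "diagram_equiv g1 square_snd g2 square_fst
      (\<lambda>p. fst p + snd p) square_snd (\<lambda>p. fst p + snd p + \<theta> p) square_fst"
    by (rule normalise_functions[OF g1 g2])
  have "diagram_equiv f1 \<gamma>1 f2 \<gamma>2
      (\<lambda>p. fst p + snd p) square_snd (\<lambda>p. fst p + snd p + \<theta> p) square_fst"
    by (rule diagram_equiv_trans[OF straightened normalised])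
  then show ?thesis
    using \<theta> by (intro exI[of _ \<theta>]) (simp add: case_prod_unfold square_snd_def[abs_def]
        square_fst_def[abs_def])
qed

end
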